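(* Let $\alpha<2$, $c\in\mathbb{R}$, $c+1-\alpha>0$ and $0\le V\in L^1_{loc}(\mathbb{R}^+,y^{c-\alpha}\,dy)$. Then the operator $y^\alpha B^n-V$ generates a contractive analytic semigroup in $L^2_{c-\alpha}$. If, in addition, (i) $c<3-\alpha$ and $V\in L^2_{loc}(\mathbb{R}^+,y^{c-\alpha}\,dy)$, or (ii) $c=3-\alpha$ and $V|\log y|^{\frac12}\in L^2_{loc}(\mathbb{R}^+,y^{c-\alpha}\,dy)$, or (iii) $c>3-\alpha$ and $Vy^{\frac{3-c-\alpha}{2}}\in L^2_{loc}(\mathbb{R}^+,y^{c-\alpha}\,dy)$, then $$\mathcal{D}=\left\{u\in C_c^\infty([0,\infty)):\ u\ \text{constant in a neighborhood of } 0\right\}$$ is a core for $y^\alpha B^n-V$ in $L^2_{c-\alpha}$.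
   Context: $\mathbb{R}_+=(0,\infty)$; $L^2_k=L^2(\mathbb{R}_+,y^k\,dy)$. $W\in L^q_{loc}(\mathbb{R}^+,y^k\,dy)$ means $W\in L^q([0,b],y^k\,dy)$ for every $0<b<\infty$. Formally $y^\alpha B-V=y^\alpha\left(D_{yy}+\frac cyD_y\right)-V$; $y^\alpha B^n-V$ in $L^2_{c-\alpha}$ is the operator associated with the form $$\mathfrak{a}_{\alpha,V}(u,v)=\int_0^\infty\left(y^\alpha D_yu\,D_y\overline v+Vu\overline v\right)y^{c-\alpha}\,dy,\qquad D(\mathfrak{a}_{\alpha,V})=\{u\in L^2_{c-\alpha}:u'\in L^2_c,\ V^{1/2}u\in L^2_{c-\alpha}\},$$ i.e. $u\in D(y^\alpha B^n-V)$ and $y^\alpha B^nu-Vu=-f$ iff $u\in D(\mathfrak{a}_{\alpha,V})$, $f\in L^2_{c-\alpha}$ and $\mathfrak{a}_{\alpha,V}(u,v)=\int_0^\infty f\overline v\,y^{c-\alpha}dy$ for all $v\in D(\mathfrak{a}_{\alpha,V})$.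
   Formalization: In (ii) V ∈ L²_loc(y^{c-α}dy) is assumed in addition to V|log y|^{1/2} ∈ L²_loc: |log y| vanishes at y=1, so V=|y-1|^{-3/4} near 1 meets (ii) as written but 𝒟 is not in the domain; V ∈ L²_loc is necessary for the core claim. *)

theory Defs
  imports "HOL-Analysis.Analysis"
begin

(* Elements of L^2(M) are represented by functions; everything below is invariant under
   modification on null sets, and equalities between elements are stated almost everywhere. *)

definition L2 :: "'a measure \<Rightarrow> ('a \<Rightarrow> complex) set" where
  "L2 M = {f. f \<in> borel_measurable M \<and> integrable M (\<lambda>x. (cmod (f x))\<^sup>2)}"

definition l2norm :: "'a measure \<Rightarrow> ('a \<Rightarrow> complex) \<Rightarrow> real" where
  "l2norm M f = sqrt (LINT x|M. (cmod (f x))\<^sup>2)"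

(* Compatibility with almost everywhere equality follows from linearity and the bound. *)
definition bounded_operator :: "'a measure \<Rightarrow> (('a \<Rightarrow> complex) \<Rightarrow> ('a \<Rightarrow> complex)) \<Rightarrow> bool" where
  "bounded_operator M S \<longleftrightarrow>
     (\<forall>f\<in>L2 M. S f \<in> L2 M) \<and>
     (\<forall>f\<in>L2 M. \<forall>g\<in>L2 M. \<forall>a b. AE x in M. S (\<lambda>t. a * f t + b * g t) x = a * S f x + b * S g x) \<and>
     (\<exists>K. \<forall>f\<in>L2 M. l2norm M (S f) \<le> K * l2norm M f)"

definition sector :: "real \<Rightarrow> complex set" where
  "sector \<theta> = {z. z \<noteq> 0 \<and> \<bar>Arg z\<bar> < \<theta>}"

(* Complex differentiability in the operator norm. *)
definition operator_holomorphic_on ::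
    "'a measure \<Rightarrow> (complex \<Rightarrow> ('a \<Rightarrow> complex) \<Rightarrow> ('a \<Rightarrow> complex)) \<Rightarrow> complex set \<Rightarrow> bool" where
  "operator_holomorphic_on M T S \<longleftrightarrow>
     (\<forall>z\<in>S. \<exists>D. bounded_operator M D \<and>
        (\<forall>\<epsilon>>0. \<forall>\<^sub>F w in at z within S. \<forall>f\<in>L2 M.
           l2norm M (\<lambda>x. (T w f x - T z f x) / (w - z) - D f x) \<le> \<epsilon> * l2norm M f))"

definition analytic_semigroup ::
    "'a measure \<Rightarrow> real \<Rightarrow> (complex \<Rightarrow> ('a \<Rightarrow> complex) \<Rightarrow> ('a \<Rightarrow> complex)) \<Rightarrow> bool" where
  "analytic_semigroup M \<theta> T \<longleftrightarrow>
     0 < \<theta> \<and> \<theta> \<le> pi / 2 \<and>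
     (\<forall>z\<in>insert 0 (sector \<theta>). bounded_operator M (T z)) \<and>
     (\<forall>f\<in>L2 M. AE x in M. T 0 f x = f x) \<and>
     (\<forall>z\<in>sector \<theta>. \<forall>w\<in>sector \<theta>. \<forall>f\<in>L2 M. AE x in M. T (z + w) f x = T z (T w f) x) \<and>
     operator_holomorphic_on M T (sector \<theta>) \<and>
     (\<forall>\<theta>'. 0 < \<theta>' \<and> \<theta>' < \<theta> \<longrightarrow> (\<forall>f\<in>L2 M.
        ((\<lambda>z. l2norm M (\<lambda>x. T z f x - f x)) \<longlongrightarrow> 0) (at 0 within sector \<theta>')))"

(* Unbounded operators are given by their graphs. *)
definition generator ::
    "'a measure \<Rightarrow> (complex \<Rightarrow> ('a \<Rightarrow> complex) \<Rightarrow> ('a \<Rightarrow> complex)) \<Rightarrow> (('a \<Rightarrow> complex) \<times> ('a \<Rightarrow> complex)) set" where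
  "generator M T = {(u, g). u \<in> L2 M \<and> g \<in> L2 M \<and>
     ((\<lambda>t::real. l2norm M (\<lambda>x. (T (of_real t) u x - u x) / of_real t - g x)) \<longlongrightarrow> 0) (at_right 0)}"

definition generates_contractive_analytic_semigroup ::
    "'a measure \<Rightarrow> (('a \<Rightarrow> complex) \<times> ('a \<Rightarrow> complex)) set \<Rightarrow> bool" where
  "generates_contractive_analytic_semigroup M A \<longleftrightarrow>
     (\<exists>\<theta> T. analytic_semigroup M \<theta> T \<and>
        (\<forall>z\<in>sector \<theta>. \<forall>f\<in>L2 M. l2norm M (T z f) \<le> l2norm M f) \<and>
        generator M T = A)"

(* D is contained in the domain of A and dense in it for the graph norm. *)
definition is_core ::
    "'a measure \<Rightarrow> (('a \<Rightarrow> complex) \<times> ('a \<Rightarrow> complex)) set \<Rightarrow> ('a \<Rightarrow> complex) set \<Rightarrow> bool" where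
  "is_core M A D \<longleftrightarrow> D \<subseteq> Domain A \<and>
     (\<forall>(u, g)\<in>A. \<forall>\<epsilon>>0. \<exists>(v, h)\<in>A. v \<in> D \<and>
        l2norm M (\<lambda>x. u x - v x) < \<epsilon> \<and> l2norm M (\<lambda>x. g x - h x) < \<epsilon>)"

(* The measure y^k dy on the open half-line; L2 (wmeas k) is the space L^2_k. *)
definition wmeas :: "real \<Rightarrow> real measure" where
  "wmeas k = density (lebesgue_on {0<..}) (\<lambda>y. ennreal (y powr k))"

(* Integrability on [0,b] for every b: the condition is not local at 0. *)
definition Lq_loc :: "real \<Rightarrow> real \<Rightarrow> (real \<Rightarrow> real) set" where
  "Lq_loc q k = {W. W \<in> borel_measurable (wmeas k) \<and>
     (\<forall>b>0. set_integrable (wmeas k) {0..b} (\<lambda>y. \<bar>W y\<bar> powr q))}"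

(* Derivatives are one-sided at endpoints belonging to S; values outside S are irrelevant. *)
definition smooth_on :: "real set \<Rightarrow> (real \<Rightarrow> complex) \<Rightarrow> bool" where
  "smooth_on S u \<longleftrightarrow> (\<exists>D::nat \<Rightarrow> real \<Rightarrow> complex. D 0 = u \<and>
     (\<forall>n. \<forall>y\<in>S. (D n has_vector_derivative D (Suc n) y) (at y within S)))"

definition test_functions :: "(real \<Rightarrow> complex) set" where
  "test_functions = {\<phi>. smooth_on {0<..} \<phi> \<and> (\<exists>a b. 0 < a \<and> (\<forall>y>0. y \<notin> {a..b} \<longrightarrow> \<phi> y = 0))}"

definition has_weak_deriv :: "(real \<Rightarrow> complex) \<Rightarrow> (real \<Rightarrow> complex) \<Rightarrow> bool" where
  "has_weak_deriv u w \<longleftrightarrow>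
     (\<forall>a b. 0 < a \<longrightarrow> set_integrable lebesgue {a..b} u \<and> set_integrable lebesgue {a..b} w) \<and>
     (\<forall>\<phi>\<in>test_functions.
        (LINT y:{0<..}|lebesgue. u y * vector_derivative \<phi> (at y)) = - (LINT y:{0<..}|lebesgue. w y * \<phi> y))"

(* Determined up to null sets whenever a weak derivative exists. *)
definition wderiv :: "(real \<Rightarrow> complex) \<Rightarrow> real \<Rightarrow> complex" where
  "wderiv u = (SOME w. has_weak_deriv u w)"

definition form_dom :: "real \<Rightarrow> real \<Rightarrow> (real \<Rightarrow> real) \<Rightarrow> (real \<Rightarrow> complex) set" where
  "form_dom \<alpha> c V = {u \<in> L2 (wmeas (c - \<alpha>)).
     (\<exists>w. has_weak_deriv u w \<and> w \<in> L2 (wmeas c)) \<and>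
     (\<lambda>y. of_real (sqrt (V y)) * u y) \<in> L2 (wmeas (c - \<alpha>))}"

definition form :: "real \<Rightarrow> real \<Rightarrow> (real \<Rightarrow> real) \<Rightarrow> (real \<Rightarrow> complex) \<Rightarrow> (real \<Rightarrow> complex) \<Rightarrow> complex" where
  "form \<alpha> c V u v = (LINT y|wmeas (c - \<alpha>).
     of_real (y powr \<alpha>) * wderiv u y * cnj (wderiv v y) + of_real (V y) * u y * cnj (v y))"

(* Graph of y^alpha B^n - V in L^2_{c-alpha}: pairs (u, -f) with form u v = <f, v>
   for all v in the form domain. *)
definition neumann_op ::
    "real \<Rightarrow> real \<Rightarrow> (real \<Rightarrow> real) \<Rightarrow> ((real \<Rightarrow> complex) \<times> (real \<Rightarrow> complex)) set" where
  "neumann_op \<alpha> c V = {(u, g). u \<in> form_dom \<alpha> c V \<and> g \<in> L2 (wmeas (c - \<alpha>)) \<and>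
     (\<forall>v\<in>form_dom \<alpha> c V. form \<alpha> c V u v = (LINT y|wmeas (c - \<alpha>). - g y * cnj (v y)))}"

definition core_functions :: "(real \<Rightarrow> complex) set" where
  "core_functions = {u. smooth_on {0..} u \<and> (\<exists>b. \<forall>y\<ge>b. u y = 0) \<and>
     (\<exists>\<epsilon>>0. \<exists>k. \<forall>y\<in>{0..<\<epsilon>}. u y = k)}"

end

theory Submission
  imports Defs "HOL-Computational_Algebra.Polynomial"
begin

text \<open>
  Sending a function \<open>u\<close> of the form domain to the triple \<open>(u, u', V\<^sup>1\<^sup>/\<^sup>2 u)\<close> identifies the
  form domain with a closed subspace of a product of \<open>L\<^sup>2\<close> spaces, and the resolvent
  \<open>R = (1 - A)\<inverse>\<close> of the operator is the compression to the first factor of the orthogonal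
  projection onto that subspace. Hence \<open>0 \<le> R \<le> 1\<close> is self-adjoint with dense range, and the
  semigroup is \<open>T z = E\<^sub>z R\<close> with \<open>E\<^sub>z t = exp (- z (1 / t - 1))\<close>, defined by the continuous
  functional calculus of \<open>R\<close>: all its properties, on the whole right half-plane, become
  statements about the sup norm on \<open>[0, 1]\<close>.

  Each of the conditions (i) to (iii) implies that \<open>V\<close> is locally square integrable, and this
  suffices for the core. If \<open>h\<close> is orthogonal to \<open>\<phi> - A \<phi>\<close> for all \<open>\<phi>\<close> in \<open>\<D>\<close>, then, as the
  functions \<open>y\<^sup>c \<phi>'\<close> are precisely the test functions, \<open>y\<^sup>c h' = H\<close> where \<open>H(y)\<close> is the integral
  of \<open>(1 + V) h s\<^sup>c\<^sup>-\<^sup>\<alpha>\<close> over \<open>(0, y)\<close>. For real \<open>h\<close>, if \<open>h\<close> and \<open>H\<close> had the same sign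
  at some point, \<open>\<bar>h\<bar>\<close> would increase from there on, contradicting square integrability; so
  \<open>(h\<^sup>2)' = 2 h H y\<^sup>-\<^sup>c \<le> 0\<close>. If \<open>h(y)\<close> did not vanish, \<open>h\<close> would have a constant sign on
  \<open>(0, y]\<close>, and \<open>H(y)\<close> would have the same sign, a contradiction.
\<close>

section \<open>Orthogonal projections\<close>

text \<open>\<open>generator\<close> demands equality of graphs and A is unbounded, so A itself is
  never manipulated: (u, g) lies in its graph iff u = R (u - g), and this equation with the bounded
  R carries both the generator and the core statement. The calculus uses no spectral measure: p(R)
  is positive for p \<ge> 0 on [0, 1] because the Bernstein polynomials are positive in R, and
  positivity of B^2 - p^2 is the norm bound that permits uniform limits. The Hilbert space is real,
  made of complex functions with the real part of the inner product; multiplication by i is an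
  isometry J commuting with R, and a complex symbol acts as Re + J Im. All weights are reduced to
  one space by f -> y^(k/2) f, so that a triple may mix the weights c - \<alpha> and c. The obstacle
  at the core is the endpoint 0: an element h of the orthogonal complement is only weakly
  differentiable inside the half-line and carries no boundary condition. Core functions may take any
  constant value near 0, whereas test functions vanish there; this additional freedom fixes the
  constant of integration, so that y^c h' is an integral starting exactly at 0.\<close>

lemma orthogonal_projection_exists:
  fixes S :: "'a::{real_inner,banach} set"
  assumes "subspace S" "closed S"
  shows "\<exists>p\<in>S. \<forall>y\<in>S. inner (x - p) y = 0"
proof -
  define d where "d = (INF y\<in>S. (norm (x - y))\<^sup>2)"
  have ne: "S \<noteq> {}" using assms(1) subspace_0 by blast
  have bdd: "bdd_below ((\<lambda>y. (norm (x - y))\<^sup>2) ` S)"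
    by (rule bdd_belowI[of _ 0]) auto
  have d_le: "d \<le> (norm (x - y))\<^sup>2" if "y \<in> S" for y
    unfolding d_def using bdd that by (rule cINF_lower)
  have "\<exists>y\<in>S. (norm (x - y))\<^sup>2 < d + 1 / Suc n" for n
    using cINF_less_iff[OF ne bdd, of "d + 1 / Suc n"] unfolding d_def by auto
  then obtain s where s: "\<And>n. s n \<in> S" "\<And>n. (norm (x - s n))\<^sup>2 < d + 1 / Suc n"
    by metis
  \<comment> \<open>Parallelogram law for x - s m and x - s n: the midpoint stays in S, at squared
    distance at least d from x, so two near-minimizers are close to each other.\<close>
  have par: "(norm (s m - s n))\<^sup>2 \<le> 2 / Suc m + 2 / Suc n" for m n
  proof -
    have "(1/2) *\<^sub>R (s m + s n) \<in> S"
      using s assms(1) by (simp add: subspace_add subspace_scale)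
    from d_le[OF this] have "4 * d \<le> 4 * (norm (x - (1/2) *\<^sub>R (s m + s n)))\<^sup>2" by simp
    also have "\<dots> = (norm ((x - s m) + (x - s n)))\<^sup>2"
    proof -
      have "(x - s m) + (x - s n) = 2 *\<^sub>R (x - (1/2) *\<^sub>R (s m + s n))"
        by (simp add: algebra_simps scaleR_2)
      then show ?thesis by (simp add: power_mult_distrib)
    qed
    also have "\<dots> = 2 * (norm (x - s m))\<^sup>2 + 2 * (norm (x - s n))\<^sup>2 - (norm (s m - s n))\<^sup>2"
      by (simp add: power2_norm_eq_inner inner_simps inner_commute)
    finally show ?thesis using s(2)[of m] s(2)[of n] by simp
  qed
  have "Cauchy s"
  proof (rule metric_CauchyI)
    fix e :: real assume "0 < e"
    obtain N where "4 / e\<^sup>2 < real N"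
      using reals_Archimedean2 by blast
    then have N: "4 / e\<^sup>2 < real (Suc N)" by simp
    have "dist (s m) (s n) < e" if "m \<ge> N" "n \<ge> N" for m n
    proof -
      have "2 / Suc m \<le> 2 / Suc N" "2 / Suc n \<le> 2 / Suc N"
        using that by (auto intro!: divide_left_mono)
      then have "(norm (s m - s n))\<^sup>2 \<le> 4 / Suc N" using par[of m n] by simp
      also have "\<dots> < e\<^sup>2" using N \<open>0 < e\<close> by (simp add: field_simps)
      finally show ?thesis using \<open>0 < e\<close> by (simp add: dist_norm power2_less_imp_less)
    qed
    then show "\<exists>M. \<forall>m\<ge>M. \<forall>n\<ge>M. dist (s m) (s n) < e" by blast
  qed
  then obtain p where p: "s \<longlonglongrightarrow> p" using Cauchy_convergent convergent_def by blast
  have pS: "p \<in> S" using closed_sequentially[OF assms(2)] s(1) p by blast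
  have "(\<lambda>n. d + 1 / Suc n) \<longlonglongrightarrow> d + 0"
    by (intro tendsto_add tendsto_const LIMSEQ_Suc lim_1_over_n)
  moreover have "(\<lambda>n. (norm (x - s n))\<^sup>2) \<longlonglongrightarrow> (norm (x - p))\<^sup>2"
    by (intro tendsto_intros p)
  ultimately have pd: "(norm (x - p))\<^sup>2 \<le> d"
    using LIMSEQ_le s(2) by (metis (no_types, lifting) add.right_neutral less_imp_le)
  have "inner (x - p) y = 0" if y: "y \<in> S" for y
  proof -
    define t where "t = inner (x - p) y"
    \<comment> \<open>The best step along y is t divided by the squared norm of y; the added 1
      covers y = 0 and still brings q closer to x unless t = 0.\<close>
    define r where "r = t / ((norm y)\<^sup>2 + 1)"
    define q where "q = p + r *\<^sub>R y"
    have "q \<in> S" unfolding q_def using pS y assms(1) by (simp add: subspace_add subspace_scale)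
    then have "(norm (x - p))\<^sup>2 \<le> (norm (x - q))\<^sup>2" using pd d_le[of q] by linarith
    also have "x - q = (x - p) - r *\<^sub>R y" by (simp add: q_def)
    also have "(norm \<dots>)\<^sup>2 = (norm (x - p))\<^sup>2 - 2 * r * t + r\<^sup>2 * (norm y)\<^sup>2"
      unfolding t_def
      by (simp only: power2_norm_eq_inner inner_diff_left[of "x - p"] inner_diff_right[of _ "x - p"] inner_scaleR_left inner_scaleR_right)
        (simp add: inner_commute[of y "x - p"] power2_eq_square right_diff_distrib)
    finally have *: "2 * r * t \<le> r\<^sup>2 * (norm y)\<^sup>2" by simp
    define a where "a = (norm y)\<^sup>2 + 1"
    have a: "a > 0" "(norm y)\<^sup>2 = a - 1" by (auto simp: a_def add_nonneg_pos)
    have "2 * t\<^sup>2 * a \<le> t\<^sup>2 * (a - 1)"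
      using * a unfolding r_def a_def[symmetric] a(2) by (simp add: field_simps power2_eq_square)
    then have "t\<^sup>2 * (a + 1) \<le> 0" by (simp add: algebra_simps)
    then show ?thesis using a(1) t_def
      by (metis add_pos_pos mult_le_0_iff not_le power2_less_eq_zero_iff zero_less_one)
  qed
  then show ?thesis using pS by blast
qed

lemma subspace_closure:
  fixes S :: "'a::real_normed_vector set"
  assumes "subspace S"
  shows "subspace (closure S)"
proof (rule subspaceI)
  show "0 \<in> closure S" using assms subspace_0 closure_subset by blast
  show "x + y \<in> closure S" if xy: "x \<in> closure S" "y \<in> closure S" for x y
  proof -
    obtain f g where "\<And>n. f n \<in> S" "f \<longlonglongrightarrow> x" "\<And>n. g n \<in> S" "g \<longlonglongrightarrow> y"
      using xy unfolding closure_sequential by blast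
    then have "(\<lambda>n. f n + g n) \<longlonglongrightarrow> x + y" "\<And>n. f n + g n \<in> S"
      using assms by (auto intro: tendsto_add subspace_add)
    then show ?thesis unfolding closure_sequential by (intro exI[of _ "\<lambda>n. f n + g n"]) auto
  qed
  show "r *\<^sub>R x \<in> closure S" if x: "x \<in> closure S" for r x
  proof -
    obtain f where "\<And>n. f n \<in> S" "f \<longlonglongrightarrow> x"
      using x unfolding closure_sequential by blast
    then have "(\<lambda>n. r *\<^sub>R f n) \<longlonglongrightarrow> r *\<^sub>R x" "\<And>n. r *\<^sub>R f n \<in> S"
      using assms by (auto intro: tendsto_scaleR subspace_scale)
    then show ?thesis unfolding closure_sequential by (intro exI[of _ "\<lambda>n. r *\<^sub>R f n"]) auto
  qed
qed

text \<open>The difference between x and its projection onto the closure is orthogonal to S, hence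
  zero. Serves twice: for the range of the resolvent and for the residuals of the core
  functions.\<close>

lemma dense_if_orthogonal_zero:
  fixes S :: "'a::{real_inner,banach} set"
  assumes S: "subspace S" and 0: "\<And>x. (\<And>y. y \<in> S \<Longrightarrow> inner x y = 0) \<Longrightarrow> x = 0"
  shows "closure S = UNIV"
proof -
  have "x \<in> closure S" for x
  proof -
    obtain p where p: "p \<in> closure S" "\<And>y. y \<in> closure S \<Longrightarrow> inner (x - p) y = 0"
      using orthogonal_projection_exists[of "closure S" x] S
      by (metis closed_closure subspace_closure)
    then have "x - p = 0" using 0[of "x - p"] closure_subset by blast
    then show ?thesis using p(1) by simp
  qed
  then show ?thesis by blast
qed

definition orth_proj :: "'a::{real_inner,banach} set \<Rightarrow> 'a \<Rightarrow> 'a" where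
  "orth_proj S x = (SOME p. p \<in> S \<and> (\<forall>y\<in>S. inner (x - p) y = 0))"

context
  fixes S :: "'a::{real_inner,banach} set"
  assumes S: "subspace S" "closed S"
begin

lemma orth_proj_in: "orth_proj S x \<in> S"
  and orth_proj_orthogonal: "y \<in> S \<Longrightarrow> inner (x - orth_proj S x) y = 0"
  using someI_ex[of "\<lambda>p. p \<in> S \<and> (\<forall>y\<in>S. inner (x - p) y = 0)"] orthogonal_projection_exists[OF S, of x]
  unfolding orth_proj_def by blast+

lemma orth_proj_eqI:
  assumes "p \<in> S" "\<And>y. y \<in> S \<Longrightarrow> inner (x - p) y = 0"
  shows "orth_proj S x = p"
proof -
  have q: "p - orth_proj S x \<in> S" using S(1) assms(1) orth_proj_in by (simp add: subspace_diff)
  have "inner (p - orth_proj S x) (p - orth_proj S x)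
      = inner (x - orth_proj S x) (p - orth_proj S x) - inner (x - p) (p - orth_proj S x)"
    by (simp add: inner_diff_left)
  also have "\<dots> = 0" using assms(2)[OF q] orth_proj_orthogonal[OF q, of x] by simp
  finally show ?thesis by simp
qed

lemma inner_orth_proj: "inner (orth_proj S x) (orth_proj S y) = inner x (orth_proj S y)"
  using orth_proj_orthogonal[OF orth_proj_in, of x y] by (simp add: inner_diff_left)

lemma inner_orth_proj_commute: "inner (orth_proj S x) y = inner x (orth_proj S y)"
  using inner_orth_proj[of x y] inner_orth_proj[of y x] by (simp add: inner_commute)

lemma norm_orth_proj: "norm (orth_proj S x) \<le> norm x"
proof -
  have "norm (orth_proj S x) * norm (orth_proj S x) \<le> norm x * norm (orth_proj S x)"
    using inner_orth_proj[of x x] norm_cauchy_schwarz[of x "orth_proj S x"]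
    by (simp add: power2_norm_eq_inner[symmetric] power2_eq_square)
  then show ?thesis by (cases "orth_proj S x = 0") auto
qed

lemma bounded_linear_orth_proj: "bounded_linear (orth_proj S)"
proof (rule bounded_linear_intro[of _ 1])
  show "orth_proj S (x + y) = orth_proj S x + orth_proj S y" for x y
  proof (rule orth_proj_eqI)
    show "orth_proj S x + orth_proj S y \<in> S" by (simp add: S orth_proj_in subspace_add)
    show "inner (x + y - (orth_proj S x + orth_proj S y)) z = 0" if "z \<in> S" for z
      using orth_proj_orthogonal[OF that, of x] orth_proj_orthogonal[OF that, of y]
      by (simp add: inner_simps)
  qed
  show "orth_proj S (r *\<^sub>R x) = r *\<^sub>R orth_proj S x" for r x
  proof (rule orth_proj_eqI)
    show "r *\<^sub>R orth_proj S x \<in> S" by (simp add: S orth_proj_in subspace_scale)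
    show "inner (r *\<^sub>R x - r *\<^sub>R orth_proj S x) z = 0" if "z \<in> S" for z
      using orth_proj_orthogonal[OF that, of x] by (simp add: inner_simps)
  qed
qed (simp add: norm_orth_proj)

end

section \<open>Functional calculus of a self-adjoint operator between 0 and 1\<close>

definition op_eval :: "('a::real_normed_vector \<Rightarrow>\<^sub>L 'a) \<Rightarrow> real poly \<Rightarrow> ('a \<Rightarrow>\<^sub>L 'a)" where
  "op_eval R p = fold_coeffs (\<lambda>a T. a *\<^sub>R id_blinfun + (R o\<^sub>L T)) p 0"

lemma op_eval_0 [simp]: "op_eval R 0 = 0"
  by (simp add: op_eval_def)

lemma op_eval_pCons [simp]: "op_eval R (pCons a p) = a *\<^sub>R id_blinfun + (R o\<^sub>L op_eval R p)"
proof (cases "p = 0 \<and> a = 0")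
  case True
  then show ?thesis by (simp add: blinfun_compose_zero)
next
  case False
  then show ?thesis by (auto simp: op_eval_def fold_coeffs_pCons_not_0_0_eq fold_coeffs_pCons_coeff_not_0_eq)
qed

lemma op_eval_add: "op_eval R (p + q) = op_eval R p + op_eval R q"
  by (induction p q rule: poly_induct2)
    (auto simp: algebra_simps blinfun.bilinear_simps intro!: blinfun_eqI)

lemma op_eval_smult: "op_eval R (smult c p) = c *\<^sub>R op_eval R p"
  by (induction p) (auto simp: algebra_simps blinfun.bilinear_simps intro!: blinfun_eqI)

lemma op_eval_diff: "op_eval R (p - q) = op_eval R p - op_eval R q"
  using op_eval_add[of R "p - q" q] by simp

lemma op_eval_sum: "op_eval R (sum f I) = (\<Sum>i\<in>I. op_eval R (f i))"
  by (induction I rule: infinite_finite_induct) (auto simp: op_eval_add)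

lemma op_eval_mult: "op_eval R (p * q) = op_eval R p o\<^sub>L op_eval R q"
proof (induction p)
  case 0
  then show ?case by (simp add: blinfun_compose_zero)
next
  case (pCons a p)
  then show ?case
    by (auto simp: op_eval_add op_eval_smult algebra_simps blinfun.bilinear_simps intro!: blinfun_eqI)
qed

lemma op_eval_commute: "op_eval R p (op_eval R q x) = op_eval R q (op_eval R p x)"
  by (metis blinfun_apply_blinfun_compose mult.commute op_eval_mult)

lemma op_eval_1 [simp]: "op_eval R 1 = id_blinfun"
  by (simp add: one_pCons blinfun_compose_zero)

lemma op_eval_X: "op_eval R [:0, 1:] x = R x"
  by (simp add: blinfun_compose_zero blinfun.bilinear_simps)

lemma op_eval_commute_op:
  fixes R J :: "'a::real_normed_vector \<Rightarrow>\<^sub>L 'a"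
  assumes "\<And>x. R (J x) = J (R x)"
  shows "op_eval R p (J x) = J (op_eval R p x)"
  by (induction p arbitrary: x) (auto simp: blinfun.bilinear_simps assms)

section \<open>Bernstein polynomials and the Bernstein coefficients of a polynomial\<close>

definition bern :: "nat \<Rightarrow> nat \<Rightarrow> real poly" where
  "bern n k = smult (real (n choose k)) ([:0, 1:] ^ k * [:1, -1:] ^ (n - k))"

lemma sum_bern: "(\<Sum>k\<le>n. bern n k) = 1"
proof -
  have "([:0, 1:] + [:1, -1:] :: real poly) ^ n = (\<Sum>k\<le>n. bern n k)"
    unfolding binomial_ring bern_def
    by (rule sum.cong) (auto simp: mult.assoc of_nat_poly)
  moreover have "[:0, 1:] + [:1, -1:] = (1 :: real poly)" by (simp add: one_pCons)
  ultimately show ?thesis by (metis power_one)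
qed

lemma smult_sum_right: "smult c (sum f I) = (\<Sum>i\<in>I. smult c (f i))"
  by (induction I rule: infinite_finite_induct) (auto simp: smult_add_right)

text \<open>Factorial moments of the binomial distribution: (k choose j)(n choose k) = (n choose
  j)(n - j choose k - j), and after the shift k = i + j the full sum of Bernstein polynomials of
  degree n - j remains, which is 1. Read backwards, it expands t^j with coefficients (k choose j) /
  (n choose j).\<close>

lemma sum_choose_bern:
  assumes "j \<le> n"
  shows "(\<Sum>k\<le>n. smult (real (k choose j)) (bern n k)) = smult (real (n choose j)) (monom 1 j)"
proof -
  have "(\<Sum>k\<le>n. smult (real (k choose j)) (bern n k)) = (\<Sum>k=j..n. smult (real (k choose j)) (bern n k))"
    by (rule sum.mono_neutral_right) (auto simp: not_le)
  also have "\<dots> = (\<Sum>i\<le>n-j. smult (real (i + j choose j)) (bern n (i + j)))"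
    using assms by (intro sum.reindex_bij_witness[of _ "\<lambda>i. i + j" "\<lambda>k. k - j"]) auto
  also have "\<dots> = (\<Sum>i\<le>n-j. smult (real (n choose j)) (monom 1 j * bern (n - j) i))"
  proof (rule sum.cong)
    fix i assume "i \<in> {..n-j}"
    then have i: "i + j \<le> n" using assms by auto
    have "real (i + j choose j) * real (n choose (i + j)) = real (n choose j) * real (n - j choose i)"
      using choose_mult[of j "i + j" n] i by (simp flip: of_nat_mult add: mult.commute)
    then show "smult (real (i + j choose j)) (bern n (i + j)) = smult (real (n choose j)) (monom 1 j * bern (n - j) i)"
      by (simp add: bern_def power_add monom_altdef ac_simps diff_diff_left)
  qed simp
  also have "\<dots> = smult (real (n choose j)) (monom 1 j * (\<Sum>i\<le>n-j. bern (n - j) i))"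
    by (simp add: sum_distrib_left smult_sum_right)
  finally show ?thesis by (simp add: sum_bern)
qed

text \<open>The ratio is a product of factors (k - i) / (n - i), each within i / (n - i) of k / n.
  Uniformity in k is the point: all Bernstein coefficients of a given degree are controlled at
  once.\<close>

lemma choose_ratio_tendsto:
  assumes "e > 0"
  shows "\<exists>N. \<forall>n\<ge>N. \<forall>k\<le>n. \<bar>real (k choose j) / real (n choose j) - (real k / real n) ^ j\<bar> < e"
  using assms
proof (induction j arbitrary: e)
  case 0
  then show ?case by simp
next
  case (Suc j)
  obtain N where N: "\<And>n k. n \<ge> N \<Longrightarrow> k \<le> n \<Longrightarrow> \<bar>real (k choose j) / real (n choose j) - (real k / real n) ^ j\<bar> < e / 2"
    using Suc.IH[of "e / 2"] Suc.prems by auto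
  obtain N' where N': "2 * real j / e < real N'" using reals_Archimedean2 by blast
  have "\<bar>real (k choose Suc j) / real (n choose Suc j) - (real k / real n) ^ Suc j\<bar> < e"
    if n: "n \<ge> N + N' + j + 1" and k: "k \<le> n" for n k
  proof -
    \<comment> \<open>Stated with a real difference, so that it also covers m < j, where both
      binomial coefficients vanish.\<close>
    have step: "real (m choose Suc j) = real (m choose j) * (real m - real j) / real (Suc j)" for m
    proof (cases "j \<le> m")
      case True
      have "Suc j * (m choose Suc j) = (m choose j) * (m - j)"
        by (metis binomial_absorb_comp mult.commute binomial_absorption)
      then have "real (Suc j) * real (m choose Suc j) = real (m choose j) * real (m - j)"
        by (metis of_nat_mult)
      then show ?thesis using True by (simp add: field_simps of_nat_diff)
    next
      case False
      then show ?thesis by (simp add: binomial_eq_0)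
    qed
    define a where "a = real (k choose j) / real (n choose j)"
    define b where "b = (real k - real j) / (real n - real j)"
    have ab: "real (k choose Suc j) / real (n choose Suc j) = a * b"
      unfolding step a_def b_def by (simp del: of_nat_Suc)
    have nj: "real n - real j > 0" using n by simp
    have a01: "0 \<le> a" "a \<le> 1"
      using k n binomial_right_mono[of k n j] unfolding a_def by (auto simp: divide_le_eq)
    have "\<bar>b - real k / real n\<bar> \<le> real j / (real n - real j)"
    proof -
      have "b - real k / real n = - (real j * (real n - real k) / (real n * (real n - real j)))"
        using nj n unfolding b_def by (simp add: field_simps)
      also have "\<bar>\<dots>\<bar> = real j / (real n - real j) * ((real n - real k) / real n)"
        using nj n k by (simp add: abs_mult)
      also have "\<dots> \<le> real j / (real n - real j) * 1"
        using nj n k by (intro mult_left_mono) auto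
      finally show ?thesis by simp
    qed
    also have "\<dots> < e / 2"
    proof -
      have "2 * real j < e * real N'" using N' Suc.prems by (simp add: field_simps)
      also have "\<dots> \<le> e * (real n - real j)" using n Suc.prems by (intro mult_left_mono) auto
      finally show ?thesis using nj by (simp add: field_simps)
    qed
    finally have b: "\<bar>b - real k / real n\<bar> < e / 2" .
    have "a * b - (real k / real n) ^ Suc j = a * (b - real k / real n) + (real k / real n) * (a - (real k / real n) ^ j)"
      by (simp add: algebra_simps)
    also have "\<bar>\<dots>\<bar> \<le> a * \<bar>b - real k / real n\<bar> + (real k / real n) * \<bar>a - (real k / real n) ^ j\<bar>"
      using a01 by (intro order.trans[OF abs_triangle_ineq]) (simp add: abs_mult)
    also have "\<dots> \<le> 1 * \<bar>b - real k / real n\<bar> + 1 * \<bar>a - (real k / real n) ^ j\<bar>"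
      using a01 k n by (intro add_mono mult_right_mono) (auto simp: divide_le_eq)
    also have "\<dots> < e"
      using b N[of n k] n k unfolding a_def by simp
    finally show ?thesis unfolding ab .
  qed
  then show ?case by blast
qed

text \<open>The k-th coefficient is p(k / n) with every power (k / n)^j replaced by (k choose j) /
  (n choose j). By \<open>choose_ratio_tendsto\<close> it is close to the value p(k / n), hence
  almost nonnegative when p is nonnegative.\<close>

lemma poly_eq_bern_combination:
  fixes p :: "real poly"
  assumes "degree p \<le> n"
  shows "p = (\<Sum>k\<le>n. smult (\<Sum>j\<le>degree p. coeff p j * (real (k choose j) / real (n choose j))) (bern n k))"
proof -
  have "(\<Sum>k\<le>n. smult (\<Sum>j\<le>degree p. coeff p j * (real (k choose j) / real (n choose j))) (bern n k))
      = (\<Sum>k\<le>n. \<Sum>j\<le>degree p. smult (coeff p j / real (n choose j)) (smult (real (k choose j)) (bern n k)))"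
    by (simp add: smult_sum)
  also have "\<dots> = (\<Sum>j\<le>degree p. \<Sum>k\<le>n. smult (coeff p j / real (n choose j)) (smult (real (k choose j)) (bern n k)))"
    by (rule sum.swap)
  also have "\<dots> = (\<Sum>j\<le>degree p. smult (coeff p j / real (n choose j)) (smult (real (n choose j)) (monom 1 j)))"
    using assms by (intro sum.cong refl) (simp only: smult_sum_right[symmetric] sum_choose_bern atMost_iff)
  also have "\<dots> = (\<Sum>j\<le>degree p. monom (coeff p j) j)"
    by (rule sum.cong) (use assms in \<open>auto simp: smult_monom\<close>)
  finally show ?thesis by (simp add: poly_as_sum_of_monoms)
qed

text \<open>Symmetry is a separate assumption because over the reals it does not follow from a
  condition on the quadratic form.\<close>

locale unit_interval_operator =
  fixes R :: "'a::{real_inner,banach} \<Rightarrow>\<^sub>L 'a"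
  assumes selfadj: "inner (R x) y = inner x (R y)"
    and nonneg: "0 \<le> inner (R x) x"
    and le_id: "inner (R x) x \<le> inner x x"
begin

lemma op_eval_selfadj: "inner (op_eval R p x) y = inner x (op_eval R p y)"
proof (induction p arbitrary: x y)
  case (pCons a p)
  have "R (op_eval R p y) = op_eval R p (R y)"
    using op_eval_commute[of R "[:0,1:]" p y] by (simp add: op_eval_X del: op_eval_pCons)
  then show ?case using pCons by (simp add: blinfun.bilinear_simps inner_simps selfadj)
qed simp

text \<open>p(R) is self-adjoint and commutes with q(R), so the two factors p can be distributed
  over both sides: the form of q(R) is evaluated at p(R) x.\<close>

lemma op_eval_square_nonneg:
  assumes "\<And>x. 0 \<le> inner (op_eval R q x) x"
  shows "0 \<le> inner (op_eval R (p\<^sup>2 * q) x) x"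
proof -
  have "inner (op_eval R (p\<^sup>2 * q) x) x = inner (op_eval R p (op_eval R q (op_eval R p x))) x"
    by (metis (no_types, lifting) op_eval_mult blinfun_apply_blinfun_compose mult.assoc mult.commute power2_eq_square)
  then show ?thesis using assms[of "op_eval R p x"] by (simp add: op_eval_selfadj)
qed

text \<open>Splitting off even powers as a square leaves one of the factors 1, R, 1 - R, R (1 -
  R).\<close>

lemma bern_nonneg: "0 \<le> inner (op_eval R (bern n k) x) x"
proof -
  have X: "0 \<le> inner (op_eval R [:0,1:] x) x" for x
    by (simp add: op_eval_X nonneg del: op_eval_pCons)
  have Y: "0 \<le> inner (op_eval R [:1,-1:] x) x" for x
    using le_id[of x] by (simp add: blinfun.bilinear_simps inner_simps blinfun_compose_zero)
  have par: "\<exists>b e. (m = 2 * b + e \<and> (e = 0 \<or> e = 1))" for m :: nat by presburger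
  obtain b e where k: "k = 2 * b + e" and e: "e = 0 \<or> e = 1" using par by blast
  obtain b' e' where nk: "n - k = 2 * b' + e'" and e': "e' = 0 \<or> e' = 1" using par by blast
  have "[:0, 1:] ^ k * [:1, -1:] ^ (n - k)
      = ([:0, 1:] ^ b * [:1, -1:] ^ b')\<^sup>2 * ([:0, 1:] ^ e * [:1, -1:] ^ e' :: real poly)"
    unfolding nk unfolding k by (simp add: power_add power_mult_distrib power_mult[symmetric] ac_simps)
  moreover have "0 \<le> inner (op_eval R ([:0, 1:] ^ e * [:1, -1:] ^ e') x) x" for x
  proof -
    \<comment> \<open>Positivity of a product of two positive commuting operators is not immediate;
      the identity, X + (1 - X) = 1 multiplied by X (1 - X), writes it as a sum of squares times
      positive factors.\<close>
    have XY: "[:0, 1:] * [:1, -1:] = [:0, 1:]\<^sup>2 * [:1,-1:] + [:1, -1:]\<^sup>2 * [:0, 1 :: real:]"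
      by (simp add: power2_eq_square)
    have "0 \<le> inner (op_eval R ([:0, 1:] * [:1, -1:]) x) x"
      unfolding XY op_eval_add plus_blinfun.rep_eq inner_add_left
      using op_eval_square_nonneg[OF X] op_eval_square_nonneg[OF Y] by (intro add_nonneg_nonneg)
    then show ?thesis using e e' X Y
      by (auto simp del: op_eval_pCons mult_pCons_left mult_pCons_right)
  qed
  ultimately have "0 \<le> inner (op_eval R ([:0, 1:] ^ k * [:1, -1:] ^ (n - k)) x) x"
    by (simp only: op_eval_square_nonneg)
  then show ?thesis
    by (simp add: bern_def op_eval_smult scaleR_blinfun.rep_eq)
qed

text \<open>
  A polynomial that is nonnegative on the unit interval has coefficients at least \<open>-\<epsilon>\<close> in the
  Bernstein basis of sufficiently large degree, and the Bernstein polynomials sum to 1.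
\<close>

lemma op_eval_nonneg:
  assumes p: "\<And>t. t \<in> {0..1} \<Longrightarrow> 0 \<le> poly p t"
  shows "0 \<le> inner (op_eval R p x) x"
proof (rule field_le_epsilon)
  fix e :: real assume e: "0 < e"
  \<comment> \<open>With this C, an error of e / C in every power of k / n changes the quadratic
    form at x by at most e; the summand 1 keeps C positive.\<close>
  define C where "C = (\<Sum>j\<le>degree p. \<bar>coeff p j\<bar>) * inner x x + 1"
  have C: "C > 0" unfolding C_def by (intro add_nonneg_pos mult_nonneg_nonneg sum_nonneg) auto
  have "\<exists>N. \<forall>j\<le>degree p. \<forall>n\<ge>N. \<forall>k\<le>n. \<bar>real (k choose j) / real (n choose j) - (real k / real n) ^ j\<bar> < e / C"
  proof -
    obtain N where N: "\<And>j. \<forall>n\<ge>N j. \<forall>k\<le>n. \<bar>real (k choose j) / real (n choose j) - (real k / real n) ^ j\<bar> < e / C"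
      using choose_ratio_tendsto[of "e / C"] e C by (metis divide_pos_pos)
    show ?thesis
    proof (intro exI allI impI)
      fix j n k assume "j \<le> degree p" "Max (N ` {..degree p}) \<le> n" "k \<le> n"
      then have "N j \<le> n" by (meson Max_ge atMost_iff finite_atMost finite_imageI imageI le_trans)
      then show "\<bar>real (k choose j) / real (n choose j) - (real k / real n) ^ j\<bar> < e / C"
        using N \<open>k \<le> n\<close> by blast
    qed
  qed
  then obtain N where N: "\<And>j n k. j \<le> degree p \<Longrightarrow> n \<ge> N \<Longrightarrow> k \<le> n \<Longrightarrow>
      \<bar>real (k choose j) / real (n choose j) - (real k / real n) ^ j\<bar> < e / C" by blast
  define n where "n = N + degree p + 1"
  define c where "c k = (\<Sum>j\<le>degree p. coeff p j * (real (k choose j) / real (n choose j)))" for k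
  define S where "S = (\<Sum>j\<le>degree p. \<bar>coeff p j\<bar>)"
  have c: "- (S * (e / C)) \<le> c k" if k: "k \<le> n" for k
  proof -
    have "\<bar>c k - poly p (real k / real n)\<bar>
        = \<bar>\<Sum>j\<le>degree p. coeff p j * (real (k choose j) / real (n choose j) - (real k / real n) ^ j)\<bar>"
      by (simp add: c_def poly_altdef sum_subtractf[symmetric] algebra_simps)
    also have "\<dots> \<le> (\<Sum>j\<le>degree p. \<bar>coeff p j\<bar> * (e / C))"
    proof (rule order.trans[OF sum_abs], rule sum_mono)
      fix j assume "j \<in> {..degree p}"
      then have "\<bar>real (k choose j) / real (n choose j) - (real k / real n) ^ j\<bar> \<le> e / C"
        using N[of j n k] k by (simp add: n_def less_imp_le)
      then show "\<bar>coeff p j * (real (k choose j) / real (n choose j) - (real k / real n) ^ j)\<bar> \<le> \<bar>coeff p j\<bar> * (e / C)"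
        unfolding abs_mult by (rule mult_left_mono) simp
    qed
    also have "\<dots> = S * (e / C)" by (simp add: S_def sum_distrib_right sum_divide_distrib)
    finally show ?thesis using p[of "real k / real n"] k by (auto simp: n_def divide_le_eq)
  qed
  have "inner (op_eval R p x) x = (\<Sum>k\<le>n. c k * inner (op_eval R (bern n k) x) x)"
  proof -
    have "p = (\<Sum>k\<le>n. smult (c k) (bern n k))"
      unfolding c_def by (rule poly_eq_bern_combination) (simp add: n_def)
    from arg_cong[OF this, of "op_eval R"] have "op_eval R p = (\<Sum>k\<le>n. c k *\<^sub>R op_eval R (bern n k))"
      by (simp only: op_eval_sum op_eval_smult)
    then show ?thesis by (simp add: blinfun.sum_left inner_sum_left scaleR_blinfun.rep_eq)
  qed
  also have "\<dots> \<ge> (\<Sum>k\<le>n. - (S * (e / C)) * inner (op_eval R (bern n k) x) x)"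
    by (intro sum_mono mult_right_mono bern_nonneg c) auto
  also have "(\<Sum>k\<le>n. - (S * (e / C)) * inner (op_eval R (bern n k) x) x)
      = - (S * (e / C)) * inner (op_eval R (\<Sum>k\<le>n. bern n k) x) x"
    by (simp add: op_eval_sum blinfun.sum_left inner_sum_left sum_distrib_left)
  also have "\<dots> = - (S * inner x x * (e / C))" by (simp add: sum_bern)
  finally have "- (S * inner x x * (e / C)) \<le> inner (op_eval R p x) x" .
  moreover have "S * inner x x * (e / C) \<le> e"
  proof -
    have "S * inner x x \<le> C" by (simp add: C_def S_def)
    then have "S * inner x x * (e / C) \<le> C * (e / C)" using e C by (intro mult_right_mono) auto
    then show ?thesis using C by simp
  qed
  ultimately show "0 \<le> inner (op_eval R p x) x + e" by simp
qed

text \<open>Positivity of B^2 - p^2 on [0, 1], evaluated at x, is the inequality between squared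
  norms. This contraction from the sup norm is what extends the calculus from polynomials to
  continuous functions.\<close>

lemma norm_op_eval_le:
  assumes "\<And>t. t \<in> {0..1} \<Longrightarrow> \<bar>poly p t\<bar> \<le> B"
  shows "norm (op_eval R p) \<le> B"
proof (rule norm_blinfun_bound)
  show B: "0 \<le> B" using assms[of 0] by simp
  fix x
  have "0 \<le> inner (op_eval R (smult (B\<^sup>2) 1 - p * p) x) x"
  proof (rule op_eval_nonneg)
    fix t :: real assume "t \<in> {0..1}"
    then have "\<bar>poly p t\<bar>\<^sup>2 \<le> B\<^sup>2" using assms by (intro power_mono) auto
    then show "0 \<le> poly (smult (B\<^sup>2) 1 - p * p) t" by (simp add: power2_eq_square)
  qed
  also have "\<dots> = B\<^sup>2 * inner x x - inner (op_eval R p x) (op_eval R p x)"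
    by (simp add: op_eval_diff op_eval_smult op_eval_mult blinfun.bilinear_simps inner_simps op_eval_selfadj)
  finally have "(norm (op_eval R p x))\<^sup>2 \<le> (B * norm x)\<^sup>2"
    by (simp add: power2_norm_eq_inner power_mult_distrib)
  then show "norm (op_eval R p x) \<le> B * norm x" using B by (auto intro: power2_le_imp_le)
qed

end

section \<open>Continuous functional calculus by uniform approximation\<close>

context unit_interval_operator
begin

text \<open>A relation instead of a limit along a chosen sequence: the same polynomial approximates
  the symbol uniformly and the operator in norm, so algebraic rules are proved with one approximant
  at a time.\<close>

definition fc_rel :: "(real \<Rightarrow> real) \<Rightarrow> ('a \<Rightarrow>\<^sub>L 'a) \<Rightarrow> bool" where
  "fc_rel f T \<longleftrightarrow> (\<forall>e>0. \<exists>p. (\<forall>t\<in>{0..1}. \<bar>f t - poly p t\<bar> \<le> e) \<and> norm (T - op_eval R p) \<le> e)"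

definition fc :: "(real \<Rightarrow> real) \<Rightarrow> ('a \<Rightarrow>\<^sub>L 'a)" where
  "fc f = (THE T. fc_rel f T)"

text \<open>A single estimate with three uses: uniqueness (f = g and B = 0), the Cauchy property of
  the approximating polynomials, and the norm bound (g = 0).\<close>

lemma fc_rel_bounded_diff:
  assumes "fc_rel f S" "fc_rel g T" "\<And>t. t \<in> {0..1} \<Longrightarrow> \<bar>f t - g t\<bar> \<le> B"
  shows "norm (S - T) \<le> B"
proof (rule field_le_epsilon)
  fix e :: real assume "0 < e"
  then have e: "e / 4 > 0" by simp
  from assms(1) e obtain p where p: "\<forall>t\<in>{0..1}. \<bar>f t - poly p t\<bar> \<le> e/4" "norm (S - op_eval R p) \<le> e/4"
    unfolding fc_rel_def by blast
  from assms(2) e obtain q where q: "\<forall>t\<in>{0..1}. \<bar>g t - poly q t\<bar> \<le> e/4" "norm (T - op_eval R q) \<le> e/4"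
    unfolding fc_rel_def by blast
  have "norm (op_eval R (p - q)) \<le> B + e/2"
  proof (rule norm_op_eval_le)
    fix t :: real assume "t \<in> {0..1}"
    then show "\<bar>poly (p - q) t\<bar> \<le> B + e / 2"
      using p(1)[rule_format, of t] q(1)[rule_format, of t] assms(3)[of t] unfolding poly_diff by arith
  qed
  moreover have eq: "S - T = (S - op_eval R p) + op_eval R (p - q) - (T - op_eval R q)"
    by (simp add: op_eval_diff)
  ultimately show "norm (S - T) \<le> B + e"
    unfolding eq using p(2) q(2) norm_triangle_ineq4[of "(S - op_eval R p) + op_eval R (p - q)" "T - op_eval R q"]
      norm_triangle_ineq[of "S - op_eval R p" "op_eval R (p - q)"] by linarith
qed

lemma fc_rel_unique:
  assumes "fc_rel f S" "fc_rel f T" shows "S = T"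
  using fc_rel_bounded_diff[OF assms, of 0] by simp

lemma fc_rel_poly: "fc_rel (poly p) (op_eval R p)"
  unfolding fc_rel_def by (intro allI impI exI[of _ p]) auto

lemma polynomial_approximation:
  fixes f :: "real \<Rightarrow> real"
  assumes "continuous_on {0..1} f" "e > 0"
  obtains p where "\<And>t. t \<in> {0..1} \<Longrightarrow> \<bar>f t - poly p t\<bar> \<le> e"
proof -
  obtain N where N: "\<forall>n x. N \<le> n \<and> x \<in> {0..1} \<longrightarrow> \<bar>f x - (\<Sum>k\<le>n. f (k/n) * Bernstein n k x)\<bar> < e"
    using Bernstein_Weierstrass[OF assms] by blast
  have "poly (\<Sum>k\<le>N. smult (f (k/N)) (bern N k)) x = (\<Sum>k\<le>N. f (k/N) * Bernstein N k x)" for x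
    by (simp add: poly_sum bern_def Bernstein_def mult_ac)
  then show ?thesis using N that[of "\<Sum>k\<le>N. smult (f (k/N)) (bern N k)"] by (metis less_imp_le order_refl)
qed

lemma fc_rel_exists:
  assumes "continuous_on {0..1} f"
  shows "\<exists>T. fc_rel f T"
proof -
  have "\<exists>p. \<forall>t\<in>{0..1}. \<bar>f t - poly p t\<bar> \<le> 1 / Suc n" for n
    using polynomial_approximation[OF assms, of "1 / Suc n"] by (metis of_nat_0_less_iff zero_less_Suc zero_less_divide_1_iff)
  then obtain p where p: "\<And>n t. t \<in> {0..1} \<Longrightarrow> \<bar>f t - poly (p n) t\<bar> \<le> 1 / Suc n" by metis
  have dist: "norm (op_eval R (p m) - op_eval R (p n)) \<le> 1 / Suc m + 1 / Suc n" for m n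
    by (rule fc_rel_bounded_diff[OF fc_rel_poly fc_rel_poly])
      (smt (verit) p)
  have inv: "\<exists>N. \<forall>n\<ge>N. 1 / real (Suc n) < e" if "e > 0" for e :: real
    using LIMSEQ_D[OF LIMSEQ_Suc[OF lim_1_over_n[where 'a=real]], OF that] by auto
  have "Cauchy (\<lambda>n. op_eval R (p n))"
  proof (rule CauchyI)
    fix e :: real assume "0 < e"
    then obtain N where N: "\<And>n. n \<ge> N \<Longrightarrow> 1 / real (Suc n) < e / 2" using inv[of "e/2"] by auto
    have "norm (op_eval R (p m) - op_eval R (p n)) < e" if "m \<ge> N" "n \<ge> N" for m n
      using dist[of m n] N[OF that(1)] N[OF that(2)] by linarith
    then show "\<exists>M. \<forall>m\<ge>M. \<forall>n\<ge>M. norm (op_eval R (p m) - op_eval R (p n)) < e" by blast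
  qed
  then obtain T where T: "(\<lambda>n. op_eval R (p n)) \<longlonglongrightarrow> T" using Cauchy_convergent convergent_def by blast
  have "fc_rel f T"
    unfolding fc_rel_def
  proof (intro allI impI)
    fix e :: real assume e: "e > 0"
    obtain N where N: "\<And>n. n \<ge> N \<Longrightarrow> 1 / real (Suc n) < e" using inv[OF e] by auto
    obtain N' where N': "\<And>n. n \<ge> N' \<Longrightarrow> norm (op_eval R (p n) - T) < e" using LIMSEQ_D[OF T e] by auto
    show "\<exists>p. (\<forall>t\<in>{0..1}. \<bar>f t - poly p t\<bar> \<le> e) \<and> norm (T - op_eval R p) \<le> e"
    proof (intro exI[of _ "p (max N N')"] conjI ballI)
      show "norm (T - op_eval R (p (max N N'))) \<le> e"
        using N'[of "max N N'"] by (simp add: norm_minus_commute)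
      show "\<bar>f t - poly (p (max N N')) t\<bar> \<le> e" if "t \<in> {0..1}" for t
        using N[of "max N N'"] p[OF that, of "max N N'"] by simp
    qed
  qed
  then show ?thesis ..
qed

lemma fc_rel_fc: "continuous_on {0..1} f \<Longrightarrow> fc_rel f (fc f)"
  unfolding fc_def using fc_rel_exists[of f] fc_rel_unique by (auto intro: theI)

lemma fc_eqI: "fc_rel f T \<Longrightarrow> fc f = T"
  unfolding fc_def using fc_rel_unique by blast

lemma fc_cong:
  assumes "\<And>t. t \<in> {0..1} \<Longrightarrow> f t = g t"
  shows "fc f = fc g"
proof -
  have "fc_rel f = fc_rel g" unfolding fc_rel_def using assms by (auto simp: fun_eq_iff)
  then show ?thesis by (simp add: fc_def)
qed

lemma norm_fc_le:
  assumes "continuous_on {0..1} f" "\<And>t. t \<in> {0..1} \<Longrightarrow> \<bar>f t\<bar> \<le> B"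
  shows "norm (fc f) \<le> B"
  using fc_rel_bounded_diff[OF fc_rel_fc[OF assms(1)] fc_rel_poly[of 0], of B] assms(2) by simp

lemma fc_poly: "fc (poly p) = op_eval R p"
  by (rule fc_eqI) (rule fc_rel_poly)

lemma fc_add:
  assumes f: "continuous_on {0..1} f" and g: "continuous_on {0..1} g"
  shows "fc (\<lambda>t. f t + g t) = fc f + fc g"
proof (rule fc_eqI, unfold fc_rel_def, intro allI impI)
  fix e :: real assume "e > 0"
  then have e: "e / 2 > 0" by simp
  obtain p where p: "\<forall>t\<in>{0..1}. \<bar>f t - poly p t\<bar> \<le> e/2" "norm (fc f - op_eval R p) \<le> e/2"
    using fc_rel_fc[OF f] e unfolding fc_rel_def by blast
  obtain q where q: "\<forall>t\<in>{0..1}. \<bar>g t - poly q t\<bar> \<le> e/2" "norm (fc g - op_eval R q) \<le> e/2"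
    using fc_rel_fc[OF g] e unfolding fc_rel_def by blast
  have "norm ((fc f - op_eval R p) + (fc g - op_eval R q)) \<le> e"
    using norm_triangle_le[of "fc f - op_eval R p" "fc g - op_eval R q" e] p(2) q(2) by simp
  then have "norm (fc f + fc g - op_eval R (p + q)) \<le> e"
    by (simp add: op_eval_add algebra_simps)
  moreover have "\<bar>f t + g t - poly (p + q) t\<bar> \<le> e" if "t \<in> {0..1}" for t
    using p(1)[rule_format, OF that] q(1)[rule_format, OF that] unfolding poly_add by arith
  ultimately show "\<exists>p. (\<forall>t\<in>{0..1}. \<bar>f t + g t - poly p t\<bar> \<le> e) \<and> norm (fc f + fc g - op_eval R p) \<le> e"
    by blast
qed

lemma fc_mult:
  assumes f: "continuous_on {0..1} f" and g: "continuous_on {0..1} g"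
  shows "fc (\<lambda>t. f t * g t) = fc f o\<^sub>L fc g"
proof (rule fc_eqI, unfold fc_rel_def, intro allI impI)
  fix e :: real assume e: "e > 0"
  obtain B0 where "\<forall>x\<in>f ` {0..1}. norm x \<le> B0"
    using compact_imp_bounded[OF compact_continuous_image[OF f compact_Icc]] bounded_iff by blast
  moreover obtain C0 where "\<forall>x\<in>g ` {0..1}. norm x \<le> C0"
    using compact_imp_bounded[OF compact_continuous_image[OF g compact_Icc]] bounded_iff by blast
  ultimately obtain B where B: "B \<ge> 1" "\<And>t. t \<in> {0..1} \<Longrightarrow> \<bar>f t\<bar> \<le> B" "\<And>t. t \<in> {0..1} \<Longrightarrow> \<bar>g t\<bar> \<le> B"
    using that[of "max 1 (max B0 C0)"] by (force simp: le_max_iff_disj)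
  \<comment> \<open>d \<le> 1 bounds the approximant q by B + 1, so the product error is at most B d
    + d (B + 1) = d (2 B + 1).\<close>
  define d where "d = min 1 (e / (2 * B + 1))"
  have d: "d > 0" "d \<le> 1" "d * (2 * B + 1) \<le> e"
  proof -
    show "d > 0" "d \<le> 1" using e B(1) by (auto simp: d_def)
    have "d * (2 * B + 1) \<le> e / (2 * B + 1) * (2 * B + 1)"
      using B(1) by (intro mult_right_mono) (auto simp: d_def)
    then show "d * (2 * B + 1) \<le> e" using B(1) by simp
  qed
  obtain p where p: "\<forall>t\<in>{0..1}. \<bar>f t - poly p t\<bar> \<le> d" "norm (fc f - op_eval R p) \<le> d"
    using fc_rel_fc[OF f] d(1) unfolding fc_rel_def by blast
  obtain q where q: "\<forall>t\<in>{0..1}. \<bar>g t - poly q t\<bar> \<le> d" "norm (fc g - op_eval R q) \<le> d"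
    using fc_rel_fc[OF g] d(1) unfolding fc_rel_def by blast
  have key: "B * d + d * (B + 1) \<le> e"
    using d(3) by (simp add: algebra_simps)
  have "norm ((fc f o\<^sub>L (fc g - op_eval R q)) + ((fc f - op_eval R p) o\<^sub>L op_eval R q)) \<le> B * d + d * (B + 1)"
  proof (rule norm_triangle_le, rule add_mono)
    have "norm (fc f) \<le> B" by (rule norm_fc_le[OF f B(2)])
    then show "norm (fc f o\<^sub>L (fc g - op_eval R q)) \<le> B * d"
      using q(2) B(1) by (intro order.trans[OF norm_blinfun_compose] mult_mono) auto
    have "norm (op_eval R q) \<le> B + 1"
    proof (rule norm_op_eval_le)
      show "\<bar>poly q t\<bar> \<le> B + 1" if "t \<in> {0..1}" for t
        using q(1)[rule_format, OF that] B(3)[OF that] d(2) by linarith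
    qed
    then show "norm ((fc f - op_eval R p) o\<^sub>L op_eval R q) \<le> d * (B + 1)"
      using p(2) d(1) by (intro order.trans[OF norm_blinfun_compose] mult_mono) auto
  qed
  then have "norm ((fc f o\<^sub>L fc g) - op_eval R (p * q)) \<le> e"
    using key by (simp add: op_eval_mult bounded_bilinear.diff_left[OF bounded_bilinear_blinfun_compose] bounded_bilinear.diff_right[OF bounded_bilinear_blinfun_compose])
  moreover have "\<bar>f t * g t - poly (p * q) t\<bar> \<le> e" if t: "t \<in> {0..1}" for t
  proof -
    have "f t * g t - poly (p * q) t = f t * (g t - poly q t) + (f t - poly p t) * poly q t"
      by (simp add: algebra_simps)
    also have "\<bar>\<dots>\<bar> \<le> \<bar>f t\<bar> * \<bar>g t - poly q t\<bar> + \<bar>f t - poly p t\<bar> * \<bar>poly q t\<bar>"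
      by (intro order.trans[OF abs_triangle_ineq]) (simp add: abs_mult)
    also have "\<dots> \<le> B * d + d * (B + 1)"
      using q(1)[rule_format, OF t] p(1)[rule_format, OF t] B(2,3)[OF t] d B(1) by (intro add_mono mult_mono) auto
    finally show ?thesis using key by simp
  qed
  ultimately show "\<exists>p. (\<forall>t\<in>{0..1}. \<bar>f t * g t - poly p t\<bar> \<le> e) \<and> norm ((fc f o\<^sub>L fc g) - op_eval R p) \<le> e"
    by blast
qed

lemma fc_const: "fc (\<lambda>t. c) = c *\<^sub>R id_blinfun"
  using fc_poly[of "[:c:]"] fc_cong[of "\<lambda>t. c" "poly [:c:]"] by (simp add: blinfun_compose_zero)

lemma fc_id: "fc (\<lambda>t. t) = R"
  using fc_poly[of "[:0, 1:]"] fc_cong[of "\<lambda>t. t" "poly [:0, 1:]"] by (auto intro!: blinfun_eqI simp: op_eval_X simp del: op_eval_pCons)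

text \<open>The form in which identities linear in the operator, such as symmetry and commutation
  with J, pass from polynomials to continuous symbols.\<close>

lemma fc_limit:
  assumes "continuous_on {0..1} f"
  obtains p where "(\<lambda>n. op_eval R (p n)) \<longlonglongrightarrow> fc f"
proof -
  have "\<exists>p. norm (fc f - op_eval R p) \<le> 1 / Suc n" for n
    using fc_rel_fc[OF assms] unfolding fc_rel_def by (metis of_nat_0_less_iff zero_less_Suc zero_less_divide_1_iff)
  then obtain p where p: "\<And>n. norm (fc f - op_eval R (p n)) \<le> 1 / Suc n" by metis
  have "(\<lambda>n. op_eval R (p n)) \<longlonglongrightarrow> fc f"
    by (rule LIM_zero_cancel, rule Lim_null_comparison[OF _ LIMSEQ_Suc[OF lim_1_over_n]])
      (use p in \<open>auto simp: norm_minus_commute\<close>)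
  then show ?thesis by (rule that)
qed

lemma fc_selfadj:
  assumes "continuous_on {0..1} f"
  shows "inner (fc f x) y = inner x (fc f y)"
proof -
  obtain p where p: "(\<lambda>n. op_eval R (p n)) \<longlonglongrightarrow> fc f" using fc_limit[OF assms] .
  have "(\<lambda>n. inner (op_eval R (p n) x) y) \<longlonglongrightarrow> inner (fc f x) y"
    "(\<lambda>n. inner x (op_eval R (p n) y)) \<longlonglongrightarrow> inner x (fc f y)"
    by (intro tendsto_intros p)+
  then show ?thesis using LIMSEQ_unique by (simp add: op_eval_selfadj)
qed

lemma fc_commute_op:
  fixes J :: "'a \<Rightarrow>\<^sub>L 'a"
  assumes "continuous_on {0..1} f" and RJ: "\<And>x. R (J x) = J (R x)"
  shows "fc f (J x) = J (fc f x)"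
proof -
  obtain p where p: "(\<lambda>n. op_eval R (p n)) \<longlonglongrightarrow> fc f" using fc_limit[OF assms(1)] .
  have "(\<lambda>n. op_eval R (p n) (J x)) \<longlonglongrightarrow> fc f (J x)" "(\<lambda>n. J (op_eval R (p n) x)) \<longlonglongrightarrow> J (fc f x)"
    by (intro tendsto_intros p)+
  then show ?thesis using LIMSEQ_unique by (simp add: op_eval_commute_op RJ)
qed

end

section \<open>Complex symbols through the complex structure J\<close>

locale complex_unit_interval_operator = unit_interval_operator R
  for R :: "'a::{real_inner,banach} \<Rightarrow>\<^sub>L 'a" +
  fixes J :: "'a \<Rightarrow>\<^sub>L 'a"
  assumes J_J: "J (J x) = - x"
    and J_inner: "inner (J x) (J y) = inner x y"
    and R_J: "R (J x) = J (R x)"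
begin

definition cscale :: "complex \<Rightarrow> 'a \<Rightarrow> 'a" where
  "cscale z x = Re z *\<^sub>R x + Im z *\<^sub>R J x"

text \<open>J stands for i on the real Hilbert space. As an isometry with square -1 it is
  skew-adjoint, and it commutes with every function of R, so complex symbols multiply
  correctly.\<close>

definition cfc :: "(real \<Rightarrow> complex) \<Rightarrow> ('a \<Rightarrow>\<^sub>L 'a)" where
  "cfc F = fc (\<lambda>t. Re (F t)) + (J o\<^sub>L fc (\<lambda>t. Im (F t)))"

lemma cfc_apply: "cfc F x = fc (\<lambda>t. Re (F t)) x + J (fc (\<lambda>t. Im (F t)) x)"
  by (simp add: cfc_def blinfun.bilinear_simps)

context
  fixes F G :: "real \<Rightarrow> complex"
  assumes F: "continuous_on {0..1} F" and G: "continuous_on {0..1} G"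
begin

lemma cont_parts:
  "continuous_on {0..1} (\<lambda>t. Re (F t))" "continuous_on {0..1} (\<lambda>t. Im (F t))"
  "continuous_on {0..1} (\<lambda>t. Re (G t))" "continuous_on {0..1} (\<lambda>t. Im (G t))"
  by (intro continuous_intros F G)+

lemma cfc_add: "cfc (\<lambda>t. F t + G t) x = cfc F x + cfc G x"
  by (simp add: cfc_apply fc_add cont_parts blinfun.bilinear_simps)

lemma cfc_mult: "cfc (\<lambda>t. F t * G t) x = cfc F (cfc G x)"
proof -
  have Re: "fc (\<lambda>t. Re (F t * G t)) x = fc (\<lambda>t. Re (F t)) (fc (\<lambda>t. Re (G t)) x) - fc (\<lambda>t. Im (F t)) (fc (\<lambda>t. Im (G t)) x)"
  proof -
    have "fc (\<lambda>t. Re (F t * G t)) = fc (\<lambda>t. Re (F t) * Re (G t) + (- 1) * (Im (F t) * Im (G t)))"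
      by simp
    also have "\<dots> = fc (\<lambda>t. Re (F t) * Re (G t)) + fc (\<lambda>t. (- 1) * (Im (F t) * Im (G t)))"
      by (intro fc_add continuous_intros cont_parts)
    also have "fc (\<lambda>t. (- 1) * (Im (F t) * Im (G t))) = fc (\<lambda>t. -1) o\<^sub>L fc (\<lambda>t. Im (F t) * Im (G t))"
      by (intro fc_mult continuous_intros cont_parts)
    finally show ?thesis
      by (simp add: fc_mult cont_parts fc_const blinfun.bilinear_simps)
  qed
  have Im: "fc (\<lambda>t. Im (F t * G t)) x = fc (\<lambda>t. Re (F t)) (fc (\<lambda>t. Im (G t)) x) + fc (\<lambda>t. Im (F t)) (fc (\<lambda>t. Re (G t)) x)"
    by (simp add: fc_add fc_mult cont_parts continuous_on_mult blinfun.bilinear_simps)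
  show ?thesis
    unfolding cfc_apply Re Im
    by (simp add: blinfun.bilinear_simps fc_commute_op[OF _ R_J] cont_parts J_J)
qed

text \<open>Write a and b for the operators of Re F and Im F. Since a x and J b x are orthogonal,
  the squared norm is the quadratic form of a^2 + b^2, whose symbol is the squared modulus of F.
  Estimating the two parts separately would lose a constant and with it the contractivity of the
  semigroup.\<close>

lemma norm_cfc_le:
  assumes B: "\<And>t. t \<in> {0..1} \<Longrightarrow> cmod (F t) \<le> B"
  shows "norm (cfc F) \<le> B"
proof (rule norm_blinfun_bound)
  show B0: "0 \<le> B" using B[of 0] norm_ge_zero[of "F 0"] by (simp del: norm_ge_zero)
  fix x
  let ?a = "fc (\<lambda>t. Re (F t))" and ?b = "fc (\<lambda>t. Im (F t))"
  have J0: "inner y (J y) = 0" for y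
    using J_inner[of y "J y"] by (simp add: J_J inner_commute)
  have "inner (?a x) (J (?b x)) = inner x (J (fc (\<lambda>t. Re (F t) * Im (F t)) x))"
    by (simp add: fc_selfadj fc_commute_op[OF _ R_J] cont_parts fc_mult)
  also have "\<dots> = 0"
  proof -
    let ?c = "fc (\<lambda>t. Re (F t) * Im (F t))"
    have c: "continuous_on {0..1} (\<lambda>t. Re (F t) * Im (F t))" by (intro continuous_intros cont_parts)
    \<comment> \<open>J times a commuting self-adjoint operator is skew-adjoint, so its real
      quadratic form equals its own negative.\<close>
    have "inner x (J (?c x)) = inner (J x) (J (J (?c x)))" by (simp add: J_inner)
    also have "\<dots> = - inner (J x) (?c x)" by (simp add: J_J)
    also have "\<dots> = - inner x (J (?c x))"
      using fc_selfadj[OF c, of "J x" x] fc_commute_op[OF c R_J, of x] by (simp add: inner_commute)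
    finally show ?thesis by simp
  qed
  finally have orth: "inner (?a x) (J (?b x)) = 0" .
  have "(norm (cfc F x))\<^sup>2 = inner (?a x) (?a x) + inner (?b x) (?b x)"
    unfolding cfc_apply power2_norm_eq_inner using orth
    by (simp add: inner_add_left inner_add_right J_inner inner_commute[of "J _" "?a x"])
  also have "\<dots> = inner (fc (\<lambda>t. Re (F t) * Re (F t) + Im (F t) * Im (F t)) x) x"
    by (simp add: fc_add fc_mult cont_parts continuous_on_mult blinfun.bilinear_simps inner_add_left fc_selfadj)
  also have "\<dots> \<le> norm (fc (\<lambda>t. Re (F t) * Re (F t) + Im (F t) * Im (F t)) x) * norm x"
    by (rule norm_cauchy_schwarz)
  also have "\<dots> \<le> (B\<^sup>2 * norm x) * norm x"
  proof (intro mult_right_mono order.trans[OF norm_blinfun] norm_fc_le)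
    show "continuous_on {0..1} (\<lambda>t. Re (F t) * Re (F t) + Im (F t) * Im (F t))"
      by (intro continuous_intros cont_parts)
    show "\<bar>Re (F t) * Re (F t) + Im (F t) * Im (F t)\<bar> \<le> B\<^sup>2" if "t \<in> {0..1}" for t
      using power_mono[OF B[OF that], of 2] by (simp add: cmod_power2 power2_eq_square[of "Re _"] power2_eq_square[of "Im _"])
  qed auto
  finally have "(norm (cfc F x))\<^sup>2 \<le> (B * norm x)\<^sup>2" by (simp add: power2_eq_square mult_ac)
  then show "norm (cfc F x) \<le> B * norm x" using B0 by (auto intro: power2_le_imp_le)
qed

end

lemma cfc_const: "cfc (\<lambda>t. c) x = cscale c x"
  by (simp add: cfc_apply fc_const cscale_def blinfun.bilinear_simps)

lemma cfc_cmult: "continuous_on {0..1} F \<Longrightarrow> cfc (\<lambda>t. c * F t) x = cscale c (cfc F x)"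
  using cfc_mult[of "\<lambda>t. c" F] by (simp add: cfc_const)

lemma cfc_diff:
  assumes "continuous_on {0..1} F" "continuous_on {0..1} G"
  shows "cfc (\<lambda>t. F t - G t) x = cfc F x - cfc G x"
  using cfc_add[of "\<lambda>t. F t - G t" G x] assms by (simp add: continuous_on_diff)

lemma cfc_id: "cfc (\<lambda>t. of_real t) x = R x"
  by (simp add: cfc_apply fc_id fc_const)

lemma cfc_cscale:
  assumes "continuous_on {0..1} F"
  shows "cfc F (cscale c x) = cscale c (cfc F x)"
  using cfc_mult[of "\<lambda>t. c" F x] cfc_mult[of F "\<lambda>t. c" x] assms by (simp add: cfc_const mult.commute)

end

section \<open>The semigroup generated by a resolvent\<close>

text \<open>Uniform boundedness along the filter carries strong convergence from a dense set to the
  whole space. It takes the place of norm convergence, which fails at z = 0 for an unbounded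
  generator.\<close>

lemma strong_limit_zero_from_dense:
  fixes S :: "'b \<Rightarrow> 'a::real_normed_vector \<Rightarrow>\<^sub>L 'c::real_normed_vector"
  assumes bound: "\<forall>\<^sub>F s in F. norm (S s) \<le> C" and dense: "closure D = UNIV"
    and D: "\<And>x. x \<in> D \<Longrightarrow> ((\<lambda>s. S s x) \<longlongrightarrow> 0) F"
  shows "((\<lambda>s. S s x) \<longlongrightarrow> 0) F"
proof (rule tendstoI)
  fix e :: real assume e: "e > 0"
  define C' where "C' = max C 1"
  have C': "C' > 0" "C \<le> C'" by (auto simp: C'_def)
  have "x \<in> closure D" using dense by simp
  then obtain y where y: "y \<in> D" "dist y x < e / (2 * C')"
    using e C' by (metis closure_approachable divide_pos_pos mult_pos_pos zero_less_numeral)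
  have "\<forall>\<^sub>F s in F. dist (S s y) 0 < e / 2"
    using tendstoD[OF D[OF y(1)], of "e / 2"] e by simp
  with bound show "\<forall>\<^sub>F s in F. dist (S s x) 0 < e"
  proof eventually_elim
    case (elim s)
    have "norm (S s (x - y)) \<le> C' * norm (x - y)"
      using elim(1) C' by (intro order.trans[OF norm_blinfun] mult_right_mono) auto
    also have "\<dots> < C' * (e / (2 * C'))"
      using y(2) C' by (intro mult_strict_left_mono) (auto simp: dist_norm norm_minus_commute)
    also have "\<dots> = e / 2" using C' by simp
    finally have "norm (S s (x - y)) < e / 2" .
    moreover have "S s x = S s (x - y) + S s y" by (simp add: blinfun.bilinear_simps)
    ultimately show ?case
      using norm_triangle_ineq[of "S s (x - y)" "S s y"] elim(2) by simp
  qed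
qed

text \<open>If \<open>t\<close> is the spectral variable of \<open>(1 - A)\<inverse>\<close>, then \<open>1 / t - 1\<close> is that of \<open>-A\<close>.\<close>

definition heat_symbol :: "complex \<Rightarrow> real \<Rightarrow> complex" where
  "heat_symbol z t = (if t \<le> 0 then 0 else exp (- z * of_real (1 / t - 1)))"

text \<open>The derivative in z, that is, the symbol of A T z. The value 0 at t = 0 is the limit
  when Re z > 0.\<close>

definition heat_symbol_deriv :: "complex \<Rightarrow> real \<Rightarrow> complex" where
  "heat_symbol_deriv z t = (if t \<le> 0 then 0 else - of_real (1 / t - 1) * exp (- z * of_real (1 / t - 1)))"

lemma square_le_exp: "0 \<le> x \<Longrightarrow> x\<^sup>2 \<le> 2 * exp x" for x :: real
  using exp_lower_Taylor_quadratic[of x] by simp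

lemma norm_heat_symbol: "0 < t \<Longrightarrow> cmod (heat_symbol z t) = exp (- Re z * (1 / t - 1))"
  by (simp add: heat_symbol_def)

lemma norm_heat_symbol_le_1:
  assumes "0 \<le> Re z" "t \<le> 1"
  shows "cmod (heat_symbol z t) \<le> 1"
proof (cases "t \<le> 0")
  case False
  then have "0 \<le> Re z * (1 / t - 1)" using assms by (intro mult_nonneg_nonneg) auto
  then show ?thesis using False by (simp add: norm_heat_symbol)
qed (simp add: heat_symbol_def)

text \<open>This is x^2 \<le> 2 exp x at x = a / t. Quadratic decay is chosen because the derivative
  symbol has an extra factor of size 1 / t, after which a decay of order t remains.\<close>

lemma exp_neg_inverse_le:
  fixes a t :: real
  assumes "0 < a" "0 < t" "t \<le> 1"
  shows "exp (- a * (1 / t - 1)) \<le> 2 * exp a / a\<^sup>2 * t\<^sup>2"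
proof -
  have "(a / t)\<^sup>2 \<le> 2 * exp (a / t)" using assms by (intro square_le_exp) auto
  then have "a\<^sup>2 * exp (- (a / t)) \<le> 2 * t\<^sup>2"
    using assms by (simp add: exp_minus field_simps power_divide)
  then have "exp (- (a / t)) \<le> 2 * t\<^sup>2 / a\<^sup>2"
    using assms by (simp add: field_simps)
  then have "exp a * exp (- (a / t)) \<le> exp a * (2 * t\<^sup>2 / a\<^sup>2)"
    by (intro mult_left_mono) auto
  then show ?thesis by (simp add: exp_add[symmetric] algebra_simps)
qed

lemma continuous_on_if_vanishing_at_0:
  fixes F :: "real \<Rightarrow> complex"
  assumes F: "continuous_on {0<..1} F" and b: "\<And>t. 0 < t \<Longrightarrow> t \<le> 1 \<Longrightarrow> cmod (F t) \<le> C * t"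
  shows "continuous_on {0..1} (\<lambda>t. if t \<le> 0 then 0 else F t)"
  unfolding continuous_on_eq_continuous_within
proof
  fix x :: real assume x: "x \<in> {0..1}"
  show "continuous (at x within {0..1}) (\<lambda>t. if t \<le> 0 then 0 else F t)"
  proof (cases "x = 0")
    case True
    have "((\<lambda>t. if t \<le> 0 then 0 else F t) \<longlongrightarrow> 0) (at 0 within {0..1})"
    proof (rule Lim_null_comparison)
      show "\<forall>\<^sub>F t in at 0 within {0..1}. norm (if t \<le> 0 then 0 else F t) \<le> C * t"
        using b by (auto simp: eventually_at intro!: exI[of _ 1])
      have "((\<lambda>t. C * t) \<longlongrightarrow> C * 0) (at 0 within {0..1})" by (intro tendsto_intros)
      then show "((\<lambda>t. C * t) \<longlongrightarrow> 0) (at 0 within {0..1})" by simp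
    qed
    then show ?thesis using True by (simp add: continuous_within)
  next
    case False
    then have x: "0 < x" "x \<le> 1" using x by auto
    then have "(F \<longlongrightarrow> F x) (at x within {0<..1})"
      using F by (auto simp: continuous_on)
    moreover have "at x within {0<..1} = at x within {0..1}"
    proof (rule at_within_nhd[of _ "{0<..}"])
      show "{0<..1} \<inter> {0<..} - {x} = {0..1} \<inter> {0<..} - {x}" by auto
    qed (use x in auto)
    ultimately have "(F \<longlongrightarrow> F x) (at x within {0..1})" by simp
    moreover have "\<forall>\<^sub>F t in at x within {0..1}. F t = (if t \<le> 0 then 0 else F t)"
      using x by (auto simp: eventually_at dist_real_def intro!: exI[of _ x])
    ultimately show ?thesis using x
      by (auto simp: continuous_within elim: Lim_transform_eventually)
  qed
qed

lemma continuous_on_heat_symbol: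
  assumes "0 < Re z"
  shows "continuous_on {0..1} (heat_symbol z)"
  unfolding heat_symbol_def[abs_def]
proof (rule continuous_on_if_vanishing_at_0)
  show "continuous_on {0<..1} (\<lambda>t. exp (- z * of_real (1 / t - 1)))"
    by (intro continuous_intros) auto
  fix t :: real assume t: "0 < t" "t \<le> 1"
  have "cmod (exp (- z * of_real (1 / t - 1))) \<le> 2 * exp (Re z) / (Re z)\<^sup>2 * t\<^sup>2"
    using exp_neg_inverse_le[OF assms t] by simp
  also have "\<dots> \<le> 2 * exp (Re z) / (Re z)\<^sup>2 * t"
    using t by (intro mult_left_mono) (auto simp: power2_eq_square)
  finally show "cmod (exp (- z * of_real (1 / t - 1))) \<le> 2 * exp (Re z) / (Re z)\<^sup>2 * t" .
qed

lemma continuous_on_heat_symbol_deriv: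
  assumes "0 < Re z"
  shows "continuous_on {0..1} (heat_symbol_deriv z)"
  unfolding heat_symbol_deriv_def[abs_def]
proof (rule continuous_on_if_vanishing_at_0)
  show "continuous_on {0<..1} (\<lambda>t. - of_real (1 / t - 1) * exp (- z * of_real (1 / t - 1)))"
    by (intro continuous_intros) auto
  fix t :: real assume t: "0 < t" "t \<le> 1"
  have "cmod (- of_real (1 / t - 1) * exp (- z * of_real (1 / t - 1))) = (1 / t - 1) * exp (- Re z * (1 / t - 1))"
    using t by (simp add: norm_mult del: of_real_diff of_real_divide)
  also have "\<dots> \<le> (1 / t) * (2 * exp (Re z) / (Re z)\<^sup>2 * t\<^sup>2)"
    using t exp_neg_inverse_le[OF assms t] by (intro mult_mono) auto
  also have "\<dots> = 2 * exp (Re z) / (Re z)\<^sup>2 * t"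
    using t by (simp add: power2_eq_square)
  finally show "cmod (- of_real (1 / t - 1) * exp (- z * of_real (1 / t - 1))) \<le> 2 * exp (Re z) / (Re z)\<^sup>2 * t" .
qed

lemma heat_symbol_add: "heat_symbol (z + w) t = heat_symbol z t * heat_symbol w t"
  by (simp add: heat_symbol_def ring_distribs exp_add[symmetric] del: of_real_diff of_real_divide)

text \<open>Put l = 1 / t - 1 and h = w - z. The Taylor remainder of exp (- h l) is at most exp (l
  cmod h) (l cmod h)^2; as cmod h \<le> Re z / 2, half of the decay exp (- l Re z) survives and
  absorbs l^2. Uniformity in t yields holomorphy in operator norm.\<close>

lemma heat_symbol_difference_quotient:
  assumes a: "0 < Re z" and h: "cmod (w - z) \<le> Re z / 2" "w \<noteq> z" and t: "t \<in> {0..1}"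
  shows "cmod ((heat_symbol w t - heat_symbol z t) / (w - z) - heat_symbol_deriv z t)
    \<le> 8 / (Re z)\<^sup>2 * cmod (w - z)"
proof (cases "t \<le> 0")
  case True
  then show ?thesis by (simp add: heat_symbol_def heat_symbol_deriv_def)
next
  case False
  define l where "l = 1 / t - 1"
  have l: "0 \<le> l" using t False by (simp add: l_def)
  define h where "h = w - z"
  have hz: "h \<noteq> 0" using \<open>w \<noteq> z\<close> by (simp add: h_def)
  have "- z * l + - h * l = - w * of_real l" by (simp add: h_def algebra_simps)
  then have "heat_symbol w t = exp (- z * l) * exp (- h * l)"
    unfolding exp_add[symmetric] using False by (simp add: heat_symbol_def l_def)
  then have eq: "(heat_symbol w t - heat_symbol z t) / (w - z) - heat_symbol_deriv z t
      = exp (- z * l) * (exp (- h * l) - (1 + (- h * l))) / h"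
    using False hz by (simp add: heat_symbol_def heat_symbol_deriv_def h_def[symmetric] l_def[symmetric] field_simps
        del: of_real_diff of_real_divide)
  have "cmod (exp (- h * l) - (\<Sum>i\<le>1. (- h * l) ^ i / fact i)) \<le> exp \<bar>Re (- h * l)\<bar> * (cmod (- h * l)) ^ Suc 1 / fact 1"
    by (rule Taylor_exp)
  then have "cmod (exp (- h * l) - (1 + (- h * l))) \<le> exp \<bar>Re (- h * l)\<bar> * (cmod h * l)\<^sup>2"
    using l by (simp add: norm_mult power2_eq_square)
  also have "\<dots> \<le> exp (Re z / 2 * l) * (cmod h * l)\<^sup>2"
  proof (intro mult_right_mono)
    have "\<bar>Re (- h * l)\<bar> \<le> cmod h * l"
      using l abs_Re_le_cmod[of h] by (simp add: abs_mult mult_right_mono)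
    also have "\<dots> \<le> Re z / 2 * l" using assms(2) l by (intro mult_right_mono) (auto simp: h_def)
    finally show "exp \<bar>Re (- h * l)\<bar> \<le> exp (Re z / 2 * l)" by simp
  qed auto
  finally have "cmod (exp (- z * l) * (exp (- h * l) - (1 + (- h * l))) / h)
      \<le> exp (- Re z * l) * (exp (Re z / 2 * l) * (cmod h * l)\<^sup>2) / cmod h"
    unfolding norm_divide norm_mult by (intro divide_right_mono mult_mono) auto
  also have "\<dots> = cmod h * (exp (- (Re z / 2 * l)) * l\<^sup>2)"
  proof -
    have "x * (y * (n * l)\<^sup>2) / n = n * ((x * y) * l\<^sup>2)" if "n \<noteq> 0" for x y n :: real
      using that by (simp add: power2_eq_square)
    moreover have "exp (- Re z * l) * exp (Re z / 2 * l) = exp (- (Re z / 2 * l))"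
      by (simp add: exp_add[symmetric])
    ultimately show ?thesis using hz by (metis norm_eq_zero)
  qed
  also have "\<dots> \<le> cmod h * (8 / (Re z)\<^sup>2)"
  proof (intro mult_left_mono)
    \<comment> \<open>Source of the constant 8: x^2 \<le> 2 exp x at x = l Re z / 2.\<close>
    have "(Re z / 2 * l)\<^sup>2 \<le> 2 * exp (Re z / 2 * l)" using a l by (intro square_le_exp) auto
    then show "exp (- (Re z / 2 * l)) * l\<^sup>2 \<le> 8 / (Re z)\<^sup>2"
      using a by (simp add: exp_minus field_simps power_mult_distrib power_divide)
  qed auto
  finally show ?thesis unfolding eq by (simp add: h_def mult.commute)
qed

text \<open>Mean value estimate on the convex half-plane Re \<le> 0, where the derivative of exp has
  modulus at most 1.\<close>

lemma cmod_exp_minus_1_le: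
  assumes "0 \<le> Re w"
  shows "cmod (exp (- w) - 1) \<le> cmod w"
proof -
  have "cmod (exp (- w) - exp 0) \<le> 1 * cmod (- w - 0)"
  proof (rule field_differentiable_bound[where S = "{x. Re x \<le> 0}" and f' = exp])
    show "convex {x. Re x \<le> 0}" using convex_halfspace_Re_le by blast
  qed (use assms in \<open>auto intro!: derivative_eq_intros\<close>)
  then show ?thesis by simp
qed

text \<open>The factor t is the symbol of R. Without it the difference from 1 does not become
  uniformly small, as the symbol is 0 at t = 0; with it, t (1 / t - 1) = 1 - t stays
  bounded.\<close>

lemma heat_symbol_near_0:
  assumes "0 \<le> Re z" and t: "t \<in> {0..1}"
  shows "cmod (of_real t * (heat_symbol z t - 1)) \<le> cmod z"
proof (cases "t \<le> 0")
  case True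
  then show ?thesis using t by simp
next
  case False
  have l: "0 \<le> 1 / t - 1" using t False by simp
  have "cmod (exp (- (z * of_real (1 / t - 1))) - 1) \<le> cmod (z * of_real (1 / t - 1))"
  proof (rule cmod_exp_minus_1_le)
    show "0 \<le> Re (z * of_real (1 / t - 1))"
      using mult_nonneg_nonneg[OF assms(1) l] by simp
  qed
  also have "\<dots> = cmod z * (1 / t - 1)"
    using l by (simp add: norm_mult del: of_real_diff of_real_divide)
  finally have "t * cmod (exp (- (z * of_real (1 / t - 1))) - 1) \<le> t * (cmod z * (1 / t - 1))"
    using t by (intro mult_left_mono) auto
  also have "\<dots> = cmod z * (1 - t)" using False by (simp add: field_simps)
  also have "\<dots> \<le> cmod z * 1" using t by (intro mult_left_mono) auto
  finally show ?thesis using False t by (simp add: norm_mult heat_symbol_def)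
qed

text \<open>The function inside is the symbol of (T s - 1) R / s - (R - 1). The first bound is the
  uniform one and the second the rate on the range of R, as
  \<open>strong_limit_zero_from_dense\<close> asks; the rate comes from 0 \<le> exp (- x) - 1 + x
  \<le> x^2 at x = s (1 / t - 1).\<close>

lemma heat_symbol_generator:
  assumes s: "0 < s" and t: "t \<in> {0..1}"
  shows "cmod (of_real t * (heat_symbol (of_real s) t - 1) / of_real s + of_real (1 - t)) \<le> 2" (is ?A)
    and "cmod ((of_real t * (heat_symbol (of_real s) t - 1) / of_real s + of_real (1 - t)) * of_real t) \<le> s" (is ?B)
proof -
  have "cmod (of_real t * (heat_symbol (of_real s) t - 1)) \<le> s"
    using heat_symbol_near_0[of "of_real s" t] s t by simp
  then have "cmod (of_real t * (heat_symbol (of_real s) t - 1) / of_real s) \<le> 1"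
    using s by (simp add: norm_divide)
  moreover have "cmod (of_real (1 - t)) \<le> 1" unfolding norm_of_real using t by simp
  ultimately show ?A using norm_triangle_ineq[of "of_real t * (heat_symbol (of_real s) t - 1) / of_real s" "of_real (1 - t)"]
    by linarith
  show ?B
  proof (cases "t \<le> 0")
    case True
    then show ?thesis using t s by simp
  next
    case False
    define l where "l = 1 / t - 1"
    have l: "0 \<le> l" "t * l = 1 - t" using t False by (simp_all add: l_def field_simps)
    define x where "x = s * l"
    have x: "0 \<le> x" using l s by (simp add: x_def)
    have "exp (- x) \<le> 1 / (1 + x)"
      using exp_ge_add_one_self[of x] x by (simp add: exp_minus field_simps)
    also have "\<dots> \<le> 1 - x + x\<^sup>2" using x by (simp add: field_simps power2_eq_square)
    finally have "exp (- x) - 1 + x \<le> x\<^sup>2" by simp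
    moreover have "0 \<le> exp (- x) - 1 + x" using exp_ge_add_one_self[of "-x"] by simp
    ultimately have x2: "\<bar>exp (- x) - 1 + x\<bar> \<le> x\<^sup>2" by simp
    have "heat_symbol (of_real s) t = exp (of_real (- x))"
      using False by (simp add: heat_symbol_def x_def l_def)
    then have hs: "heat_symbol (of_real s) t = of_real (exp (- x))"
      by (simp only: exp_of_real)
    have alg: "t * (t * (E - 1) / s + t * l) = t\<^sup>2 / s * (E - 1 + x)" for E
      using s by (simp add: x_def distrib_left power2_eq_square)
    have "(of_real t * (heat_symbol (of_real s) t - 1) / of_real s + of_real (1 - t)) * of_real t
       = (of_real (t * (t * (exp (- x) - 1) / s + t * l)) :: complex)"
      unfolding l(2) hs by (simp add: mult.commute)
    also have "t * (t * (exp (- x) - 1) / s + t * l) = t\<^sup>2 / s * (exp (- x) - 1 + x)"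
      by (rule alg)
    also have "cmod (of_real \<dots>) \<le> t\<^sup>2 / s * x\<^sup>2"
      unfolding norm_of_real abs_mult using x2 s by (intro mult_mono) auto
    also have "\<dots> = s * (t * l)\<^sup>2" using s by (simp add: x_def power2_eq_square)
    also have "\<dots> \<le> s * 1" unfolding l(2) using t s by (intro mult_left_mono power_le_one) auto
    finally show ?thesis by simp
  qed
qed

section \<open>The holomorphic semigroup and its generator\<close>

context complex_unit_interval_operator
begin

text \<open>The case z = 0 is separate because the symbol is then 1 for t > 0 and 0 at t = 0: it is
  discontinuous and lies outside the continuous calculus.\<close>

definition heat :: "complex \<Rightarrow> ('a \<Rightarrow>\<^sub>L 'a)" where
  "heat z = (if z = 0 then id_blinfun else cfc (heat_symbol z))"

lemma heat_0: "heat 0 x = x"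
  by (simp add: heat_def)

lemma heat_cscale: "0 < Re z \<Longrightarrow> heat z (cscale c x) = cscale c (heat z x)"
  by (auto simp: heat_def cfc_cscale continuous_on_heat_symbol)

lemma heat_add:
  assumes "0 < Re z" "0 < Re w"
  shows "heat (z + w) x = heat z (heat w x)"
proof -
  have "heat_symbol (z + w) = (\<lambda>t. heat_symbol z t * heat_symbol w t)"
    by (simp add: heat_symbol_add fun_eq_iff)
  moreover have "z \<noteq> 0" "w \<noteq> 0" "z + w \<noteq> 0" using assms by (auto simp: complex_eq_iff)
  ultimately show ?thesis by (simp add: heat_def cfc_mult continuous_on_heat_symbol assms)
qed

lemma norm_heat_le: "0 < Re z \<Longrightarrow> norm (heat z x) \<le> norm x"
proof -
  assume z: "0 < Re z"
  have "norm (cfc (heat_symbol z)) \<le> 1"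
    using z by (intro norm_cfc_le[of _ "heat_symbol z"] continuous_on_heat_symbol norm_heat_symbol_le_1) auto
  then have "norm (heat z) \<le> 1" using z by (auto simp: heat_def)
  then show ?thesis using norm_blinfun[of "heat z" x] mult_right_mono[of "norm (heat z)" 1 "norm x"] by simp
qed

definition heat_deriv :: "complex \<Rightarrow> ('a \<Rightarrow>\<^sub>L 'a)" where
  "heat_deriv z = cfc (heat_symbol_deriv z)"

lemma heat_deriv_cscale: "0 < Re z \<Longrightarrow> heat_deriv z (cscale c x) = cscale c (heat_deriv z x)"
  by (simp add: heat_deriv_def cfc_cscale continuous_on_heat_symbol_deriv)

lemma heat_difference_quotient:
  assumes a: "0 < Re z" and h: "cmod (w - z) \<le> Re z / 2" "w \<noteq> z"
  shows "norm (cscale (1 / (w - z)) (heat w x - heat z x) - heat_deriv z x)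
    \<le> 8 / (Re z)\<^sup>2 * cmod (w - z) * norm x"
proof -
  have w: "0 < Re w" using a h(1) abs_Re_le_cmod[of "w - z"] by simp
  then have nz: "z \<noteq> 0" "w \<noteq> 0" using a by auto
  note cont = continuous_on_heat_symbol[OF a] continuous_on_heat_symbol[OF w] continuous_on_heat_symbol_deriv[OF a]
  define Q where "Q t = 1 / (w - z) * (heat_symbol w t - heat_symbol z t) - heat_symbol_deriv z t" for t
  have "cfc Q x = cfc (\<lambda>t. 1 / (w - z) * (heat_symbol w t - heat_symbol z t)) x - cfc (heat_symbol_deriv z) x"
    unfolding Q_def[abs_def] by (intro cfc_diff continuous_intros cont)
  also have "cfc (\<lambda>t. 1 / (w - z) * (heat_symbol w t - heat_symbol z t)) x
      = cscale (1 / (w - z)) (cfc (\<lambda>t. heat_symbol w t - heat_symbol z t) x)"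
    by (intro cfc_cmult continuous_intros cont)
  also have "cfc (\<lambda>t. heat_symbol w t - heat_symbol z t) x = cfc (heat_symbol w) x - cfc (heat_symbol z) x"
    by (intro cfc_diff cont)
  finally have Q: "cfc Q x = cscale (1 / (w - z)) (heat w x - heat z x) - heat_deriv z x"
    using nz by (simp add: heat_def heat_deriv_def)
  have "norm (cfc Q) \<le> 8 / (Re z)\<^sup>2 * cmod (w - z)"
  proof (rule norm_cfc_le)
    show "continuous_on {0..1} Q" unfolding Q_def[abs_def] by (intro continuous_intros cont)
    then show "continuous_on {0..1} Q" .
    show "cmod (Q t) \<le> 8 / (Re z)\<^sup>2 * cmod (w - z)" if "t \<in> {0..1}" for t
      using heat_symbol_difference_quotient[OF a h that] by (simp add: Q_def)
  qed
  then show ?thesis unfolding Q[symmetric]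
    by (intro order.trans[OF norm_blinfun] mult_right_mono) auto
qed

context
  assumes dense: "closure (range (blinfun_apply R)) = UNIV"
begin

text \<open>On the range of R the difference is at most cmod z times a norm, whatever the direction
  of z, so the limit holds in the whole half-plane and not only in smaller sectors.\<close>

lemma heat_tendsto_id: "((\<lambda>z. heat z x - x) \<longlongrightarrow> 0) (at 0 within {z. 0 < Re z})"
proof -
  let ?F = "at 0 within {z. 0 < Re z}"
  have ev: "\<forall>\<^sub>F z in ?F. 0 < Re z" by (simp add: eventually_at_filter)
  have "((\<lambda>z. (heat z - id_blinfun) x) \<longlongrightarrow> 0) ?F"
  proof (rule strong_limit_zero_from_dense[OF _ dense])
    show "\<forall>\<^sub>F z in ?F. norm (heat z - id_blinfun) \<le> 2"
      using ev
    proof eventually_elim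
      case (elim z)
      have "norm (heat z x - x) \<le> 2 * norm x" for x
        using norm_triangle_ineq4[of "heat z x" x] norm_heat_le[OF elim, of x] by linarith
      then show ?case by (intro norm_blinfun_bound) (auto simp: blinfun.bilinear_simps)
    qed
    fix y assume "y \<in> range R"
    then obtain x where y: "y = R x" by blast
    have "\<forall>\<^sub>F z in ?F. norm ((heat z - id_blinfun) y) \<le> cmod z * norm x"
      using ev
    proof eventually_elim
      case (elim z)
      note cont = continuous_on_heat_symbol[OF elim]
      have z: "z \<noteq> 0" using elim by auto
      have "cfc (\<lambda>t. of_real t * (heat_symbol z t - 1)) x = R (cfc (\<lambda>t. heat_symbol z t - 1) x)"
        by (subst cfc_mult) (intro continuous_intros cont | simp add: cfc_id)+
      also have "cfc (\<lambda>t. heat_symbol z t - 1) x = heat z x - x"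
        by (subst cfc_diff) (intro continuous_intros cont | simp add: cfc_const cscale_def heat_def z)+
      also have "R (heat z x - x) = (heat z - id_blinfun) y"
      proof -
        have "R (heat z x) = heat z (R x)"
          using z cfc_mult[of "\<lambda>t. of_real t" "heat_symbol z" x] cfc_mult[of "heat_symbol z" "\<lambda>t. of_real t" x] cont
          by (simp add: heat_def cfc_id mult.commute continuous_on_of_real)
        then show ?thesis by (simp add: y blinfun.bilinear_simps)
      qed
      finally have "norm ((heat z - id_blinfun) y) \<le> norm (cfc (\<lambda>t. of_real t * (heat_symbol z t - 1))) * norm x"
        using norm_blinfun by metis
      also have "\<dots> \<le> cmod z * norm x"
        using elim heat_symbol_near_0[of z]
        by (intro mult_right_mono norm_cfc_le[of _ "heat_symbol z"] continuous_intros cont) auto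
      finally show ?case .
    qed
    then show "((\<lambda>z. (heat z - id_blinfun) y) \<longlongrightarrow> 0) ?F"
    proof (rule Lim_null_comparison)
      have "((\<lambda>z. cmod z * norm x) \<longlongrightarrow> cmod 0 * norm x) ?F" by (intro tendsto_intros)
      then show "((\<lambda>z. cmod z * norm x) \<longlongrightarrow> 0) ?F" by simp
    qed
  qed
  then show ?thesis by (simp add: blinfun.bilinear_simps)
qed

lemma heat_R: "0 < Re z \<Longrightarrow> heat z (R x) = R (heat z x)"
  using cfc_mult[of "\<lambda>t. of_real t" "heat_symbol z" x] cfc_mult[of "heat_symbol z" "\<lambda>t. of_real t" x]
    continuous_on_heat_symbol[of z]
  by (auto simp: heat_def cfc_id mult.commute continuous_on_of_real)

text \<open>With R = (1 - A)^(-1) the limit is A R x = R x - x.\<close>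

lemma heat_right_derivative_on_range:
  "((\<lambda>s. (1 / s) *\<^sub>R (heat (of_real s) (R x) - R x)) \<longlongrightarrow> R x - x) (at_right 0)"
proof -
  \<comment> \<open>Symbol of the difference quotient applied to R, minus the expected limit R -
    1.\<close>
  define G where "G s t = of_real (1 / s) * (of_real t * (heat_symbol (of_real s) t - 1)) + of_real (1 - t)" for s t :: real
  have ev: "\<forall>\<^sub>F s in at_right (0::real). 0 < s" by (simp add: eventually_at_filter)
  have cont: "continuous_on {0..1} (G s)" if "0 < s" for s
    unfolding G_def[abs_def] using that by (intro continuous_intros continuous_on_heat_symbol) auto
  have G: "cfc (G s) x = (1 / s) *\<^sub>R (heat (of_real s) (R x) - R x) - (R x - x)" if s: "0 < s" for s x
  proof -
    have c: "continuous_on {0..1} (heat_symbol (of_real s))" using s by (intro continuous_on_heat_symbol) simp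
    have "cfc (G s) x = cscale (of_real (1 / s)) (R (cfc (\<lambda>t. heat_symbol (of_real s) t - 1) x)) + cfc (\<lambda>t. 1 - of_real t) x"
      unfolding G_def[abs_def]
      by (simp add: cfc_add cfc_cmult cfc_mult cfc_id continuous_intros c del: of_real_divide)
    also have "cfc (\<lambda>t. heat_symbol (of_real s) t - 1) x = heat (of_real s) x - x"
      using s by (simp add: cfc_diff c continuous_intros cfc_const heat_def cscale_def)
    also have "cfc (\<lambda>t. 1 - of_real t) x = x - R x"
      by (simp add: cfc_diff continuous_intros cfc_const cfc_id cscale_def)
    finally show ?thesis
      using s by (simp add: heat_R blinfun.bilinear_simps cscale_def algebra_simps)
  qed
  have "((\<lambda>s. cfc (G s) x) \<longlongrightarrow> 0) (at_right 0)"
  proof (rule strong_limit_zero_from_dense[OF _ dense])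
    show "\<forall>\<^sub>F s in at_right 0. norm (cfc (G s)) \<le> 2"
      using ev
    proof eventually_elim
      case (elim s)
      show ?case using heat_symbol_generator(1)[OF elim]
        by (intro norm_cfc_le[OF cont[OF elim] cont[OF elim]]) (simp add: G_def)
    qed
    fix y assume "y \<in> range R"
    then obtain x where y: "y = R x" by blast
    have "\<forall>\<^sub>F s in at_right 0. norm (cfc (G s) y) \<le> s * norm x"
      using ev
    proof eventually_elim
      case (elim s)
      have "cfc (G s) y = cfc (\<lambda>t. G s t * of_real t) x"
        by (simp add: cfc_mult cont[OF elim] continuous_intros cfc_id y)
      then have "norm (cfc (G s) y) \<le> norm (cfc (\<lambda>t. G s t * of_real t)) * norm x"
        using norm_blinfun by metis
      also have "\<dots> \<le> s * norm x"
        using elim heat_symbol_generator(2)[OF elim]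
        by (intro mult_right_mono norm_cfc_le[OF _ cont[OF elim]] continuous_intros cont) (auto simp: G_def)
      finally show ?case .
    qed
    then show "((\<lambda>s. cfc (G s) y) \<longlongrightarrow> 0) (at_right 0)"
    proof (rule Lim_null_comparison)
      have "((\<lambda>s::real. s * norm x) \<longlongrightarrow> 0 * norm x) (at_right 0)" by (intro tendsto_intros)
      then show "((\<lambda>s::real. s * norm x) \<longlongrightarrow> 0) (at_right 0)" by simp
    qed
  qed
  then have "((\<lambda>s. (1 / s) *\<^sub>R (heat (of_real s) (R x) - R x) - (R x - x)) \<longlongrightarrow> 0) (at_right 0)"
    by (rule Lim_transform_eventually) (use ev in eventually_elim, simp add: G)
  then show ?thesis by (rule LIM_zero_cancel)
qed

text \<open>For the converse R is applied to the difference quotient. R commutes with the semigroup,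
  so the limit is known on its range, and uniqueness of limits gives R g = R u - u, which is the
  equation.\<close>

lemma heat_generator:
  "((\<lambda>s. (1 / s) *\<^sub>R (heat (of_real s) u - u)) \<longlongrightarrow> g) (at_right 0) \<longleftrightarrow> u = R (u - g)"
proof
  assume "u = R (u - g)"
  then show "((\<lambda>s. (1 / s) *\<^sub>R (heat (of_real s) u - u)) \<longlongrightarrow> g) (at_right 0)"
    using heat_right_derivative_on_range[of "u - g"] by simp
next
  assume "((\<lambda>s. (1 / s) *\<^sub>R (heat (of_real s) u - u)) \<longlongrightarrow> g) (at_right 0)"
  then have "((\<lambda>s. R ((1 / s) *\<^sub>R (heat (of_real s) u - u))) \<longlongrightarrow> R g) (at_right 0)"
    by (intro tendsto_intros)
  then have "((\<lambda>s. (1 / s) *\<^sub>R (heat (of_real s) (R u) - R u)) \<longlongrightarrow> R g) (at_right 0)"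
  proof (rule Lim_transform_eventually)
    show "\<forall>\<^sub>F s in at_right 0. R ((1 / s) *\<^sub>R (heat (of_real s) u - u)) = (1 / s) *\<^sub>R (heat (of_real s) (R u) - R u)"
      by (auto simp: eventually_at_filter heat_R blinfun.bilinear_simps)
  qed
  from tendsto_unique[OF _ this heat_right_derivative_on_range[of u]]
  have "R g = R u - u" by simp
  then show "u = R (u - g)" by (simp add: blinfun.bilinear_simps)
qed

end

end

section \<open>The Hilbert space of square integrable functions\<close>

lemma L2_measurable: "f \<in> L2 M \<Longrightarrow> f \<in> borel_measurable M"
  and L2_square_integrable: "f \<in> L2 M \<Longrightarrow> integrable M (\<lambda>x. (cmod (f x))\<^sup>2)"
  by (simp_all add: L2_def)

lemma L2I:
  assumes "f \<in> borel_measurable M" "integrable M g" "AE x in M. (cmod (f x))\<^sup>2 \<le> g x"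
  shows "f \<in> L2 M"
proof -
  have "integrable M (\<lambda>x. (cmod (f x))\<^sup>2)"
    by (rule Bochner_Integration.integrable_bound[OF assms(2)]) (use assms in auto)
  then show ?thesis using assms by (simp add: L2_def)
qed

lemma L2_add:
  assumes "f \<in> L2 M" "g \<in> L2 M"
  shows "(\<lambda>x. f x + g x) \<in> L2 M"
proof (rule L2I)
  show "integrable M (\<lambda>x. 2 * (cmod (f x))\<^sup>2 + 2 * (cmod (g x))\<^sup>2)"
    using assms by (intro Bochner_Integration.integrable_add integrable_mult_right L2_square_integrable)
  show "AE x in M. (cmod (f x + g x))\<^sup>2 \<le> 2 * (cmod (f x))\<^sup>2 + 2 * (cmod (g x))\<^sup>2"
  proof (rule AE_I2)
    fix x
    have "(cmod (f x + g x))\<^sup>2 \<le> (cmod (f x) + cmod (g x))\<^sup>2"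
      by (intro power_mono norm_triangle_ineq) auto
    also have "\<dots> \<le> 2 * (cmod (f x))\<^sup>2 + 2 * (cmod (g x))\<^sup>2"
      using sum_squares_bound[of "cmod (f x)" "cmod (g x)"] by (simp add: power2_sum)
    finally show "(cmod (f x + g x))\<^sup>2 \<le> 2 * (cmod (f x))\<^sup>2 + 2 * (cmod (g x))\<^sup>2" .
  qed
qed (use assms[THEN L2_measurable] in measurable)

lemma L2_cmult:
  assumes "f \<in> L2 M"
  shows "(\<lambda>x. c * f x) \<in> L2 M"
  using assms by (auto simp: L2_def norm_mult power_mult_distrib)

lemma L2_uminus: "f \<in> L2 M \<Longrightarrow> (\<lambda>x. - f x) \<in> L2 M"
  by (auto simp: L2_def)

lemma L2_diff: "f \<in> L2 M \<Longrightarrow> g \<in> L2 M \<Longrightarrow> (\<lambda>x. f x - g x) \<in> L2 M"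
  using L2_add[of f M "\<lambda>x. - g x"] L2_uminus[of g M] by simp

lemma L2_0: "(\<lambda>x. 0) \<in> L2 M"
  by (simp add: L2_def)

lemma borel_measurable_cnj [measurable]: "cnj \<in> borel_measurable borel"
  by (intro borel_measurable_continuous_onI continuous_intros)

lemma L2_cnj: "f \<in> L2 M \<Longrightarrow> (\<lambda>x. cnj (f x)) \<in> L2 M"
  by (auto simp: L2_def intro: measurable_compose[OF _ borel_measurable_cnj])

lemma L2_AE_cong:
  assumes "f \<in> L2 M" "g \<in> borel_measurable M" "AE x in M. f x = g x"
  shows "g \<in> L2 M"
  using assms(3) by (intro L2I[OF assms(2) L2_square_integrable[OF assms(1)]]) auto

lemma L2_integrable_mult:
  assumes "f \<in> L2 M" "g \<in> L2 M"
  shows "integrable M (\<lambda>x. f x * g x)"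
proof (rule Bochner_Integration.integrable_bound)
  show "integrable M (\<lambda>x. (cmod (f x))\<^sup>2 + (cmod (g x))\<^sup>2)"
    using assms by (intro Bochner_Integration.integrable_add L2_square_integrable)
  show "AE x in M. norm (f x * g x) \<le> norm ((cmod (f x))\<^sup>2 + (cmod (g x))\<^sup>2)"
  proof (rule AE_I2)
    fix x
    have "cmod (f x) * cmod (g x) \<le> (cmod (f x))\<^sup>2 + (cmod (g x))\<^sup>2"
      using sum_squares_bound[of "cmod (f x)" "cmod (g x)"] mult_nonneg_nonneg[OF norm_ge_zero norm_ge_zero, of "f x" "g x"]
      unfolding mult.assoc by linarith
    then show "norm (f x * g x) \<le> norm ((cmod (f x))\<^sup>2 + (cmod (g x))\<^sup>2)"
      by (simp add: norm_mult)
  qed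
qed (use assms[THEN L2_measurable] in measurable)

lemma L2_integrable_mult_cnj:
  assumes "f \<in> L2 M" "g \<in> L2 M"
  shows "integrable M (\<lambda>x. f x * cnj (g x))"
  by (rule L2_integrable_mult[OF assms(1) L2_cnj[OF assms(2)]])

text \<open>Riesz-Fischer. Along a subsequence the squared distances lie below 16^(-k); weighting
  the squared increments by 4^k leaves summable integrals, and finiteness of the weighted sum at a
  point bounds the k-th increment by a multiple of 2^(-k), so the subsequence converges almost
  everywhere.\<close>

lemma L2_complete:
  fixes f :: "nat \<Rightarrow> 'a \<Rightarrow> complex"
  assumes f: "\<And>n. f n \<in> L2 M"
    and cauchy: "\<And>e. e > 0 \<Longrightarrow> \<exists>N. \<forall>m\<ge>N. \<forall>n\<ge>N. (LINT x|M. (cmod (f m x - f n x))\<^sup>2) < e"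
  shows "\<exists>g\<in>L2 M. (\<lambda>n. LINT x|M. (cmod (f n x - g x))\<^sup>2) \<longlonglongrightarrow> 0"
proof -
  have "\<exists>N. \<forall>m\<ge>N. \<forall>n\<ge>N. (LINT x|M. (cmod (f m x - f n x))\<^sup>2) < (1/16) ^ k" for k
    using cauchy[of "(1/16)^k"] by simp
  then obtain N where N: "\<And>k m n. N k \<le> m \<Longrightarrow> N k \<le> n \<Longrightarrow> (LINT x|M. (cmod (f m x - f n x))\<^sup>2) < (1/16) ^ k"
    by metis
  \<comment> \<open>Dominates every N j with j \<le> k, whether or not N increases.\<close>
  define r where "r k = (\<Sum>i\<le>k. N i) + k" for k
  have r: "N j \<le> r k" if "j \<le> k" for j k
    using member_le_sum[of j "{..k}" N] that by (simp add: r_def)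
  have r_ge: "k \<le> r k" for k by (simp add: r_def)
  have meas: "f n \<in> borel_measurable M" for n using f by (rule L2_measurable)
  have int: "integrable M (\<lambda>x. (cmod (f m x - f n x))\<^sup>2)" for m n
    using f by (intro L2_square_integrable L2_diff)
  define d where "d k x = f (r (Suc k)) x - f (r k) x" for k x
  have d_meas: "d k \<in> borel_measurable M" for k unfolding d_def using meas by auto
  have "(\<integral>\<^sup>+x. (\<Sum>k. ennreal (4 ^ k * (cmod (d k x))\<^sup>2)) \<partial>M) = (\<Sum>k. \<integral>\<^sup>+x. ennreal (4 ^ k * (cmod (d k x))\<^sup>2) \<partial>M)"
    using d_meas by (intro nn_integral_suminf) measurable
  also have "\<dots> \<le> (\<Sum>k. ennreal ((1/4) ^ k))"
  proof (rule suminf_le)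
    fix k
    have "(\<integral>\<^sup>+x. ennreal (4 ^ k * (cmod (d k x))\<^sup>2) \<partial>M) = ennreal (LINT x|M. 4 ^ k * (cmod (d k x))\<^sup>2)"
      unfolding d_def using int by (intro nn_integral_eq_integral) auto
    also have "(LINT x|M. 4 ^ k * (cmod (d k x))\<^sup>2) = 4 ^ k * (LINT x|M. (cmod (d k x))\<^sup>2)"
      by simp
    also have "\<dots> \<le> 4 ^ k * (1/16) ^ k"
      using N[of k "r (Suc k)" "r k"] r[of k k] r[of k "Suc k"] by (intro mult_left_mono) (auto simp: d_def)
    also have "\<dots> = (1/4 :: real) ^ k" by (simp flip: power_mult_distrib)
    finally show "(\<integral>\<^sup>+x. ennreal (4 ^ k * (cmod (d k x))\<^sup>2) \<partial>M) \<le> ennreal ((1/4) ^ k)"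
      by (simp add: ennreal_leI)
  qed auto
  also have "\<dots> < \<infinity>"
    by (simp add: suminf_ennreal2 summable_geometric ennreal_suminf_neq_top less_top)
  finally have "AE x in M. (\<Sum>k. ennreal (4 ^ k * (cmod (d k x))\<^sup>2)) \<noteq> \<infinity>"
    using d_meas by (intro nn_integral_PInf_AE) (auto simp: less_top)
  then have conv: "AE x in M. convergent (\<lambda>k. f (r k) x)"
  proof eventually_elim
    case (elim x)
    define C where "C = enn2real (\<Sum>k. ennreal (4 ^ k * (cmod (d k x))\<^sup>2))"
    have C: "(\<Sum>k. ennreal (4 ^ k * (cmod (d k x))\<^sup>2)) = ennreal C" "C \<ge> 0"
      using elim by (auto simp: C_def less_top)
    have four: "(2 ^ k)\<^sup>2 = (4 :: real) ^ k" for k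
      unfolding power2_eq_square by (simp flip: power_mult_distrib)
    have "cmod (d k x) \<le> sqrt C * (1/2) ^ k" for k
    proof -
      have "(\<Sum>k\<in>{k}. ennreal (4 ^ k * (cmod (d k x))\<^sup>2)) \<le> (\<Sum>k. ennreal (4 ^ k * (cmod (d k x))\<^sup>2))"
        by (rule sum_le_suminf) auto
      then have "ennreal (4 ^ k * (cmod (d k x))\<^sup>2) \<le> ennreal C"
        unfolding C(1) by (subst (asm) sum.insert) auto
      then have "4 ^ k * (cmod (d k x))\<^sup>2 \<le> C" using C(2) by simp
      moreover have "4 ^ k * (cmod (d k x))\<^sup>2 = (2 ^ k * cmod (d k x))\<^sup>2"
        using four[of k] by (simp add: power_mult_distrib)
      ultimately have "2 ^ k * cmod (d k x) \<le> sqrt C" by (simp add: real_le_rsqrt)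
      then show ?thesis by (simp add: field_simps)
    qed
    moreover have "summable (\<lambda>k. sqrt C * (1/2) ^ k)" by (intro summable_mult summable_geometric) simp
    ultimately have "summable (\<lambda>k. d k x)" by (meson summable_comparison_test')
    then have "convergent (\<lambda>n. \<Sum>k<n. d k x)" by (simp add: summable_iff_convergent)
    then have "convergent (\<lambda>n. f (r n) x - f (r 0) x)" unfolding d_def sum_lessThan_telescope[of "\<lambda>n. f (r n) x"] .
    then have "convergent (\<lambda>n. (f (r n) x - f (r 0) x) + f (r 0) x)" by (intro convergent_add convergent_const)
    then show ?case by simp
  qed
  define g where "g x = lim (\<lambda>k. f (r k) x)" for x
  have g_meas: "g \<in> borel_measurable M" unfolding g_def using meas by (intro borel_measurable_lim_metric) auto
  have lim: "AE x in M. (\<lambda>k. f (r k) x) \<longlonglongrightarrow> g x"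
    using conv by eventually_elim (simp add: g_def convergent_LIMSEQ_iff)
  \<comment> \<open>Fatou's lemma along the subsequence carries the Cauchy estimate to the distance
    from the limit, for the full sequence.\<close>
  have fatou: "(\<integral>\<^sup>+x. ennreal ((cmod (f n x - g x))\<^sup>2) \<partial>M) \<le> ennreal ((1/16) ^ k)" if n: "N k \<le> n" for n k
  proof -
    have "(\<integral>\<^sup>+x. ennreal ((cmod (f n x - g x))\<^sup>2) \<partial>M)
        = (\<integral>\<^sup>+x. liminf (\<lambda>j. ennreal ((cmod (f n x - f (r j) x))\<^sup>2)) \<partial>M)"
    proof (rule nn_integral_cong_AE, use lim in eventually_elim)
      case (elim x)
      then have "(\<lambda>j. ennreal ((cmod (f n x - f (r j) x))\<^sup>2)) \<longlonglongrightarrow> ennreal ((cmod (f n x - g x))\<^sup>2)"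
        by (intro tendsto_intros)
      then show ?case by (rule lim_imp_Liminf[OF trivial_limit_sequentially, symmetric])
    qed
    also have "\<dots> \<le> liminf (\<lambda>j. \<integral>\<^sup>+x. ennreal ((cmod (f n x - f (r j) x))\<^sup>2) \<partial>M)"
      using meas by (intro nn_integral_liminf) measurable
    also have "\<dots> \<le> limsup (\<lambda>j. \<integral>\<^sup>+x. ennreal ((cmod (f n x - f (r j) x))\<^sup>2) \<partial>M)"
      by (rule Liminf_le_Limsup) simp
    also have "\<dots> \<le> ennreal ((1/16) ^ k)"
    proof (rule Limsup_bounded, unfold eventually_sequentially, intro exI allI impI)
      fix j assume "k \<le> j"
      then have "(LINT x|M. (cmod (f n x - f (r j) x))\<^sup>2) < (1/16) ^ k" using N n r by blast
      then show "(\<integral>\<^sup>+x. ennreal ((cmod (f n x - f (r j) x))\<^sup>2) \<partial>M) \<le> ennreal ((1/16) ^ k)"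
        using int by (subst nn_integral_eq_integral) (auto intro!: ennreal_leI)
    qed
    finally show ?thesis .
  qed
  have diff_int: "integrable M (\<lambda>x. (cmod (f n x - g x))\<^sup>2)" if "N k \<le> n" for n k
  proof (rule integrableI_bounded)
    show "(\<lambda>x. (cmod (f n x - g x))\<^sup>2) \<in> borel_measurable M" using meas g_meas by measurable
    show "(\<integral>\<^sup>+x. ennreal (norm ((cmod (f n x - g x))\<^sup>2)) \<partial>M) < \<infinity>"
      using fatou[OF that] by (simp add: le_less_trans)
  qed
  have "(\<lambda>x. f (N 0) x - g x) \<in> L2 M"
    using diff_int[of 0 "N 0"] meas g_meas by (auto simp: L2_def)
  from L2_diff[OF f[of "N 0"] this] have g: "g \<in> L2 M" by simp
  have bound: "(LINT x|M. (cmod (f n x - g x))\<^sup>2) \<le> (1/16) ^ k" if "N k \<le> n" for n k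
    using fatou[OF that] diff_int[OF that] by (subst (asm) nn_integral_eq_integral) auto
  have "(\<lambda>n. LINT x|M. (cmod (f n x - g x))\<^sup>2) \<longlonglongrightarrow> 0"
  proof (rule LIMSEQ_I)
    fix e :: real assume "e > 0"
    then obtain k where k: "(1/16 :: real) ^ k < e" using real_arch_pow_inv[of e "1/16"] by auto
    have "norm ((LINT x|M. (cmod (f n x - g x))\<^sup>2) - 0) < e" if "n \<ge> N k" for n
      using bound[OF that] k by simp
    then show "\<exists>no. \<forall>n\<ge>no. norm ((LINT x|M. (cmod (f n x - g x))\<^sup>2) - 0) < e" by blast
  qed
  then show ?thesis using g by blast
qed

section \<open>The real Hilbert space of square integrable functions modulo null sets\<close>

abbreviation halfline :: "real measure" where
  "halfline \<equiv> lebesgue_on {0<..}"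

text \<open>Only a partial equivalence: square integrability is encoded in its domain, so the
  quotient is directly the space of classes.\<close>

definition L2_rel :: "(real \<Rightarrow> complex) \<Rightarrow> (real \<Rightarrow> complex) \<Rightarrow> bool" where
  "L2_rel f g \<longleftrightarrow> f \<in> L2 halfline \<and> g \<in> L2 halfline \<and> (AE x in halfline. f x = g x)"

quotient_type l2h = "real \<Rightarrow> complex" / partial: L2_rel
proof (rule part_equivpI)
  show "\<exists>x. L2_rel x x" by (rule exI[of _ "\<lambda>_. 0"]) (simp add: L2_rel_def L2_0)
  show "symp L2_rel" by (rule sympI) (auto simp: L2_rel_def)
  show "transp L2_rel" by (rule transpI) (auto simp: L2_rel_def)
qed

lemma rep_l2h_L2: "rep_l2h x \<in> L2 halfline"
  using Quotient_rep_reflp[OF Quotient_l2h, of x] by (simp add: L2_rel_def)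

lemma abs_l2h_rep: "abs_l2h (rep_l2h x) = x"
  by (rule Quotient_abs_rep[OF Quotient_l2h])

lemma abs_l2h_eq_iff:
  assumes "f \<in> L2 halfline" "g \<in> L2 halfline"
  shows "abs_l2h f = abs_l2h g \<longleftrightarrow> (AE x in halfline. f x = g x)"
  using Quotient_rel[OF Quotient_l2h, of f g] assms by (auto simp: L2_rel_def)

instantiation l2h :: real_vector
begin

lift_definition zero_l2h :: l2h is "\<lambda>_. 0" by (simp add: L2_rel_def L2_0)
lift_definition plus_l2h :: "l2h \<Rightarrow> l2h \<Rightarrow> l2h" is "\<lambda>f g x. f x + g x"
  by (auto simp: L2_rel_def L2_add)
lift_definition minus_l2h :: "l2h \<Rightarrow> l2h \<Rightarrow> l2h" is "\<lambda>f g x. f x - g x"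
  by (auto simp: L2_rel_def L2_diff)
lift_definition uminus_l2h :: "l2h \<Rightarrow> l2h" is "\<lambda>f x. - f x"
  by (auto simp: L2_rel_def L2_uminus)
lift_definition scaleR_l2h :: "real \<Rightarrow> l2h \<Rightarrow> l2h" is "\<lambda>r f x. of_real r * f x"
  by (auto simp: L2_rel_def L2_cmult)

instance
proof
  fix a b c :: l2h and r s :: real
  show "a + b + c = a + (b + c)" "a + b = b + a" "0 + a = a" "- a + a = 0" "a - b = a + - b" "1 *\<^sub>R a = a"
    by (transfer; auto simp: L2_rel_def add_ac intro!: L2_add L2_diff L2_uminus L2_0)+
  show "r *\<^sub>R (a + b) = r *\<^sub>R a + r *\<^sub>R b"
    by transfer (auto simp: L2_rel_def distrib_left intro!: L2_add L2_cmult)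
  show "(r + s) *\<^sub>R a = r *\<^sub>R a + s *\<^sub>R a"
    by transfer (auto simp: L2_rel_def distrib_right intro!: L2_add L2_cmult)
  show "r *\<^sub>R s *\<^sub>R a = (r * s) *\<^sub>R a"
    by transfer (auto simp: L2_rel_def mult.assoc intro!: L2_cmult)
qed

end

instantiation l2h :: real_inner
begin

text \<open>Only the real part, in order to obtain a real inner product space; the imaginary part is
  recovered by inserting multiplication by i in the second argument.\<close>

lift_definition inner_l2h :: "l2h \<Rightarrow> l2h \<Rightarrow> real" is "\<lambda>f g. Re (LINT x|halfline. f x * cnj (g x))"
proof -
  fix f f' g g' assume *: "L2_rel f f'" "L2_rel g g'"
  then have [measurable]: "f \<in> borel_measurable halfline" "f' \<in> borel_measurable halfline"
    "g \<in> borel_measurable halfline" "g' \<in> borel_measurable halfline"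
    by (auto simp: L2_rel_def L2_measurable)
  have "(LINT x|halfline. f x * cnj (g x)) = (LINT x|halfline. f' x * cnj (g' x))"
    by (rule integral_cong_AE) (use * in \<open>auto simp: L2_rel_def\<close>)
  then show "Re (LINT x|halfline. f x * cnj (g x)) = Re (LINT x|halfline. f' x * cnj (g' x))" by simp
qed

definition norm_l2h :: "l2h \<Rightarrow> real" where "norm_l2h x = sqrt (inner x x)"
definition dist_l2h :: "l2h \<Rightarrow> l2h \<Rightarrow> real" where "dist_l2h x y = norm (x - y)"
definition sgn_l2h :: "l2h \<Rightarrow> l2h" where "sgn_l2h x = inverse (norm x) *\<^sub>R x"
definition uniformity_l2h :: "(l2h \<times> l2h) filter" where
  "uniformity_l2h = (INF e\<in>{0<..}. principal {(x, y). dist x y < e})"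
definition open_l2h :: "l2h set \<Rightarrow> bool" where
  "open_l2h U \<longleftrightarrow> (\<forall>x\<in>U. \<forall>\<^sub>F (x', y) in uniformity. x' = x \<longrightarrow> y \<in> U)"

lemma Re_integral_mult_cnj_self:
  "Re (LINT x|M. f x * cnj (f x)) = (LINT x|M. (cmod (f x))\<^sup>2)"
proof -
  have "(LINT x|M. f x * cnj (f x)) = (LINT x|M. complex_of_real ((cmod (f x))\<^sup>2))"
    by (simp add: complex_mult_cnj cmod_power2)
  also have "\<dots> = of_real (LINT x|M. (cmod (f x))\<^sup>2)" by (rule integral_complex_of_real)
  finally show ?thesis by simp
qed

instance
proof
  fix x y z :: l2h and r :: real
  show "dist x y = norm (x - y)" by (rule dist_l2h_def)
  show "sgn x = x /\<^sub>R norm x" by (rule sgn_l2h_def)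
  show "(uniformity :: (l2h \<times> l2h) filter) = (INF e\<in>{0<..}. principal {(x, y). dist x y < e})"
    by (rule uniformity_l2h_def)
  show "open U \<longleftrightarrow> (\<forall>x\<in>U. \<forall>\<^sub>F (x', y) in uniformity. x' = x \<longrightarrow> y \<in> U)" for U :: "l2h set"
    by (rule open_l2h_def)
  show "norm x = sqrt (inner x x)" by (rule norm_l2h_def)
  show "inner x y = inner y x"
  proof transfer
    fix f g :: "real \<Rightarrow> complex"
    have "cnj (LINT x|halfline. f x * cnj (g x)) = (LINT x|halfline. g x * cnj (f x))"
      by (subst Bochner_Integration.integral_cnj[symmetric]) (simp add: mult.commute)
    then show "Re (LINT x|halfline. f x * cnj (g x)) = Re (LINT x|halfline. g x * cnj (f x))"
      by (metis cnj.simps(1))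
  qed
  show "inner (x + y) z = inner x z + inner y z"
  proof transfer
    fix f g h assume "L2_rel f f" "L2_rel g g" "L2_rel h h"
    then have "integrable halfline (\<lambda>x. f x * cnj (h x))" "integrable halfline (\<lambda>x. g x * cnj (h x))"
      by (auto simp: L2_rel_def intro!: L2_integrable_mult_cnj)
    then show "Re (LINT x|halfline. (f x + g x) * cnj (h x))
        = Re (LINT x|halfline. f x * cnj (h x)) + Re (LINT x|halfline. g x * cnj (h x))"
      by (simp add: distrib_right)
  qed
  show "inner (r *\<^sub>R x) y = r * inner x y"
    by transfer (simp add: mult.assoc)
  show "0 \<le> inner x x"
    by transfer (simp add: Re_integral_mult_cnj_self)
  show "inner x x = 0 \<longleftrightarrow> x = 0"
  proof transfer
    fix f assume "L2_rel f f"
    then have f: "f \<in> L2 halfline" by (simp add: L2_rel_def)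
    have "(LINT x|halfline. (cmod (f x))\<^sup>2) = 0 \<longleftrightarrow> (AE x in halfline. (cmod (f x))\<^sup>2 = 0)"
      by (rule integral_nonneg_eq_0_iff_AE[OF L2_square_integrable[OF f]]) simp
    then show "Re (LINT x|halfline. f x * cnj (f x)) = 0 \<longleftrightarrow> L2_rel f (\<lambda>_. 0)"
      by (simp add: Re_integral_mult_cnj_self L2_rel_def f L2_0)
  qed
qed

end

lemma abs_l2h_add: "f \<in> L2 halfline \<Longrightarrow> g \<in> L2 halfline \<Longrightarrow> abs_l2h (\<lambda>x. f x + g x) = abs_l2h f + abs_l2h g"
  by (simp add: plus_l2h.abs_eq L2_rel_def)

lemma abs_l2h_diff: "f \<in> L2 halfline \<Longrightarrow> g \<in> L2 halfline \<Longrightarrow> abs_l2h (\<lambda>x. f x - g x) = abs_l2h f - abs_l2h g"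
  by (simp add: minus_l2h.abs_eq L2_rel_def)

lemma abs_l2h_scaleR: "f \<in> L2 halfline \<Longrightarrow> abs_l2h (\<lambda>x. of_real r * f x) = r *\<^sub>R abs_l2h f"
  by (simp add: scaleR_l2h.abs_eq L2_rel_def)

lemma inner_abs_l2h:
  "f \<in> L2 halfline \<Longrightarrow> g \<in> L2 halfline \<Longrightarrow> inner (abs_l2h f) (abs_l2h g) = Re (LINT x|halfline. f x * cnj (g x))"
  by (simp add: inner_l2h.abs_eq L2_rel_def)

lemma norm_abs_l2h: "f \<in> L2 halfline \<Longrightarrow> norm (abs_l2h f) = l2norm halfline f"
  by (simp add: norm_eq_sqrt_inner inner_abs_l2h Re_integral_mult_cnj_self l2norm_def)

instance l2h :: banach
proof
  fix X :: "nat \<Rightarrow> l2h" assume X: "Cauchy X"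
  define f where "f n = rep_l2h (X n)" for n
  have f: "f n \<in> L2 halfline" for n by (simp add: f_def rep_l2h_L2)
  have fX: "abs_l2h (f n) = X n" for n by (simp add: f_def abs_l2h_rep)
  have nrm: "(LINT x|halfline. (cmod (f m x - g x))\<^sup>2) = (norm (X m - abs_l2h g))\<^sup>2" if "g \<in> L2 halfline" for m g
    using norm_abs_l2h[OF L2_diff[OF f[of m] that]] that f
    by (simp add: abs_l2h_diff fX l2norm_def)
  have "\<exists>g\<in>L2 halfline. (\<lambda>n. LINT x|halfline. (cmod (f n x - g x))\<^sup>2) \<longlonglongrightarrow> 0"
  proof (rule L2_complete[OF f])
    fix e :: real assume e: "e > 0"
    then obtain N where "\<And>m n. m \<ge> N \<Longrightarrow> n \<ge> N \<Longrightarrow> norm (X m - X n) < sqrt e"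
      using CauchyD[OF X, of "sqrt e"] by auto
    then have "(norm (X m - X n))\<^sup>2 < e" if "m \<ge> N" "n \<ge> N" for m n
      using that e power_strict_mono[of "norm (X m - X n)" "sqrt e" 2] by auto
    then show "\<exists>N. \<forall>m\<ge>N. \<forall>n\<ge>N. (LINT x|halfline. (cmod (f m x - f n x))\<^sup>2) < e"
      using nrm[OF f] fX by auto
  qed
  then obtain g where g: "g \<in> L2 halfline" "(\<lambda>n. (norm (X n - abs_l2h g))\<^sup>2) \<longlonglongrightarrow> 0"
    using nrm by auto
  then have "(\<lambda>n. norm (X n - abs_l2h g)) \<longlonglongrightarrow> 0"
    using tendsto_real_sqrt[OF g(2)] by simp
  then have "X \<longlonglongrightarrow> abs_l2h g" by (simp add: tendsto_norm_zero_iff LIM_zero_iff)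
  then show "convergent X" by (auto simp: convergent_def)
qed

lift_definition l2h_mult_i :: "l2h \<Rightarrow> l2h" is "\<lambda>f x. \<i> * f x"
  by (auto simp: L2_rel_def L2_cmult)

lemma l2h_mult_i_abs: "f \<in> L2 halfline \<Longrightarrow> abs_l2h (\<lambda>x. \<i> * f x) = l2h_mult_i (abs_l2h f)"
  by (simp add: l2h_mult_i.abs_eq L2_rel_def)

lemma inner_l2h_mult_i: "inner (l2h_mult_i x) (l2h_mult_i y) = inner x y"
  by transfer (simp add: mult_ac)

lemma l2h_mult_i_twice: "l2h_mult_i (l2h_mult_i x) = - x"
  by transfer (simp add: L2_rel_def L2_uminus mult.assoc[symmetric])

lemma bounded_linear_l2h_mult_i: "bounded_linear l2h_mult_i"
proof (rule bounded_linear_intro[of _ 1])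
  show "l2h_mult_i (x + y) = l2h_mult_i x + l2h_mult_i y" for x y
    by transfer (simp add: L2_rel_def L2_add L2_cmult distrib_left)
  show "l2h_mult_i (r *\<^sub>R x) = r *\<^sub>R l2h_mult_i x" for r x
    by transfer (auto simp: L2_rel_def mult.left_commute intro!: L2_cmult)
  show "norm (l2h_mult_i x) \<le> norm x * 1" for x
    by (simp add: norm_eq_sqrt_inner inner_l2h_mult_i)
qed

section \<open>Test functions and weak derivatives\<close>

inductive in_span :: "(real \<Rightarrow> complex) set \<Rightarrow> (real \<Rightarrow> complex) \<Rightarrow> bool" for B where
  base: "f \<in> B \<Longrightarrow> in_span B f"
| add: "in_span B f \<Longrightarrow> in_span B g \<Longrightarrow> in_span B (\<lambda>y. f y + g y)"
| cmult: "in_span B f \<Longrightarrow> in_span B (\<lambda>y. k * f y)"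

text \<open>Smoothness asks for an infinite sequence of derivatives. If every generator has a
  derivative in the span of all generators, iterating one choice of derivative never leaves the span
  and supplies the sequence; products, powers and flat exponentials then require one differentiation
  rule each.\<close>

lemma smooth_on_in_span:
  assumes B: "\<And>f. f \<in> B \<Longrightarrow> \<exists>g. in_span B g \<and> (\<forall>y\<in>S. (f has_vector_derivative g y) (at y within S))"
    and u: "in_span B u"
  shows "smooth_on S u"
proof -
  have step: "\<exists>g. in_span B g \<and> (\<forall>y\<in>S. (f has_vector_derivative g y) (at y within S))"
    if "in_span B f" for f
    using that
  proof induction
    case (base f)
    then show ?case by (rule B)
  next
    case (add f g)
    then obtain f' g' where "in_span B f'" "\<forall>y\<in>S. (f has_vector_derivative f' y) (at y within S)"
      "in_span B g'" "\<forall>y\<in>S. (g has_vector_derivative g' y) (at y within S)" by blast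
    then show ?case
      by (intro exI[of _ "\<lambda>y. f' y + g' y"]) (auto intro: in_span.add has_vector_derivative_add)
  next
    case (cmult f k)
    then obtain f' where "in_span B f'" "\<forall>y\<in>S. (f has_vector_derivative f' y) (at y within S)" by blast
    then show ?case
      by (intro exI[of _ "\<lambda>y. k * f' y"]) (auto intro: in_span.cmult has_vector_derivative_mult_right)
  qed
  then obtain d where d: "\<And>f. in_span B f \<Longrightarrow> in_span B (d f)"
    "\<And>f y. in_span B f \<Longrightarrow> y \<in> S \<Longrightarrow> (f has_vector_derivative d f y) (at y within S)"
    by metis
  have span: "in_span B ((d ^^ n) u)" for n by (induction n) (auto intro: u d)
  show ?thesis
    unfolding smooth_on_def
    by (rule exI[of _ "\<lambda>n. (d ^^ n) u"]) (auto intro: d(2) span)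
qed

lemma smooth_on_mult:
  assumes "smooth_on S u" "smooth_on S v"
  shows "smooth_on S (\<lambda>y. u y * v y)"
proof -
  obtain D where D: "D 0 = u" "\<And>n y. y \<in> S \<Longrightarrow> (D n has_vector_derivative D (Suc n) y) (at y within S)"
    using assms(1) unfolding smooth_on_def by blast
  obtain E where E: "E 0 = v" "\<And>n y. y \<in> S \<Longrightarrow> (E n has_vector_derivative E (Suc n) y) (at y within S)"
    using assms(2) unfolding smooth_on_def by blast
  \<comment> \<open>The Leibniz rule keeps the span of these products closed under
    differentiation.\<close>
  define B where "B = {\<lambda>y. D i y * E j y |i j. True}"
  have "smooth_on S (\<lambda>y. D 0 y * E 0 y)"
  proof (rule smooth_on_in_span[of B])
    show "in_span B (\<lambda>y. D 0 y * E 0 y)" by (rule in_span.base) (auto simp: B_def)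
    fix f assume "f \<in> B"
    then obtain i j where f: "f = (\<lambda>y. D i y * E j y)" by (auto simp: B_def)
    have "in_span B (\<lambda>y. D i y * E (Suc j) y)" "in_span B (\<lambda>y. D (Suc i) y * E j y)"
      by (auto intro!: in_span.base simp: B_def)
    then have "in_span B (\<lambda>y. D i y * E (Suc j) y + D (Suc i) y * E j y)" by (rule in_span.add)
    moreover have "\<forall>y\<in>S. (f has_vector_derivative D i y * E (Suc j) y + D (Suc i) y * E j y) (at y within S)"
      unfolding f using has_vector_derivative_mult[OF D(2) E(2)] by blast
    ultimately show "\<exists>g. in_span B g \<and> (\<forall>y\<in>S. (f has_vector_derivative g y) (at y within S))" by blast
  qed
  then show ?thesis by (simp add: D E)
qed

lemma smooth_on_add:
  assumes "smooth_on S u" "smooth_on S v"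
  shows "smooth_on S (\<lambda>y. u y + v y)"
proof -
  obtain D where D: "D 0 = u" "\<And>n y. y \<in> S \<Longrightarrow> (D n has_vector_derivative D (Suc n) y) (at y within S)"
    using assms(1) unfolding smooth_on_def by blast
  obtain E where E: "E 0 = v" "\<And>n y. y \<in> S \<Longrightarrow> (E n has_vector_derivative E (Suc n) y) (at y within S)"
    using assms(2) unfolding smooth_on_def by blast
  show ?thesis
    unfolding smooth_on_def
    by (rule exI[of _ "\<lambda>n y. D n y + E n y"]) (auto simp: D(1) E(1) intro!: has_vector_derivative_add D(2) E(2))
qed

lemma smooth_on_const: "smooth_on S (\<lambda>y. k)"
  unfolding smooth_on_def by (rule exI[of _ "\<lambda>n y. if n = 0 then k else 0"]) auto

lemma smooth_on_cnj:
  assumes "smooth_on S u"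
  shows "smooth_on S (\<lambda>y. cnj (u y))"
proof -
  obtain D where D: "D 0 = u" "\<And>n y. y \<in> S \<Longrightarrow> (D n has_vector_derivative D (Suc n) y) (at y within S)"
    using assms unfolding smooth_on_def by blast
  show ?thesis
    unfolding smooth_on_def
    by (rule exI[of _ "\<lambda>n y. cnj (D n y)"]) (auto simp: D(1) intro!: has_vector_derivative_cnj D(2))
qed

lemma smooth_on_subset:
  assumes "smooth_on T u" "S \<subseteq> T"
  shows "smooth_on S u"
proof -
  obtain D where D: "D 0 = u" "\<And>n y. y \<in> T \<Longrightarrow> (D n has_vector_derivative D (Suc n) y) (at y within T)"
    using assms(1) unfolding smooth_on_def by blast
  have "(D n has_vector_derivative D (Suc n) y) (at y within S)" if "y \<in> S" for n y
    using has_vector_derivative_within_subset[OF D(2) assms(2)] that assms(2) by blast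
  then show ?thesis unfolding smooth_on_def using D(1) by blast
qed

lemma smooth_on_cong_open:
  assumes "smooth_on S u" "open S" "\<And>y. y \<in> S \<Longrightarrow> u y = v y"
  shows "smooth_on S v"
proof -
  obtain D where D: "D 0 = u" "\<And>n y. y \<in> S \<Longrightarrow> (D n has_vector_derivative D (Suc n) y) (at y within S)"
    using assms unfolding smooth_on_def by blast
  define E where "E n = (if n = 0 then v else D n)" for n
  have "(E n has_vector_derivative E (Suc n) y) (at y within S)" if y: "y \<in> S" for n y
  proof (cases n)
    case 0
    have "(v has_vector_derivative D (Suc 0) y) (at y within S)"
      using has_vector_derivative_transform[OF y, of v u] D(2)[OF y, of 0] assms(3) D(1) by metis
    then show ?thesis by (simp add: E_def 0)
  next
    case (Suc m)
    then show ?thesis using D(2)[OF y] by (simp add: E_def)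
  qed
  then show ?thesis unfolding smooth_on_def by (intro exI[of _ E]) (auto simp: E_def)
qed

lemma smooth_on_imp_continuous_on: "smooth_on S u \<Longrightarrow> continuous_on S u"
  unfolding smooth_on_def
  by (metis continuous_on_eq_continuous_within has_vector_derivative_continuous)

lemma smooth_on_deriv:
  assumes "smooth_on {0<..} u"
  shows "\<And>y. 0 < y \<Longrightarrow> (u has_vector_derivative vector_derivative u (at y)) (at y)"
    and "smooth_on {0<..} (\<lambda>y. vector_derivative u (at y))"
proof -
  obtain D where D: "D 0 = u" "\<And>n y. 0 < y \<Longrightarrow> (D n has_vector_derivative D (Suc n) y) (at y within {0<..})"
    using assms unfolding smooth_on_def by auto
  have D': "(D n has_vector_derivative D (Suc n) y) (at y)" if "0 < y" for n y
    using D(2)[OF that] that at_within_open[of y "{0<..}"] by simp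
  have eq: "vector_derivative u (at y) = D 1 y" if "0 < y" for y
    using vector_derivative_at[OF D'[OF that, of 0]] D(1) by simp
  show "(u has_vector_derivative vector_derivative u (at y)) (at y)" if "0 < y" for y
    using D'[OF that, of 0] eq[OF that] D(1) by simp
  have "smooth_on {0<..} (D 1)" unfolding smooth_on_def
    by (rule exI[of _ "\<lambda>n. D (Suc n)"]) (use D in auto)
  then show "smooth_on {0<..} (\<lambda>y. vector_derivative u (at y))"
    by (rule smooth_on_cong_open) (auto simp: eq)
qed

lemma has_vector_derivative_locally_const:
  assumes "open S" "y \<in> S" "\<And>x. x \<in> S \<Longrightarrow> f x = k"
  shows "(f has_vector_derivative 0) (at y)"
  by (rule has_vector_derivative_transform_within_open[OF has_vector_derivative_const[of k] assms(1,2)])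
    (simp add: assms(3))

lemma smooth_on_powr: "smooth_on {0<..} (\<lambda>y. complex_of_real (y powr k))"
proof (rule smooth_on_in_span)
  let ?B = "{\<lambda>y. complex_of_real (y powr k) |k. True}"
  show "in_span ?B (\<lambda>y. complex_of_real (y powr k))" by (rule in_span.base) auto
  fix f assume "f \<in> ?B"
  then obtain k where f: "f = (\<lambda>y. complex_of_real (y powr k))" by auto
  have "in_span ?B (\<lambda>y. of_real k * complex_of_real (y powr (k - 1)))"
    by (rule in_span.cmult, rule in_span.base) auto
  moreover have "(f has_vector_derivative of_real k * complex_of_real (y powr (k - 1))) (at y within {0<..})" if "y \<in> {0<..}" for y
  proof -
    have "((\<lambda>y. y powr k) has_real_derivative k * y powr (k - 1)) (at y within {0<..})"
      using that by (auto intro!: derivative_eq_intros simp: powr_diff field_simps)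
    from has_vector_derivative_of_real[OF this] show ?thesis unfolding f by simp
  qed
  ultimately show "\<exists>g. in_span ?B g \<and> (\<forall>y\<in>{0<..}. (f has_vector_derivative g y) (at y within {0<..}))" by blast
qed

section \<open>Flat exponentials, bumps and test functions\<close>

definition flat_exp :: "nat \<Rightarrow> real \<Rightarrow> real" where
  "flat_exp k x = (if x \<le> 0 then 0 else (1 / x) ^ k * exp (- (1 / x)))"

text \<open>The single term of index k + 2 in the exponential series at 1 / x. Quadratic decay makes
  the difference quotient at 0 vanish in the limit, for every k.\<close>

lemma flat_exp_le:
  fixes x :: real
  assumes "0 < x"
  shows "(1 / x) ^ k * exp (- (1 / x)) \<le> fact (k + 2) * x\<^sup>2"
proof -
  have "(1 / x) ^ (k + 2) / fact (k + 2) \<le> exp (1 / x)"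
  proof -
    have "(\<Sum>n\<in>{k+2}. (1 / x) ^ n / fact n) \<le> (\<Sum>n. (1 / x) ^ n / fact n)"
      using assms summable_exp[of "1 / x"] by (intro sum_le_suminf) (auto simp: field_simps)
    then show ?thesis by (simp add: exp_def field_simps)
  qed
  then have "(1 / x) ^ k * (1 / x)\<^sup>2 \<le> fact (k + 2) * exp (1 / x)"
    by (simp only: pos_divide_le_eq[OF fact_gt_zero] power_add mult.commute)
  then have "(1 / x) ^ k * (1 / x)\<^sup>2 * exp (- (1 / x)) * x\<^sup>2 \<le> fact (k + 2) * exp (1 / x) * exp (- (1 / x)) * x\<^sup>2"
    by (intro mult_right_mono) auto
  then show ?thesis using assms by (simp add: exp_minus power_divide mult_ac del: fact_Suc)
qed

text \<open>With Z = 1 / x, Z' = - Z^2, the derivative of Z^k exp (- Z) is a combination of the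
  members k + 2 and k + 1 of the same family, which \<open>smooth_on_in_span\<close> turns into
  smoothness across 0.\<close>

lemma flat_exp_deriv:
  "(flat_exp k has_real_derivative flat_exp (k + 2) x - real k * flat_exp (k + 1) x) (at x)"
proof -
  consider "x < 0" | "x = 0" | "0 < x" by linarith
  then show ?thesis
  proof cases
    case 1
    have "((\<lambda>x. 0) has_real_derivative 0) (at x)" by simp
    then have "(flat_exp k has_real_derivative 0) (at x)"
      by (rule has_field_derivative_transform_within_open[where S = "{..<0}"]) (use 1 in \<open>auto simp: flat_exp_def\<close>)
    then show ?thesis using 1 by (simp add: flat_exp_def)
  next
    case 2
    have "((\<lambda>h. (flat_exp k (0 + h) - flat_exp k 0) / h) \<longlongrightarrow> 0) (at 0)"
    proof (rule Lim_null_comparison)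
      show "\<forall>\<^sub>F h in at 0. norm ((flat_exp k (0 + h) - flat_exp k 0) / h) \<le> fact (k + 2) * \<bar>h\<bar>"
      proof (rule always_eventually, rule allI)
        fix h :: real
        show "norm ((flat_exp k (0 + h) - flat_exp k 0) / h) \<le> fact (k + 2) * \<bar>h\<bar>"
        proof (cases "0 < h")
          case True
          then show ?thesis using flat_exp_le[of h k]
            by (simp add: flat_exp_def divide_le_eq power2_eq_square abs_mult mult.assoc del: fact_Suc)
        next
          case False
          then have "flat_exp k (0 + h) - flat_exp k 0 = 0" by (simp add: flat_exp_def)
          then show ?thesis by (simp only: div_0 norm_zero) (intro mult_nonneg_nonneg abs_ge_zero fact_ge_zero)
        qed
      qed
      have "((\<lambda>h::real. fact (k + 2) * \<bar>h\<bar>) \<longlongrightarrow> fact (k + 2) * \<bar>0\<bar>) (at 0)" by (intro tendsto_intros)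
      then show "((\<lambda>h::real. fact (k + 2) * \<bar>h\<bar>) \<longlongrightarrow> 0) (at 0)" by simp
    qed
    then show ?thesis unfolding DERIV_def using 2 by (simp add: flat_exp_def)
  next
    case 3
    have "((\<lambda>x. (1 / x) ^ k * exp (- (1 / x))) has_real_derivative flat_exp (k + 2) x - real k * flat_exp (k + 1) x) (at x)"
    proof -
      have z: "((\<lambda>x. 1 / x) has_real_derivative - (1 / x)\<^sup>2) (at x)"
        using 3 by (auto intro!: derivative_eq_intros simp: power2_eq_square)
      have "((\<lambda>x. (1 / x) ^ k * exp (- (1 / x))) has_real_derivative
          (1 / x) ^ k * (exp (- (1 / x)) * (- (- (1 / x)\<^sup>2))) + (real k * (- (1 / x)\<^sup>2 * (1 / x) ^ (k - 1))) * exp (- (1 / x))) (at x)"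
        using DERIV_mult'[OF DERIV_power[OF z, of k] DERIV_fun_exp[OF DERIV_minus[OF z]]] by simp
      moreover have "(1 / x) ^ k * (exp (- (1 / x)) * (- (- (1 / x)\<^sup>2))) + (real k * (- (1 / x)\<^sup>2 * (1 / x) ^ (k - 1))) * exp (- (1 / x))
          = flat_exp (k + 2) x - real k * flat_exp (k + 1) x"
      proof -
        have "Z ^ k * (w * (- (- Z\<^sup>2))) + (real k * (- Z\<^sup>2 * Z ^ (k - 1))) * w = Z ^ (k + 2) * w - real k * (Z ^ (k + 1) * w)" for Z w :: real
          by (cases k) (simp_all add: power2_eq_square)
        then show ?thesis using 3 by (simp only: flat_exp_def not_le[symmetric] if_False)
      qed
      ultimately show ?thesis by (simp only:)
    qed
    then show ?thesis
      by (rule has_field_derivative_transform_within_open[where S = "{0<..}"]) (use 3 in \<open>auto simp: flat_exp_def\<close>)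
  qed
qed

lemma smooth_on_flat_exp_affine: "smooth_on UNIV (\<lambda>y. complex_of_real (flat_exp 0 (a * y + b)))"
proof (rule smooth_on_in_span)
  let ?B = "{\<lambda>y. complex_of_real (flat_exp k (a * y + b)) |k. True}"
  show "in_span ?B (\<lambda>y. complex_of_real (flat_exp 0 (a * y + b)))" by (rule in_span.base) auto
  fix f assume "f \<in> ?B"
  then obtain k where f: "f = (\<lambda>y. complex_of_real (flat_exp k (a * y + b)))" by auto
  let ?g = "\<lambda>y. of_real a * complex_of_real (flat_exp (k + 2) (a * y + b)) + of_real (- a * k) * complex_of_real (flat_exp (k + 1) (a * y + b))"
  have "in_span ?B ?g"
    by (intro in_span.add in_span.cmult in_span.base) auto
  moreover have "(f has_vector_derivative ?g y) (at y within UNIV)" for y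
  proof -
    have "((\<lambda>y. flat_exp k (a * y + b)) has_real_derivative (flat_exp (k + 2) (a * y + b) - real k * flat_exp (k + 1) (a * y + b)) * a) (at y)"
      by (rule DERIV_chain2[OF flat_exp_deriv]) (auto intro!: derivative_eq_intros)
    then have "((\<lambda>y. complex_of_real (flat_exp k (a * y + b))) has_vector_derivative
        of_real ((flat_exp (k + 2) (a * y + b) - real k * flat_exp (k + 1) (a * y + b)) * a)) (at y)"
      by (rule has_vector_derivative_of_real)
    moreover have "of_real ((flat_exp (k + 2) (a * y + b) - real k * flat_exp (k + 1) (a * y + b)) * a) = ?g y"
      by (simp add: algebra_simps)
    ultimately show ?thesis unfolding f by (simp only:)
  qed
  ultimately show "\<exists>g. in_span ?B g \<and> (\<forall>y\<in>UNIV. (f has_vector_derivative g y) (at y within UNIV))" by blast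
qed

text \<open>Positive exactly on (p, q) and at most 1; the factor n + 1 steepens the flanks, so that
  the bumps tend pointwise to the indicator of the open interval.\<close>

definition bump :: "real \<Rightarrow> real \<Rightarrow> nat \<Rightarrow> real \<Rightarrow> complex" where
  "bump p q n y = of_real (flat_exp 0 (real (Suc n) * (y - p))) * of_real (flat_exp 0 (real (Suc n) * (q - y)))"

lemma smooth_on_bump: "smooth_on UNIV (bump p q n)"
  unfolding bump_def[abs_def]
  using smooth_on_mult[OF smooth_on_flat_exp_affine[of "real (Suc n)" "- (real (Suc n) * p)"]
      smooth_on_flat_exp_affine[of "- real (Suc n)" "real (Suc n) * q"]]
  by (simp add: algebra_simps)

lemma bump_outside: "y \<notin> {p<..<q} \<Longrightarrow> bump p q n y = 0"
proof -
  assume "y \<notin> {p<..<q}"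
  then have "y - p \<le> 0 \<or> q - y \<le> 0" by auto
  then have "real (Suc n) * (y - p) \<le> 0 \<or> real (Suc n) * (q - y) \<le> 0"
    by (meson mult_nonneg_nonpos of_nat_0_le_iff)
  then show ?thesis by (auto simp: bump_def flat_exp_def simp del: of_nat_Suc)
qed

lemma test_functionI:
  assumes "smooth_on {0<..} \<phi>" "0 < a" "\<And>y. 0 < y \<Longrightarrow> y \<notin> {a..b} \<Longrightarrow> \<phi> y = 0"
  shows "\<phi> \<in> test_functions"
  using assms unfolding test_functions_def by blast

lemma bump_test_function:
  assumes "0 < p"
  shows "bump p q n \<in> test_functions"
proof (rule test_functionI[OF _ assms])
  show "smooth_on {0<..} (bump p q n)" by (rule smooth_on_subset[OF smooth_on_bump]) simp
  show "bump p q n y = 0" if "y \<notin> {p..q}" for y using that by (intro bump_outside) auto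
qed

lemma norm_bump_le: "cmod (bump p q n y) \<le> 1"
  unfolding bump_def norm_mult
  by (intro mult_le_one) (auto simp: flat_exp_def)

lemma bump_tendsto: "(\<lambda>n. bump p q n y) \<longlonglongrightarrow> indicator {p<..<q} y"
proof (cases "y \<in> {p<..<q}")
  case True
  have *: "(\<lambda>n. flat_exp 0 (real (Suc n) * d)) \<longlonglongrightarrow> 1" if d: "d > 0" for d
  proof -
    have "(\<lambda>n. - ((1 / d) * (1 / real (Suc n)))) \<longlonglongrightarrow> - ((1 / d) * 0)"
      by (intro tendsto_intros LIMSEQ_Suc[OF lim_1_over_n])
    then have "(\<lambda>n. exp (- ((1 / d) * (1 / real (Suc n))))) \<longlonglongrightarrow> exp (- ((1 / d) * 0))"
      by (rule tendsto_exp)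
    moreover have "flat_exp 0 (real (Suc n) * d) = exp (- ((1 / d) * (1 / real (Suc n))))" for n
      using d by (simp add: flat_exp_def mult_le_0_iff not_le)
    ultimately show ?thesis by simp
  qed
  have "(\<lambda>n. bump p q n y) \<longlonglongrightarrow> of_real 1 * of_real 1"
    unfolding bump_def using True by (intro tendsto_mult tendsto_of_real *) auto
  then show ?thesis using True by simp
qed (simp add: bump_outside)

lemma test_function_bounds:
  assumes "\<phi> \<in> test_functions"
  obtains a b where "0 < a" "a < b" "\<And>y. 0 < y \<Longrightarrow> y \<notin> {a..b} \<Longrightarrow> \<phi> y = 0" "smooth_on {0<..} \<phi>"
proof -
  obtain a b where "0 < a" "\<And>y. 0 < y \<Longrightarrow> y \<notin> {a..b} \<Longrightarrow> \<phi> y = 0" "smooth_on {0<..} \<phi>"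
    using assms unfolding test_functions_def by auto
  then show ?thesis using that[of a "max b (a + 1)"] by fastforce
qed

lemma test_function_mult:
  assumes "\<phi> \<in> test_functions" "smooth_on {0<..} u"
  shows "(\<lambda>y. u y * \<phi> y) \<in> test_functions"
  using assms smooth_on_mult[of "{0<..}" u \<phi>] unfolding test_functions_def by force

lemma test_function_cnj: "\<phi> \<in> test_functions \<Longrightarrow> (\<lambda>y. cnj (\<phi> y)) \<in> test_functions"
  using smooth_on_cnj[of "{0<..}" \<phi>] unfolding test_functions_def by force

lemma test_function_add:
  assumes "\<phi> \<in> test_functions" "\<psi> \<in> test_functions"
  shows "(\<lambda>y. \<phi> y + \<psi> y) \<in> test_functions"
proof -
  obtain a b where 1: "0 < a" "a < b" "\<And>y. 0 < y \<Longrightarrow> y \<notin> {a..b} \<Longrightarrow> \<phi> y = 0" "smooth_on {0<..} \<phi>"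
    by (rule test_function_bounds[OF assms(1)]) blast
  obtain c d where 2: "0 < c" "c < d" "\<And>y. 0 < y \<Longrightarrow> y \<notin> {c..d} \<Longrightarrow> \<psi> y = 0" "smooth_on {0<..} \<psi>"
    by (rule test_function_bounds[OF assms(2)]) blast
  show ?thesis
  proof (rule test_functionI[of _ "min a c" "max b d"])
    fix y assume y: "0 < y" "y \<notin> {min a c..max b d}"
    then have "y \<notin> {a..b}" "y \<notin> {c..d}" by auto
    then show "\<phi> y + \<psi> y = 0" using 1(3) 2(3) y(1) by simp
  qed (use 1 2 in \<open>auto intro: smooth_on_add\<close>)
qed

lemma test_function_cmult: "\<phi> \<in> test_functions \<Longrightarrow> (\<lambda>y. k * \<phi> y) \<in> test_functions"
  using test_function_mult[OF _ smooth_on_const] by simp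

lemma vector_derivative_outside_support:
  assumes "\<And>y. 0 < y \<Longrightarrow> y \<notin> {a..b} \<Longrightarrow> \<phi> y = 0" "0 < y" "y \<notin> {a..b}"
  shows "vector_derivative \<phi> (at y) = 0"
  by (rule vector_derivative_at, rule has_vector_derivative_locally_const[of "{0<..} - {a..b}" _ _ 0])
    (use assms in \<open>auto intro: open_Diff\<close>)

lemma test_function_deriv:
  assumes "\<phi> \<in> test_functions"
  shows "(\<lambda>y. vector_derivative \<phi> (at y)) \<in> test_functions"
proof -
  obtain a b where ab: "0 < a" "a < b" "\<And>y. 0 < y \<Longrightarrow> y \<notin> {a..b} \<Longrightarrow> \<phi> y = 0" "smooth_on {0<..} \<phi>"
    by (rule test_function_bounds[OF assms]) blast
  show ?thesis
    using ab(1) smooth_on_deriv(2)[OF ab(4)] vector_derivative_outside_support[OF ab(3)]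
    by (intro test_functionI[of _ a b])
qed

lemma test_function_bounded:
  assumes "\<phi> \<in> test_functions"
  obtains C where "\<And>y. 0 < y \<Longrightarrow> cmod (\<phi> y) \<le> C"
proof -
  obtain a b where ab: "0 < a" "a < b" "\<And>y. 0 < y \<Longrightarrow> y \<notin> {a..b} \<Longrightarrow> \<phi> y = 0" "smooth_on {0<..} \<phi>"
    by (rule test_function_bounds[OF assms]) blast
  have "continuous_on {a..b} \<phi>"
    by (rule continuous_on_subset[OF smooth_on_imp_continuous_on[OF ab(4)]]) (use ab(1) in auto)
  then have "bounded (\<phi> ` {a..b})" by (intro compact_imp_bounded compact_continuous_image) auto
  then obtain C where C: "\<And>y. y \<in> {a..b} \<Longrightarrow> cmod (\<phi> y) \<le> C" unfolding bounded_iff by blast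
  have "cmod (\<phi> a) \<le> C" using ab(2) by (intro C) auto
  then have "0 \<le> C" by (rule order.trans[OF norm_ge_zero])
  then have "cmod (\<phi> y) \<le> C" if "0 < y" for y using C ab(3)[OF that] by (cases "y \<in> {a..b}") auto
  then show ?thesis by (rule that)
qed

text \<open>The primitive that vanishes near 0 is constant beyond the support of \<psi>. If that
  constant is 0 the primitive is a test function (du Bois-Reymond); otherwise subtracting it gives a
  core function.\<close>

lemma test_function_antiderivative:
  assumes "\<psi> \<in> test_functions"
  obtains \<Phi> a b where "0 < a" "a < b" "smooth_on UNIV \<Phi>" "\<And>y. y < a \<Longrightarrow> \<Phi> y = 0"
    "\<And>y. 0 < y \<Longrightarrow> (\<Phi> has_vector_derivative \<psi> y) (at y)" "\<And>y. b \<le> y \<Longrightarrow> \<Phi> y = \<Phi> b"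
    "\<And>y. 0 < y \<Longrightarrow> y \<notin> {a..b} \<Longrightarrow> \<psi> y = 0"
proof -
  obtain a b where ab: "0 < a" "a < b" "\<And>y. 0 < y \<Longrightarrow> y \<notin> {a..b} \<Longrightarrow> \<psi> y = 0" "smooth_on {0<..} \<psi>"
    by (rule test_function_bounds[OF assms]) blast
  obtain D where D: "D 0 = \<psi>" "\<And>n y. 0 < y \<Longrightarrow> (D n has_vector_derivative D (Suc n) y) (at y within {0<..})"
    using ab(4) unfolding smooth_on_def by auto
  have D': "(D n has_vector_derivative D (Suc n) y) (at y)" if "0 < y" for n y
    using D(2)[OF that] that at_within_open[of y "{0<..}"] by simp
  have D0: "D n y = 0" if "0 < y" "y < a" for n y
    using that
  proof (induction n arbitrary: y)
    case 0
    then show ?case using ab D(1) by simp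
  next
    case (Suc n)
    have "(D n has_vector_derivative 0) (at y)"
      by (rule has_vector_derivative_locally_const[of "{0<..<a}" _ _ 0]) (use Suc in auto)
    then show ?case using vector_derivative_unique_at D' Suc.prems by blast
  qed
  \<comment> \<open>Extension of all derivatives by 0 to the negative axis; it is smooth because
    they already vanish on (0, a).\<close>
  define E where "E n y = (if y \<le> 0 then 0 else D n y)" for n y
  have E: "(E n has_vector_derivative E (Suc n) y) (at y)" for n y
  proof (cases "0 < y")
    case True
    show ?thesis
      by (rule has_vector_derivative_transform_within_open[where S = "{0<..}" and f = "D n"])
        (use True D' in \<open>auto simp: E_def\<close>)
  next
    case False
    have "(E n has_vector_derivative 0) (at y)"
      by (rule has_vector_derivative_locally_const[of "{..<a}" _ _ 0])
        (use False ab(1) D0 in \<open>auto simp: E_def\<close>)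
    then show ?thesis using False by (simp add: E_def)
  qed
  have E0: "E 0 y = 0" if "y < a" for y using that D0 by (simp add: E_def)
  \<comment> \<open>Starting at a / 2, below the support, makes every y \<ge> a an interior point of
    the interval in the fundamental theorem.\<close>
  define \<Phi> where "\<Phi> y = integral {a/2..y} (E 0)" for y
  have cont: "continuous_on S (E 0)" for S
    using E[of 0] by (meson continuous_at_imp_continuous_on has_vector_derivative_continuous)
  have \<Phi>0: "\<Phi> y = 0" if "y < a" for y
  proof -
    have "integral {a/2..y} (E 0) = integral {a/2..y} (\<lambda>_. 0)"
      by (rule integral_cong) (use that E0 in auto)
    then show ?thesis by (simp add: \<Phi>_def)
  qed
  have \<Phi>': "(\<Phi> has_vector_derivative E 0 y) (at y)" for y
  proof (cases "y < a")
    case True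
    have "(\<Phi> has_vector_derivative 0) (at y)"
      by (rule has_vector_derivative_locally_const[of "{..<a}" _ _ 0]) (use True \<Phi>0 in auto)
    then show ?thesis using True E0 by simp
  next
    case False
    have "(\<Phi> has_vector_derivative E 0 y) (at y within {a/2..y+1})"
      unfolding \<Phi>_def[abs_def] using False ab(1) by (intro integral_has_vector_derivative cont) auto
    moreover have "at y within {a/2..y+1} = at y"
      using False ab(1) by (intro at_within_interior) auto
    ultimately show ?thesis by simp
  qed
  have "smooth_on UNIV \<Phi>"
    unfolding smooth_on_def
    by (rule exI[of _ "\<lambda>n. case n of 0 \<Rightarrow> \<Phi> | Suc m \<Rightarrow> E m"]) (auto simp: E \<Phi>' split: nat.split)
  moreover have "\<Phi> y = \<Phi> b" if "b \<le> y" for y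
  proof -
    have "integral {a/2..b} (E 0) + integral {b..y} (E 0) = integral {a/2..y} (E 0)"
      using ab that by (intro Henstock_Kurzweil_Integration.integral_combine integrable_continuous_real cont) auto
    moreover have "integral {b..y} (E 0) = integral {b..y} (\<lambda>_. 0)"
    \<comment> \<open>The point b is exempted because \<psi> is only known to vanish outside the
      closed interval.\<close>
    proof (rule integral_spike[of "{b}"])
      show "(0::complex) = E 0 x" if "x \<in> {b..y} - {b}" for x
        using that ab D(1) by (auto simp: E_def)
    qed simp
    ultimately show ?thesis by (simp add: \<Phi>_def)
  qed
  moreover have "(\<Phi> has_vector_derivative \<psi> y) (at y)" if "0 < y" for y
    using \<Phi>'[of y] that D(1) by (simp add: E_def)
  ultimately show ?thesis using that[of a b \<Phi>] ab \<Phi>0 by blast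
qed

section \<open>Local integrability and the lemmas of the calculus of variations\<close>

lemma AE_halfline_iff: "(AE y in halfline. P y) \<longleftrightarrow> (AE y in lebesgue. 0 < y \<longrightarrow> P y)"
  by (subst AE_restrict_space_iff) auto

lemma borel_measurable_halfline: "f \<in> borel_measurable borel \<Longrightarrow> f \<in> borel_measurable halfline"
  by (intro measurable_restrict_space1 measurable_completion) simp

lemma borel_measurable_id_halfline [measurable]: "(\<lambda>x. x) \<in> borel_measurable halfline"
  by (rule borel_measurable_halfline) simp

lemma indicator_measurable_halfline [measurable]:
  "A \<in> sets borel \<Longrightarrow> indicator A \<in> borel_measurable halfline"
  by (intro borel_measurable_halfline borel_measurable_indicator)

lemma AE_halfline_positive: "AE y in halfline. 0 < y"
  by (simp add: AE_halfline_iff)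

lemma integral_halfline:
  fixes F :: "real \<Rightarrow> complex"
  shows "(LINT y:{0<..}|lebesgue. F y) = (LINT y|halfline. F y)"
  unfolding set_lebesgue_integral_def by (subst integral_restrict_space) auto

definition locally_integrable :: "(real \<Rightarrow> complex) \<Rightarrow> bool" where
  "locally_integrable f \<longleftrightarrow> (\<forall>a b. 0 < a \<longrightarrow> set_integrable lebesgue {a..b} f)"

lemma locally_integrableD: "locally_integrable f \<Longrightarrow> 0 < a \<Longrightarrow> set_integrable lebesgue {a..b} f"
  by (simp add: locally_integrable_def)

lemma locally_integrable_measurable:
  assumes "locally_integrable f"
  shows "f \<in> borel_measurable halfline"
proof -
  have "(\<lambda>y. indicator {0<..} y *\<^sub>R f y) \<in> borel_measurable lebesgue"
  proof (rule borel_measurable_LIMSEQ_metric)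
    show "(\<lambda>y. indicator {1 / Suc n..Suc n} y *\<^sub>R f y) \<in> borel_measurable lebesgue" for n
      using locally_integrableD[OF assms, of "1 / Suc n" "Suc n"] unfolding set_integrable_def by auto
    fix y :: real
    show "(\<lambda>n. indicator {1 / Suc n..Suc n} y *\<^sub>R f y) \<longlonglongrightarrow> indicator {0<..} y *\<^sub>R f y"
    proof (cases "0 < y")
      case True
      obtain m where m: "1 / y < real m" using reals_Archimedean2 by blast
      obtain m' where m': "y < real m'" using reals_Archimedean2 by blast
      have "y \<in> {1 / Suc n..Suc n}" if "n \<ge> m + m'" for n
      proof -
        have "1 / y \<le> real (Suc n)" using m that by simp
        then have "1 / real (Suc n) \<le> y" using True by (simp add: field_simps)
        then show ?thesis using m' that by simp
      qed
      then have "\<forall>\<^sub>F n in sequentially. indicator {0<..} y *\<^sub>R f y = indicator {1 / Suc n..Suc n} y *\<^sub>R f y"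
        unfolding eventually_sequentially using True by (intro exI[of _ "m + m'"]) auto
      then show ?thesis by (rule Lim_transform_eventually[OF tendsto_const])
    next
      case False
      have "0 < 1 / real (Suc n)" for n by simp
      then have "y \<notin> {1 / Suc n..Suc n}" for n
        using False by (meson atLeastAtMost_iff less_le_trans)
      then show ?thesis using False by simp
    qed
  qed
  then show ?thesis by (subst borel_measurable_restrict_space_iff) auto
qed

lemma locally_integrable_cong_AE:
  assumes f: "locally_integrable f" "AE y in halfline. f y = g y" and g: "g \<in> borel_measurable halfline"
  shows "locally_integrable g"
  unfolding locally_integrable_def set_integrable_def
proof (intro allI impI)
  fix a b :: real assume a: "0 < a"
  have int: "integrable lebesgue (\<lambda>y. indicator {a..b} y *\<^sub>R f y)"
    using locally_integrableD[OF f(1) a] by (simp add: set_integrable_def)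
  show "integrable lebesgue (\<lambda>y. indicator {a..b} y *\<^sub>R g y)"
  proof (rule integrable_cong_AE_imp[OF int])
    have "(\<lambda>y. indicator {0<..} y *\<^sub>R g y) \<in> borel_measurable lebesgue"
      using g by (subst (asm) borel_measurable_restrict_space_iff) auto
    then have "(\<lambda>y. indicator {a..b} y *\<^sub>R (indicator {0<..} y *\<^sub>R g y)) \<in> borel_measurable lebesgue"
      by (rule borel_measurable_scaleR[OF borel_measurable_indicator, rotated]) simp
    also have "(\<lambda>y. indicator {a..b} y *\<^sub>R (indicator {0<..} y *\<^sub>R g y)) = (\<lambda>y. indicator {a..b} y *\<^sub>R g y)"
      using a by (auto simp: indicator_def)
    finally show "(\<lambda>y. indicator {a..b} y *\<^sub>R g y) \<in> borel_measurable lebesgue" .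
    show "AE y in lebesgue. indicator {a..b} y *\<^sub>R f y = indicator {a..b} y *\<^sub>R g y"
      using f(2) unfolding AE_halfline_iff by eventually_elim (use a in \<open>auto simp: indicator_def\<close>)
  qed
qed

lemma smooth_on_measurable: "smooth_on {0<..} u \<Longrightarrow> u \<in> borel_measurable halfline"
  by (intro continuous_imp_measurable_on_sets_lebesgue smooth_on_imp_continuous_on) auto

lemma continuous_on_locally_integrable:
  assumes "continuous_on {0<..} u"
  shows "locally_integrable u"
  unfolding locally_integrable_def
proof (intro allI impI)
  fix a b :: real assume "0 < a"
  then have "continuous_on {a..b} u" by (intro continuous_on_subset[OF assms]) auto
  then have "integrable lborel (\<lambda>y. indicator {a..b} y *\<^sub>R u y)" by (rule borel_integrable_compact[OF compact_Icc])
  then show "set_integrable lebesgue {a..b} u"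
    unfolding set_integrable_def by (simp add: integrable_completion borel_measurable_integrable)
qed

lemma locally_integrable_diff:
  assumes "locally_integrable f" "locally_integrable g"
  shows "locally_integrable (\<lambda>y. f y - g y)"
  using assms by (auto simp: locally_integrable_def)

lemma integrable_mult_test_function:
  assumes f: "locally_integrable f" and \<phi>: "\<phi> \<in> test_functions"
  shows "integrable halfline (\<lambda>y. f y * \<phi> y)"
proof -
  obtain a b where ab: "0 < a" "a < b" "\<And>y. 0 < y \<Longrightarrow> y \<notin> {a..b} \<Longrightarrow> \<phi> y = 0" "smooth_on {0<..} \<phi>"
    by (rule test_function_bounds[OF \<phi>]) blast
  obtain C where C: "\<And>y. 0 < y \<Longrightarrow> cmod (\<phi> y) \<le> C"
    by (rule test_function_bounded[OF \<phi>]) blast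
  have "integrable lebesgue (\<lambda>y. indicator {a..b} y *\<^sub>R f y)"
    using locally_integrableD[OF f ab(1)] by (simp add: set_integrable_def)
  moreover have "(\<lambda>y. indicator {0<..} y *\<^sub>R (indicator {a..b} y *\<^sub>R f y)) = (\<lambda>y. indicator {a..b} y *\<^sub>R f y)"
    using ab(1) by (auto simp: indicator_def)
  ultimately have int: "integrable halfline (\<lambda>y. indicator {a..b} y *\<^sub>R f y)"
    by (subst integrable_restrict_space) auto
  show ?thesis
  proof (rule Bochner_Integration.integrable_bound)
    show "integrable halfline (\<lambda>y. C * cmod (indicator {a..b} y *\<^sub>R f y))"
      using int by (intro integrable_mult_right integrable_norm)
    show "(\<lambda>y. f y * \<phi> y) \<in> borel_measurable halfline"
      using locally_integrable_measurable[OF f] smooth_on_measurable[OF ab(4)] by measurable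
    show "AE y in halfline. norm (f y * \<phi> y) \<le> norm (C * cmod (indicator {a..b} y *\<^sub>R f y))"
      using AE_halfline_positive
    proof eventually_elim
      case (elim y)
      have "0 \<le> C" using C[OF elim] norm_ge_zero order_trans by blast
      then show ?case
        using C[OF elim] ab(3)[OF elim]
        by (cases "y \<in> {a..b}") (auto simp: norm_mult abs_mult mult.commute intro: mult_right_mono)
    qed
  qed
qed

text \<open>Lebesgue differentiation, applied to f cut off below 1 / (n + 1), which is integrable on
  every bounded interval; countably many exceptional sets are then collected.\<close>

lemma AE_zero_of_interval_integrals:
  fixes f :: "real \<Rightarrow> complex"
  assumes f: "locally_integrable f"
    and zero: "\<And>p q. 0 < p \<Longrightarrow> p < q \<Longrightarrow> (LINT y:{p..q}|lebesgue. f y) = 0"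
  shows "AE y in halfline. f y = 0"
proof -
  have *: "AE y in lebesgue. y \<in> {1 / Suc n<..} \<longrightarrow> f y = 0" for n
  proof -
    define a where "a = 1 / real (Suc n)"
    have a: "0 < a" by (simp add: a_def)
    define g where "g y = (if y \<in> {a..} then f y else 0)" for y
    have "g integrable_on cbox p q" for p q
    proof -
      have "f integrable_on {max a p..q}"
        using set_lebesgue_integral_eq_integral(1)[OF locally_integrableD[OF f]] a by auto
      then have "(\<lambda>y. if y \<in> {a..} then f y else 0) integrable_on {p..q} \<longleftrightarrow> f integrable_on ({a..} \<inter> {p..q})"
        by (intro integrable_restrict_Int)
      moreover have "{a..} \<inter> {p..q} = {max a p..q}" by auto
      ultimately show ?thesis using \<open>f integrable_on {max a p..q}\<close> by (simp add: g_def[abs_def])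
    qed
    then obtain N where N: "negligible N" "\<And>x e. \<lbrakk>x \<notin> N; 0 < e\<rbrakk> \<Longrightarrow>
        \<exists>d>0. \<forall>h. 0 < h \<and> h < d \<longrightarrow> norm (integral (cbox x (x + h *\<^sub>R One)) g /\<^sub>R h ^ DIM(real) - g x) < e"
      using integrable_ccontinuous_explicit[of g] by blast
    have "f y = 0" if y: "y \<notin> N" "a < y" for y
    proof (rule ccontr)
      assume "f y \<noteq> 0"
      then obtain d where d: "d > 0" "\<And>h. 0 < h \<Longrightarrow> h < d \<Longrightarrow>
          norm (integral (cbox y (y + h *\<^sub>R One)) g /\<^sub>R h ^ DIM(real) - g y) < norm (f y)"
        using N(2)[OF y(1), of "norm (f y)"] by auto
      have "integral {y..y + d/2} g = integral {y..y + d/2} f"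
        using y(2) by (intro integral_cong) (auto simp: g_def)
      also have "\<dots> = (LINT x:{y..y + d/2}|lebesgue. f x)"
        using y(2) a by (intro set_lebesgue_integral_eq_integral(2)[symmetric] locally_integrableD[OF f]) auto
      also have "\<dots> = 0" using y(2) a d(1) by (intro zero) auto
      finally show False using d(2)[of "d/2"] d(1) y(2) by (simp add: g_def)
    qed
    moreover have "AE y in lebesgue. y \<notin> N"
      using N(1) by (simp add: negligible_iff_null_sets AE_not_in)
    ultimately show ?thesis unfolding a_def[symmetric] by (auto elim: eventually_mono)
  qed
  have "AE y in lebesgue. \<forall>n. y \<in> {1 / Suc n<..} \<longrightarrow> f y = 0" using * by (simp only: AE_all_countable) blast
  then show ?thesis unfolding AE_halfline_iff
  proof eventually_elim
    case (elim y)
    show ?case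
    proof
      assume y: "0 < y"
      obtain m where "1 / y < real m" using reals_Archimedean2 by blast
      then have "1 / y < real (Suc m)" by simp
      then have "1 / real (Suc m) < y" using y by (simp add: field_simps)
      then show "f y = 0" using elim by auto
    qed
  qed
qed

text \<open>Bumps converge boundedly to the indicator of an interval, so dominated convergence
  reduces the claim to vanishing integrals over intervals.\<close>

lemma fundamental_lemma_calculus_of_variations:
  assumes f: "locally_integrable f"
    and zero: "\<And>\<phi>. \<phi> \<in> test_functions \<Longrightarrow> (LINT y|halfline. f y * \<phi> y) = 0"
  shows "AE y in halfline. f y = 0"
proof (rule AE_zero_of_interval_integrals[OF f])
  fix p q :: real assume pq: "0 < p" "p < q"
  have [measurable]: "f \<in> borel_measurable halfline" by (rule locally_integrable_measurable[OF f])
  have bump_meas [measurable]: "bump p q n \<in> borel_measurable halfline" for n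
    by (rule smooth_on_measurable[OF smooth_on_subset[OF smooth_on_bump]]) simp
  have int: "integrable halfline (\<lambda>y. indicator {p..q} y *\<^sub>R f y)"
  proof -
    have "(\<lambda>y. indicator {0<..} y *\<^sub>R (indicator {p..q} y *\<^sub>R f y)) = (\<lambda>y. indicator {p..q} y *\<^sub>R f y)"
      using pq by (auto simp: indicator_def)
    then show ?thesis using locally_integrableD[OF f pq(1), of q]
      by (subst integrable_restrict_space) (auto simp: set_integrable_def)
  qed
  have "(\<lambda>n. LINT y|halfline. f y * bump p q n y) \<longlonglongrightarrow> (LINT y|halfline. f y * indicator {p<..<q} y)"
  proof (rule integral_dominated_convergence)
    show "integrable halfline (\<lambda>y. norm (indicator {p..q} y *\<^sub>R f y))"
      using int by (rule integrable_norm)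
    show "AE y in halfline. (\<lambda>n. f y * bump p q n y) \<longlonglongrightarrow> f y * indicator {p<..<q} y"
      by (intro AE_I2 tendsto_mult tendsto_const bump_tendsto)
    show "AE y in halfline. norm (f y * bump p q n y) \<le> norm (indicator {p..q} y *\<^sub>R f y)" for n
    proof (rule AE_I2)
      fix y
      show "norm (f y * bump p q n y) \<le> norm (indicator {p..q} y *\<^sub>R f y)"
        using norm_bump_le[of p q n y] bump_outside[of y p q n]
        by (cases "y \<in> {p..q}") (auto simp: norm_mult mult_left_le)
    qed
    show "(\<lambda>y. f y * indicator {p<..<q} y) \<in> borel_measurable halfline" by measurable
    show "(\<lambda>y. f y * bump p q n y) \<in> borel_measurable halfline" for n by measurable
  qed
  moreover have "(LINT y|halfline. f y * bump p q n y) = 0" for n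
    by (intro zero bump_test_function pq)
  ultimately have "(LINT y|halfline. f y * indicator {p<..<q} y) = 0"
    using LIMSEQ_unique[OF _ tendsto_const] by simp
  also have "(LINT y|halfline. f y * indicator {p<..<q} y) = (LINT y|lebesgue. indicator {0<..} y *\<^sub>R (f y * indicator {p<..<q} y))"
    by (rule integral_restrict_space) simp
  also have "\<dots> = (LINT y|lebesgue. indicator {p..q} y *\<^sub>R f y)"
  proof (rule integral_cong_AE)
    have "(\<lambda>y. f y * indicator {p<..<q} y) \<in> borel_measurable halfline" by measurable
    then show "(\<lambda>y. indicator {0<..} y *\<^sub>R (f y * indicator {p<..<q} y)) \<in> borel_measurable lebesgue"
      by (subst (asm) borel_measurable_restrict_space_iff) auto
    show "(\<lambda>y. indicator {p..q} y *\<^sub>R f y) \<in> borel_measurable lebesgue"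
      using locally_integrableD[OF f pq(1), of q] by (auto simp: set_integrable_def)
    have "AE y in lebesgue. y \<noteq> p" "AE y in lebesgue. y \<noteq> q"
      by (simp_all add: AE_completion AE_lborel_singleton)
    then show "AE y in lebesgue. indicator {0<..} y *\<^sub>R (f y * indicator {p<..<q} y) = indicator {p..q} y *\<^sub>R f y"
      by eventually_elim (use pq in \<open>auto simp: indicator_def\<close>)
  qed
  finally show "(LINT y:{p..q}|lebesgue. f y) = 0" by (simp add: set_lebesgue_integral_def)
qed

lemma integral_compactly_supported_deriv:
  fixes \<psi> :: "real \<Rightarrow> complex"
  assumes cont: "continuous_on {0<..} \<psi>" and ab: "0 < a" "a < b" "\<And>y. 0 < y \<Longrightarrow> y \<notin> {a..b} \<Longrightarrow> \<psi> y = 0"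
    and d: "\<And>y. 0 < y \<Longrightarrow> (\<Phi> has_vector_derivative \<psi> y) (at y)"
  shows "(LINT y|halfline. \<psi> y) = \<Phi> b - \<Phi> a"
proof -
  have loc: "locally_integrable \<psi>"
    by (rule continuous_on_locally_integrable[OF cont])
  have "(LINT y|halfline. \<psi> y) = (LINT y|lebesgue. indicator {0<..} y *\<^sub>R \<psi> y)"
    by (rule integral_restrict_space) simp
  also have "\<dots> = (LINT y:{a..b}|lebesgue. \<psi> y)"
    unfolding set_lebesgue_integral_def
    by (rule Bochner_Integration.integral_cong) (use ab in \<open>auto simp: indicator_def\<close>)
  also have "\<dots> = integral {a..b} \<psi>"
    by (rule set_lebesgue_integral_eq_integral(2)[OF locally_integrableD[OF loc ab(1)]])
  also have "\<dots> = \<Phi> b - \<Phi> a"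
    by (intro integral_unique fundamental_theorem_of_calculus)
      (use ab d in \<open>auto intro: has_vector_derivative_at_within\<close>)
  finally show ?thesis .
qed

text \<open>A test function of integral zero is the derivative of a test function. Subtracting from
  \<psi> the multiple of a fixed \<rho> with the same integral produces such a function, and C is
  the value of f on the normalized \<rho>.\<close>

lemma du_Bois_Reymond:
  assumes f: "locally_integrable f"
    and zero: "\<And>\<phi>. \<phi> \<in> test_functions \<Longrightarrow> (LINT y|halfline. f y * vector_derivative \<phi> (at y)) = 0"
  shows "\<exists>C. AE y in halfline. f y = C"
proof -
  have one: "locally_integrable (\<lambda>_. 1)" by (intro continuous_on_locally_integrable continuous_intros)
  \<comment> \<open>If all integrals were zero, the fundamental lemma applied to the constant 1
    would make the half-line a null set.\<close>
  have "\<exists>\<rho>\<in>test_functions. (LINT y|halfline. \<rho> y) \<noteq> 0"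
  proof (rule ccontr)
    assume "\<not> ?thesis"
    then have "AE y in halfline. (1::complex) = 0"
      by (intro fundamental_lemma_calculus_of_variations one) auto
    then have "AE y in lebesgue. y \<notin> {0::real<..}" by (simp add: AE_halfline_iff)
    then have "{0::real<..} \<in> null_sets lebesgue"
      by (rule AE_iff_null_sets[THEN iffD2, rotated]) simp
    then have "negligible {0::real<..}" by (simp only: negligible_iff_null_sets)
    then have "negligible (cbox 1 2 :: real set)" by (rule negligible_subset) auto
    then have "box 1 2 = ({} :: real set)" by (simp only: negligible_interval)
    moreover have "3 / 2 \<in> (box 1 2 :: real set)" by simp
    ultimately show False by blast
  qed
  then obtain \<rho> where \<rho>: "\<rho> \<in> test_functions" "(LINT y|halfline. \<rho> y) \<noteq> 0" by blast
  define C where "C = (LINT y|halfline. f y * \<rho> y) / (LINT y|halfline. \<rho> y)"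
  have intt: "integrable halfline \<psi>" if "\<psi> \<in> test_functions" for \<psi>
    using integrable_mult_test_function[OF one that] by simp
  have "AE y in halfline. f y - C = 0"
  proof (rule fundamental_lemma_calculus_of_variations)
    show "locally_integrable (\<lambda>y. f y - C)"
      by (intro locally_integrable_diff f continuous_on_locally_integrable continuous_intros)
    fix \<psi> assume \<psi>: "\<psi> \<in> test_functions"
    define k where "k = (LINT y|halfline. \<psi> y) / (LINT y|halfline. \<rho> y)"
    define \<eta> where "\<eta> y = \<psi> y + (- k) * \<rho> y" for y
    have \<eta>: "\<eta> \<in> test_functions"
      unfolding \<eta>_def[abs_def] by (intro test_function_add test_function_cmult \<psi> \<rho>)
    have \<eta>0: "(LINT y|halfline. \<eta> y) = 0"
      unfolding \<eta>_def using intt[OF \<psi>] intt[OF \<rho>(1)] \<rho>(2) by (simp add: k_def)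
    obtain \<Phi> a b where \<Phi>: "0 < a" "a < b" "smooth_on UNIV \<Phi>" "\<And>y. y < a \<Longrightarrow> \<Phi> y = 0"
      "\<And>y. 0 < y \<Longrightarrow> (\<Phi> has_vector_derivative \<eta> y) (at y)" "\<And>y. b \<le> y \<Longrightarrow> \<Phi> y = \<Phi> b"
      "\<And>y. 0 < y \<Longrightarrow> y \<notin> {a..b} \<Longrightarrow> \<eta> y = 0"
      by (rule test_function_antiderivative[OF \<eta>]) blast
    have sm: "smooth_on {0<..} \<Phi>" by (rule smooth_on_subset[OF \<Phi>(3)]) simp
    have "(LINT y|halfline. \<eta> y) = \<Phi> b - \<Phi> (a/2)"
    proof (rule integral_compactly_supported_deriv[OF _ _ _ _ \<Phi>(5)])
      show "continuous_on {0<..} \<eta>"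
        using \<eta> by (intro smooth_on_imp_continuous_on) (simp add: test_functions_def)
    qed (use \<Phi>(1,2,7) in auto)
    then have \<Phi>b: "\<Phi> b = 0" using \<eta>0 \<Phi>(1) \<Phi>(4)[of "a/2"] by simp
    have "\<Phi> \<in> test_functions"
    proof (rule test_functionI[OF sm \<Phi>(1)])
      fix y assume "y \<notin> {a..b}"
      then consider "y < a" | "b \<le> y" by fastforce
      then show "\<Phi> y = 0"
        using \<Phi>(4)[of y] \<Phi>(6)[of y] \<Phi>b by cases simp_all
    qed
    from zero[OF this] have "(LINT y|halfline. f y * vector_derivative \<Phi> (at y)) = 0" .
    also have "(LINT y|halfline. f y * vector_derivative \<Phi> (at y)) = (LINT y|halfline. f y * \<eta> y)"
      by (rule Bochner_Integration.integral_cong) (use vector_derivative_at[OF \<Phi>(5)] in auto)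
    also have "(\<lambda>y. f y * \<eta> y) = (\<lambda>y. f y * \<psi> y + (- k) * (f y * \<rho> y))"
      by (simp add: \<eta>_def algebra_simps)
    also have "(LINT y|halfline. f y * \<psi> y + (- k) * (f y * \<rho> y)) = (LINT y|halfline. f y * \<psi> y) - k * (LINT y|halfline. f y * \<rho> y)"
      using integrable_mult_test_function[OF f \<psi>] integrable_mult_test_function[OF f \<rho>(1)] by simp
    also have "k * (LINT y|halfline. f y * \<rho> y) = C * (LINT y|halfline. \<psi> y)"
      by (simp add: k_def C_def)
    finally have "(LINT y|halfline. f y * \<psi> y) = C * (LINT y|halfline. \<psi> y)" by simp
    then show "(LINT y|halfline. (f y - C) * \<psi> y) = 0"
      using integrable_mult_test_function[OF f \<psi>] intt[OF \<psi>] by (simp add: left_diff_distrib)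
  qed
  then show ?thesis by (intro exI[of _ C]) (auto elim: eventually_mono)
qed

section \<open>Weak derivatives on the half-line\<close>

lemma has_weak_deriv_iff:
  "has_weak_deriv u w \<longleftrightarrow> locally_integrable u \<and> locally_integrable w \<and>
    (\<forall>\<phi>\<in>test_functions. (LINT y|halfline. u y * vector_derivative \<phi> (at y)) = - (LINT y|halfline. w y * \<phi> y))"
  unfolding has_weak_deriv_def locally_integrable_def integral_halfline by blast

lemma has_weak_deriv_unique:
  assumes "has_weak_deriv u w" "has_weak_deriv u w'"
  shows "AE y in halfline. w y = w' y"
proof -
  have "AE y in halfline. w y - w' y = 0"
  proof (rule fundamental_lemma_calculus_of_variations)
    show "locally_integrable (\<lambda>y. w y - w' y)"
      using assms by (intro locally_integrable_diff) (auto simp: has_weak_deriv_iff)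
    fix \<phi> assume \<phi>: "\<phi> \<in> test_functions"
    then have "integrable halfline (\<lambda>y. w y * \<phi> y)" "integrable halfline (\<lambda>y. w' y * \<phi> y)"
      "(LINT y|halfline. w y * \<phi> y) = (LINT y|halfline. w' y * \<phi> y)"
      using assms by (auto simp: has_weak_deriv_iff intro: integrable_mult_test_function)
    then show "(LINT y|halfline. (w y - w' y) * \<phi> y) = 0" by (simp add: left_diff_distrib)
  qed
  then show ?thesis by simp
qed

lemma has_weak_deriv_cong_AE:
  assumes h: "has_weak_deriv u w"
    and u: "AE y in halfline. u y = u' y" "u' \<in> borel_measurable halfline"
    and w: "AE y in halfline. w y = w' y" "w' \<in> borel_measurable halfline"
  shows "has_weak_deriv u' w'"
proof -
  have loc: "locally_integrable u" "locally_integrable w" using h by (auto simp: has_weak_deriv_iff)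
  note loc' = locally_integrable_cong_AE[OF loc(1) u] locally_integrable_cong_AE[OF loc(2) w]
  have "(LINT y|halfline. u' y * vector_derivative \<phi> (at y)) = - (LINT y|halfline. w' y * \<phi> y)"
    if \<phi>: "\<phi> \<in> test_functions" for \<phi>
  proof -
    have "(LINT y|halfline. u' y * vector_derivative \<phi> (at y)) = (LINT y|halfline. u y * vector_derivative \<phi> (at y))"
      using u(1) by (intro integral_cong_AE borel_measurable_integrable[OF integrable_mult_test_function] loc loc' test_function_deriv \<phi>) auto
    also have "\<dots> = - (LINT y|halfline. w y * \<phi> y)" using h \<phi> by (simp add: has_weak_deriv_iff)
    also have "(LINT y|halfline. w y * \<phi> y) = (LINT y|halfline. w' y * \<phi> y)"
      using w(1) by (intro integral_cong_AE borel_measurable_integrable[OF integrable_mult_test_function] loc loc' \<phi>) auto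
    finally show ?thesis .
  qed
  then show ?thesis using loc' by (simp add: has_weak_deriv_iff)
qed

lemma has_weak_deriv_lincomb:
  assumes "has_weak_deriv u w" "has_weak_deriv u' w'"
  shows "has_weak_deriv (\<lambda>y. a * u y + b * u' y) (\<lambda>y. a * w y + b * w' y)"
proof -
  have loc: "locally_integrable u" "locally_integrable w" "locally_integrable u'" "locally_integrable w'"
    using assms by (auto simp: has_weak_deriv_iff)
  have lin: "locally_integrable (\<lambda>y. a * f y + b * g y)" if "locally_integrable f" "locally_integrable g" for f g
    using that unfolding locally_integrable_def by (auto intro!: set_integral_add set_integrable_mult_right)
  have "(LINT y|halfline. (a * u y + b * u' y) * vector_derivative \<phi> (at y)) = - (LINT y|halfline. (a * w y + b * w' y) * \<phi> y)"
    if \<phi>: "\<phi> \<in> test_functions" for \<phi>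
    using assms \<phi> integrable_mult_test_function[OF loc(1) test_function_deriv[OF \<phi>]] integrable_mult_test_function[OF loc(3) test_function_deriv[OF \<phi>]]
      integrable_mult_test_function[OF loc(2) \<phi>] integrable_mult_test_function[OF loc(4) \<phi>]
    by (simp add: has_weak_deriv_iff distrib_right mult.assoc)
  then show ?thesis using lin loc by (simp add: has_weak_deriv_iff)
qed

lemma has_weak_deriv_C1:
  assumes d: "\<And>y. 0 < y \<Longrightarrow> (u has_vector_derivative w y) (at y)" and w: "continuous_on {0<..} w"
  shows "has_weak_deriv u w"
proof -
  have u: "continuous_on {0<..} u"
    using d by (intro continuous_at_imp_continuous_on) (auto intro: has_vector_derivative_continuous)
  have loc: "locally_integrable u" "locally_integrable w"
    by (intro continuous_on_locally_integrable u w)+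
  have "(LINT y|halfline. u y * vector_derivative \<phi> (at y)) = - (LINT y|halfline. w y * \<phi> y)"
    if \<phi>: "\<phi> \<in> test_functions" for \<phi>
  proof -
    obtain a b where ab: "0 < a" "a < b" "\<And>y. 0 < y \<Longrightarrow> y \<notin> {a..b} \<Longrightarrow> \<phi> y = 0" "smooth_on {0<..} \<phi>"
      by (rule test_function_bounds[OF \<phi>]) blast
    note \<phi>' = vector_derivative_outside_support[OF ab(3)]
    \<comment> \<open>The end points a / 2 and b + 1 lie outside the support, so both boundary terms
      vanish.\<close>
    have "(LINT y|halfline. u y * vector_derivative \<phi> (at y) + w y * \<phi> y)
        = u (b + 1) * \<phi> (b + 1) - u (a / 2) * \<phi> (a / 2)"
    proof (rule integral_compactly_supported_deriv)
      show "continuous_on {0<..} (\<lambda>y. u y * vector_derivative \<phi> (at y) + w y * \<phi> y)"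
        by (intro continuous_on_add continuous_on_mult u w smooth_on_imp_continuous_on ab(4) smooth_on_deriv(2))
      show "((\<lambda>y. u y * \<phi> y) has_vector_derivative u y * vector_derivative \<phi> (at y) + w y * \<phi> y) (at y)"
        if "0 < y" for y
        using has_vector_derivative_mult[OF d[OF that] smooth_on_deriv(1)[OF ab(4) that]] .
    qed (use ab \<phi>' in auto)
    also have "\<dots> = 0" using ab by simp
    finally show ?thesis
      using integrable_mult_test_function[OF loc(1) test_function_deriv[OF \<phi>]] integrable_mult_test_function[OF loc(2) \<phi>]
      by (simp add: add_eq_0_iff2)
  qed
  then show ?thesis using loc by (simp add: has_weak_deriv_iff)
qed

lemma has_weak_deriv_smooth: "smooth_on {0<..} u \<Longrightarrow> has_weak_deriv u (\<lambda>y. vector_derivative u (at y))"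
  by (rule has_weak_deriv_C1) (auto intro: smooth_on_deriv smooth_on_imp_continuous_on)

section \<open>Weighted spaces\<close>

lemma measurable_wmeas [simp]: "borel_measurable (wmeas k) = borel_measurable halfline"
  by (rule measurable_cong_sets) (simp_all add: wmeas_def)

lemma powr_measurable_halfline [measurable]: "(\<lambda>y. y powr k) \<in> borel_measurable halfline"
  by (intro borel_measurable_halfline) measurable

text \<open>The density is positive on the half-line, so all the weighted measures share their null
  sets; almost everywhere statements can be kept over \<open>halfline\<close> for all weights
  together.\<close>

lemma AE_wmeas_iff: "(AE y in wmeas k. P y) \<longleftrightarrow> (AE y in halfline. P y)"
proof -
  have "(AE y in wmeas k. P y) \<longleftrightarrow> (AE y in halfline. 0 < ennreal (y powr k) \<longrightarrow> P y)"
    unfolding wmeas_def by (rule AE_density) measurable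
  also have "\<dots> \<longleftrightarrow> (AE y in halfline. P y)"
    by (rule eventually_subst) (use AE_halfline_positive in \<open>eventually_elim, simp\<close>)
  finally show ?thesis .
qed

lemma integral_wmeas:
  fixes F :: "real \<Rightarrow> 'a::{banach, second_countable_topology}"
  assumes "F \<in> borel_measurable halfline"
  shows "(LINT y|wmeas k. F y) = (LINT y|halfline. y powr k *\<^sub>R F y)"
  unfolding wmeas_def by (rule integral_density[OF assms powr_measurable_halfline]) simp

lemma integrable_wmeas:
  fixes F :: "real \<Rightarrow> 'a::{banach, second_countable_topology}"
  assumes "F \<in> borel_measurable halfline"
  shows "integrable (wmeas k) F \<longleftrightarrow> integrable halfline (\<lambda>y. y powr k *\<^sub>R F y)"
  unfolding wmeas_def by (rule integrable_density[OF assms powr_measurable_halfline]) simp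

lemma powr_half_square: "(y powr (k / 2))\<^sup>2 = y powr k" for y k :: real
  by (simp add: power2_eq_square powr_add[symmetric])

lemma L2_wmeas_iff:
  "f \<in> L2 (wmeas k) \<longleftrightarrow> (\<lambda>y. of_real (y powr (k / 2)) * f y) \<in> L2 halfline"
proof
  assume f: "f \<in> L2 (wmeas k)"
  then have [measurable]: "f \<in> borel_measurable halfline" using L2_measurable by force
  have "integrable halfline (\<lambda>y. y powr k *\<^sub>R (cmod (f y))\<^sup>2)"
    using L2_square_integrable[OF f] by (subst (asm) integrable_wmeas) auto
  then show "(\<lambda>y. of_real (y powr (k / 2)) * f y) \<in> L2 halfline"
    by (auto simp: L2_def norm_mult power_mult_distrib powr_half_square)
next
  assume f: "(\<lambda>y. of_real (y powr (k / 2)) * f y) \<in> L2 halfline"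
  then have "(\<lambda>y. of_real (y powr (k / 2)) * f y) \<in> borel_measurable halfline" by (rule L2_measurable)
  then have "(\<lambda>y. of_real (y powr (- (k / 2))) * (of_real (y powr (k / 2)) * f y)) \<in> borel_measurable halfline"
    by measurable
  also have "?this \<longleftrightarrow> f \<in> borel_measurable halfline"
    by (rule measurable_cong) (simp add: powr_minus)
  finally have [measurable]: "f \<in> borel_measurable halfline" .
  have "integrable halfline (\<lambda>y. y powr k *\<^sub>R (cmod (f y))\<^sup>2)"
    using L2_square_integrable[OF f] by (simp add: norm_mult power_mult_distrib powr_half_square)
  then have "integrable (wmeas k) (\<lambda>y. (cmod (f y))\<^sup>2)"
    by (subst integrable_wmeas) auto
  then show "f \<in> L2 (wmeas k)" by (simp add: L2_def)
qed

lemma L2_wmeas_cong_AE: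
  assumes "f \<in> L2 (wmeas k)" "g \<in> borel_measurable halfline" "AE y in halfline. f y = g y"
  shows "g \<in> L2 (wmeas k)"
  by (rule L2_AE_cong[OF assms(1)]) (use assms in \<open>simp_all add: AE_wmeas_iff\<close>)

text \<open>The unitary map onto the unweighted space, which lets one Hilbert space serve every
  weight. Its inverse \<open>dec\<close> selects a representative.\<close>

definition enc :: "real \<Rightarrow> (real \<Rightarrow> complex) \<Rightarrow> l2h" where
  "enc k f = abs_l2h (\<lambda>y. of_real (y powr (k / 2)) * f y)"

definition dec :: "real \<Rightarrow> l2h \<Rightarrow> real \<Rightarrow> complex" where
  "dec k x y = of_real (y powr (- (k / 2))) * rep_l2h x y"

lemma enc_add: "f \<in> L2 (wmeas k) \<Longrightarrow> g \<in> L2 (wmeas k) \<Longrightarrow> enc k (\<lambda>y. f y + g y) = enc k f + enc k g"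
  by (simp add: enc_def L2_wmeas_iff abs_l2h_add[symmetric] distrib_left)

lemma enc_diff: "f \<in> L2 (wmeas k) \<Longrightarrow> g \<in> L2 (wmeas k) \<Longrightarrow> enc k (\<lambda>y. f y - g y) = enc k f - enc k g"
  by (simp add: enc_def L2_wmeas_iff abs_l2h_diff[symmetric] right_diff_distrib)

lemma enc_scaleR: "f \<in> L2 (wmeas k) \<Longrightarrow> enc k (\<lambda>y. of_real r * f y) = r *\<^sub>R enc k f"
  by (simp add: enc_def L2_wmeas_iff abs_l2h_scaleR[symmetric] mult.left_commute)

lemma enc_mult_i: "f \<in> L2 (wmeas k) \<Longrightarrow> enc k (\<lambda>y. \<i> * f y) = l2h_mult_i (enc k f)"
  by (simp add: enc_def L2_wmeas_iff l2h_mult_i_abs[symmetric] mult.left_commute)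

lemma enc_cmult:
  assumes f: "f \<in> L2 (wmeas k)"
  shows "enc k (\<lambda>y. a * f y) = Re a *\<^sub>R enc k f + Im a *\<^sub>R l2h_mult_i (enc k f)"
proof -
  have "enc k (\<lambda>y. a * f y) = enc k (\<lambda>y. of_real (Re a) * f y + of_real (Im a) * (\<i> * f y))"
    by (intro arg_cong[of _ _ "enc k"] ext) (simp add: complex_eq_iff)
  also have "\<dots> = Re a *\<^sub>R enc k f + Im a *\<^sub>R l2h_mult_i (enc k f)"
    using f by (simp add: enc_add enc_scaleR enc_mult_i L2_cmult)
  finally show ?thesis .
qed

lemma enc_eq_iff:
  assumes "f \<in> L2 (wmeas k)" "g \<in> L2 (wmeas k)"
  shows "enc k f = enc k g \<longleftrightarrow> (AE y in halfline. f y = g y)"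
proof -
  have "enc k f = enc k g \<longleftrightarrow> (AE y in halfline. of_real (y powr (k / 2)) * f y = of_real (y powr (k / 2)) * g y)"
    unfolding enc_def by (rule abs_l2h_eq_iff) (use assms in \<open>simp_all add: L2_wmeas_iff\<close>)
  also have "\<dots> \<longleftrightarrow> (AE y in halfline. f y = g y)"
    by (rule eventually_subst) (use AE_halfline_positive in \<open>eventually_elim, simp\<close>)
  finally show ?thesis .
qed

lemma integral_wmeas_cnj:
  assumes "f \<in> L2 (wmeas k)" "g \<in> L2 (wmeas k)"
  shows "(LINT y|wmeas k. f y * cnj (g y))
    = (LINT y|halfline. (of_real (y powr (k / 2)) * f y) * cnj (of_real (y powr (k / 2)) * g y))"
proof -
  have "f \<in> borel_measurable halfline" "g \<in> borel_measurable halfline"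
    using assms L2_measurable by force+
  then have "(\<lambda>y. f y * cnj (g y)) \<in> borel_measurable halfline"
    by (intro borel_measurable_times measurable_compose[OF _ borel_measurable_cnj])
  then have "(LINT y|wmeas k. f y * cnj (g y)) = (LINT y|halfline. y powr k *\<^sub>R (f y * cnj (g y)))"
    by (rule integral_wmeas)
  also have "(\<lambda>y. y powr k *\<^sub>R (f y * cnj (g y))) = (\<lambda>y. (of_real (y powr (k / 2)) * f y) * cnj (of_real (y powr (k / 2)) * g y))"
    by (auto simp: scaleR_conv_of_real powr_half_square[of _ k, symmetric] power2_eq_square)
  finally show ?thesis .
qed

lemma inner_enc:
  assumes "f \<in> L2 (wmeas k)" "g \<in> L2 (wmeas k)"
  shows "inner (enc k f) (enc k g) = Re (LINT y|wmeas k. f y * cnj (g y))"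
  unfolding integral_wmeas_cnj[OF assms] enc_def
  by (rule inner_abs_l2h) (use assms in \<open>simp_all add: L2_wmeas_iff\<close>)

text \<open>The complex product is conjugate linear in its second argument, so inserting i there
  multiplies it by -i and moves the imaginary part to the real part.\<close>

lemma integral_cnj_enc:
  assumes "f \<in> L2 (wmeas k)" "g \<in> L2 (wmeas k)"
  shows "(LINT y|wmeas k. f y * cnj (g y)) = Complex (inner (enc k f) (enc k g)) (inner (enc k f) (l2h_mult_i (enc k g)))"
proof -
  have "inner (enc k f) (l2h_mult_i (enc k g)) = Re (LINT y|wmeas k. f y * cnj (\<i> * g y))"
    using assms by (simp add: inner_enc L2_cmult flip: enc_mult_i)
  also have "(LINT y|wmeas k. f y * cnj (\<i> * g y)) = - \<i> * (LINT y|wmeas k. f y * cnj (g y))"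
    by (simp add: mult.left_commute)
  also have "Re \<dots> = Im (LINT y|wmeas k. f y * cnj (g y))" by simp
  finally show ?thesis using assms by (simp add: inner_enc complex_eq_iff)
qed

lemma norm_enc: "f \<in> L2 (wmeas k) \<Longrightarrow> norm (enc k f) = l2norm (wmeas k) f"
  by (simp add: norm_eq_sqrt_inner inner_enc Re_integral_mult_cnj_self l2norm_def)

lemma dec_L2: "dec k x \<in> L2 (wmeas k)"
  and enc_dec: "enc k (dec k x) = x"
proof -
  have rep [measurable]: "rep_l2h x \<in> borel_measurable halfline" by (rule L2_measurable[OF rep_l2h_L2])
  have ae: "AE y in halfline. rep_l2h x y = of_real (y powr (k / 2)) * dec k x y"
    using AE_halfline_positive
  proof eventually_elim
    case (elim y)
    have "of_real (y powr (k / 2)) * dec k x y = of_real (y powr (k / 2) * y powr (- (k / 2))) * rep_l2h x y"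
      by (simp add: dec_def mult.assoc)
    then show ?case using elim by (simp add: powr_add[symmetric])
  qed
  have [measurable]: "dec k x \<in> borel_measurable halfline" unfolding dec_def[abs_def] by measurable
  have "(\<lambda>y. of_real (y powr (k / 2)) * dec k x y) \<in> L2 halfline"
    by (rule L2_AE_cong[OF rep_l2h_L2 _ ae]) measurable
  then show "dec k x \<in> L2 (wmeas k)" by (simp add: L2_wmeas_iff)
  have "enc k (dec k x) = abs_l2h (rep_l2h x)"
    unfolding enc_def using ae by (subst abs_l2h_eq_iff) (auto simp: rep_l2h_L2 \<open>(\<lambda>y. of_real (y powr (k / 2)) * dec k x y) \<in> L2 halfline\<close>)
  then show "enc k (dec k x) = x" by (simp add: abs_l2h_rep)
qed

lemma dec_enc: "f \<in> L2 (wmeas k) \<Longrightarrow> AE y in halfline. dec k (enc k f) y = f y"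
  using enc_eq_iff[OF dec_L2, of f k "enc k f"] by (simp add: enc_dec)

lemma powr_ge_min:
  fixes a b y k :: real
  assumes "0 < a" "a \<le> y" "y \<le> b"
  shows "min (a powr k) (b powr k) \<le> y powr k"
proof (cases "0 \<le> k")
  case True
  then have "a powr k \<le> y powr k" using assms by (intro powr_mono2) auto
  then show ?thesis by simp
next
  case False
  then have "b powr k \<le> y powr k" using assms by (intro powr_mono2') auto
  then show ?thesis by simp
qed

text \<open>Away from 0 the weight is bounded below by a positive m, so weighted integrability of a
  majorant implies unweighted integrability.\<close>

lemma set_integrable_of_weighted:
  fixes W :: "real \<Rightarrow> real" and g :: "real \<Rightarrow> complex"
  assumes ab: "0 < a" and g: "g \<in> borel_measurable halfline" and W: "integrable halfline (\<lambda>y. y powr k * (indicator {a..b} y * W y))"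
    and le: "AE y in halfline. cmod (g y) \<le> W y"
  shows "set_integrable lebesgue {a..b} g"
proof (cases "a \<le> b")
  case False
  then show ?thesis by (simp add: set_integrable_def)
next
  case True
  define m where "m = min (a powr k) (b powr k)"
  have m: "0 < m" using ab True by (auto simp: m_def)
  have "integrable halfline (\<lambda>y. indicator {a..b} y *\<^sub>R g y)"
  proof (rule Bochner_Integration.integrable_bound)
    show "integrable halfline (\<lambda>y. (1 / m) * (y powr k * (indicator {a..b} y * W y)))"
      using W by (rule integrable_mult_right)
    show "(\<lambda>y. indicator {a..b} y *\<^sub>R g y) \<in> borel_measurable halfline"
      using g by measurable
    show "AE y in halfline. norm (indicator {a..b} y *\<^sub>R g y) \<le> norm ((1 / m) * (y powr k * (indicator {a..b} y * W y)))"
      using le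
    proof eventually_elim
      case (elim y)
      show ?case
      proof (cases "y \<in> {a..b}")
        case True
        have W0: "0 \<le> W y" using elim norm_ge_zero order_trans by blast
        have "m \<le> y powr k" using True ab powr_ge_min[of a y b k] by (simp add: m_def)
        then have "1 * W y \<le> ((1 / m) * y powr k) * W y"
          using m W0 by (intro mult_right_mono) auto
        then show ?thesis using True elim W0 m by (simp add: abs_mult)
      qed auto
    qed
  qed
  then have "integrable lebesgue (\<lambda>y. indicator {0<..} y *\<^sub>R (indicator {a..b} y *\<^sub>R g y))"
    by (subst (asm) integrable_restrict_space) auto
  also have "(\<lambda>y. indicator {0<..} y *\<^sub>R (indicator {a..b} y *\<^sub>R g y)) = (\<lambda>y. indicator {a..b} y *\<^sub>R g y)"
    using ab by (auto simp: indicator_def)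
  finally show ?thesis by (simp add: set_integrable_def)
qed

lemma L2_mult_locally_integrable:
  assumes f: "f \<in> L2 (wmeas k)" and g: "g \<in> borel_measurable halfline"
    and gi: "\<And>a b. 0 < a \<Longrightarrow> integrable halfline (\<lambda>y. y powr k * (indicator {a..b} y * (cmod (g y))\<^sup>2))"
  shows "locally_integrable (\<lambda>y. f y * g y)"
  unfolding locally_integrable_def
proof (intro allI impI)
  fix a b :: real assume a: "0 < a"
  have fm [measurable]: "f \<in> borel_measurable halfline" using L2_measurable[OF f] by simp
  note [measurable] = g
  have fi: "integrable halfline (\<lambda>y. y powr k *\<^sub>R (cmod (f y))\<^sup>2)"
    using L2_square_integrable[OF f] by (subst (asm) integrable_wmeas) auto
  show "set_integrable lebesgue {a..b} (\<lambda>y. f y * g y)"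
  proof (rule set_integrable_of_weighted[OF a])
    show "(\<lambda>y. f y * g y) \<in> borel_measurable halfline" by measurable
    have "integrable halfline (\<lambda>y. y powr k * (indicator {a..b} y * (cmod (f y))\<^sup>2))"
    proof (rule Bochner_Integration.integrable_bound[OF fi])
      show "(\<lambda>y. y powr k * (indicator {a..b} y * (cmod (f y))\<^sup>2)) \<in> borel_measurable halfline"
        by measurable
    qed (auto simp: indicator_def)
    from Bochner_Integration.integrable_add[OF this gi[OF a]]
    show "integrable halfline (\<lambda>y. y powr k * (indicator {a..b} y * ((cmod (f y))\<^sup>2 + (cmod (g y))\<^sup>2)))"
      by (simp add: distrib_left)
    show "AE y in halfline. cmod (f y * g y) \<le> (cmod (f y))\<^sup>2 + (cmod (g y))\<^sup>2"
    proof (rule AE_I2)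
      fix y
      show "cmod (f y * g y) \<le> (cmod (f y))\<^sup>2 + (cmod (g y))\<^sup>2"
        using sum_squares_bound[of "cmod (f y)" "cmod (g y)"] mult_nonneg_nonneg[OF norm_ge_zero norm_ge_zero, of "f y" "g y"]
        unfolding mult.assoc norm_mult by linarith
    qed
  qed
qed

lemma integrable_powr_compact:
  assumes "0 < a"
  shows "integrable halfline (\<lambda>y. y powr k * (indicator {a..b} y * 1))"
proof -
  have "continuous_on {a..b} (\<lambda>y. y powr k)" using assms by (intro continuous_intros) auto
  then have "integrable lborel (\<lambda>y. indicator {a..b} y *\<^sub>R (y powr k))" by (rule borel_integrable_compact[OF compact_Icc])
  then have "integrable lebesgue (\<lambda>y. indicator {a..b} y *\<^sub>R (y powr k))"
    by (simp add: integrable_completion borel_measurable_integrable)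
  also have "(\<lambda>y. indicator {a..b} y *\<^sub>R (y powr k)) = (\<lambda>y. indicator {0<..} y *\<^sub>R (y powr k * (indicator {a..b} y * 1)))"
    using assms by (auto simp: indicator_def)
  finally show ?thesis by (subst integrable_restrict_space) auto
qed

lemma L2_wmeas_locally_integrable: "f \<in> L2 (wmeas k) \<Longrightarrow> locally_integrable f"
  using L2_mult_locally_integrable[of f k "\<lambda>_. 1"] integrable_powr_compact by simp

lemma bounded_support_mult_L2:
  assumes g [measurable]: "g \<in> borel_measurable halfline" and \<phi> [measurable]: "\<phi> \<in> borel_measurable halfline"
    and W: "integrable halfline (\<lambda>y. y powr k * (indicator {a..b} y * W y))" "W \<in> borel_measurable halfline"
    and gW: "AE y in halfline. (cmod (g y))\<^sup>2 \<le> W y"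
    and C: "\<And>y. 0 < y \<Longrightarrow> cmod (\<phi> y) \<le> C" and supp: "\<And>y. 0 < y \<Longrightarrow> y \<notin> {a..b} \<Longrightarrow> \<phi> y = 0"
  shows "(\<lambda>y. g y * \<phi> y) \<in> L2 (wmeas k)"
proof (rule L2I)
  note [measurable] = W(2)
  have eq: "(\<lambda>y. y powr k *\<^sub>R (C\<^sup>2 * (indicator {a..b} y * W y))) = (\<lambda>y. C\<^sup>2 * (y powr k * (indicator {a..b} y * W y)))"
    by (simp add: mult.left_commute)
  have "(\<lambda>y. C\<^sup>2 * (indicator {a..b} y * W y)) \<in> borel_measurable halfline" by measurable
  then show "integrable (wmeas k) (\<lambda>y. C\<^sup>2 * (indicator {a..b} y * W y))"
    by (subst integrable_wmeas, assumption, unfold eq) (intro integrable_mult_right W)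
  show "AE y in wmeas k. (cmod (g y * \<phi> y))\<^sup>2 \<le> C\<^sup>2 * (indicator {a..b} y * W y)"
    unfolding AE_wmeas_iff using AE_halfline_positive gW
  proof eventually_elim
    case (elim y)
    have "(cmod (\<phi> y))\<^sup>2 \<le> C\<^sup>2" using C[OF elim(1)] by (intro power_mono) auto
    then have "(cmod (\<phi> y))\<^sup>2 * (cmod (g y))\<^sup>2 \<le> C\<^sup>2 * W y" using elim(2) by (intro mult_mono) auto
    then show ?case
      using supp[OF elim(1)] by (cases "y \<in> {a..b}") (auto simp: norm_mult power_mult_distrib mult.commute)
  qed
  show "(\<lambda>y. g y * \<phi> y) \<in> borel_measurable (wmeas k)" unfolding measurable_wmeas by measurable
qed

lemma test_function_L2:
  assumes \<phi>: "\<phi> \<in> test_functions"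
  shows "\<phi> \<in> L2 (wmeas k)"
proof -
  obtain a b where ab: "0 < a" "a < b" "\<And>y. 0 < y \<Longrightarrow> y \<notin> {a..b} \<Longrightarrow> \<phi> y = 0" "smooth_on {0<..} \<phi>"
    by (rule test_function_bounds[OF \<phi>]) blast
  obtain C where C: "\<And>y. 0 < y \<Longrightarrow> cmod (\<phi> y) \<le> C"
    by (rule test_function_bounded[OF \<phi>]) blast
  have "(\<lambda>y. 1 * \<phi> y) \<in> L2 (wmeas k)"
    by (rule bounded_support_mult_L2[OF _ smooth_on_measurable[OF ab(4)] integrable_powr_compact[OF ab(1)] _ _ C ab(3)]) simp_all
  then show ?thesis by simp
qed

text \<open>The weight is moved into the test function, which stays a test function. Testing is
  thereby a pair of continuous functionals of \<open>enc k f\<close>, and identities between tested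
  functions survive limits in the weighted space.\<close>

lemma integral_test_function_enc:
  assumes f: "f \<in> L2 (wmeas k)" and \<phi>: "\<phi> \<in> test_functions"
  defines "g \<equiv> \<lambda>y. of_real (y powr (- k)) * cnj (\<phi> y)"
  shows "(LINT y|halfline. f y * \<phi> y) = Complex (inner (enc k f) (enc k g)) (inner (enc k f) (l2h_mult_i (enc k g)))"
proof -
  have g: "g \<in> test_functions"
    unfolding g_def by (intro test_function_mult test_function_cnj \<phi> smooth_on_powr)
  have gL: "g \<in> L2 (wmeas k)" by (rule test_function_L2[OF g])
  have m: "(\<lambda>y. f y * cnj (g y)) \<in> borel_measurable halfline"
    using L2_measurable[OF f] L2_measurable[OF L2_cnj[OF gL]] by (intro borel_measurable_times) auto
  have "(LINT y|wmeas k. f y * cnj (g y)) = (LINT y|halfline. y powr k *\<^sub>R (f y * cnj (g y)))"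
    by (rule integral_wmeas[OF m])
  also have "\<dots> = (LINT y|halfline. f y * \<phi> y)"
    by (rule Bochner_Integration.integral_cong)
      (auto simp: g_def scaleR_conv_of_real powr_minus field_simps)
  finally show ?thesis using integral_cnj_enc[OF f gL] by simp
qed

section \<open>The form and its resolvent\<close>

lemma has_weak_deriv_wderiv: "has_weak_deriv u w \<Longrightarrow> has_weak_deriv u (wderiv u)"
  unfolding wderiv_def by (rule someI[of "has_weak_deriv u"])

lemma wderiv_AE_eq: "has_weak_deriv u w \<Longrightarrow> AE y in halfline. wderiv u y = w y"
  by (rule has_weak_deriv_unique[OF has_weak_deriv_wderiv])

text \<open>Closedness of weak differentiation between two weighted spaces: for a fixed test
  function both sides of the defining identity are continuous, each in its own weight.\<close>

lemma has_weak_deriv_enc: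
  assumes u: "u \<in> L2 (wmeas k)" and w: "w \<in> L2 (wmeas l)"
    and lim: "(\<lambda>n. enc k (f n)) \<longlonglongrightarrow> enc k u" "(\<lambda>n. enc l (g n)) \<longlonglongrightarrow> enc l w"
    and f: "\<And>n. f n \<in> L2 (wmeas k)" and g: "\<And>n. g n \<in> L2 (wmeas l)"
    and d: "\<And>n. has_weak_deriv (f n) (g n)"
  shows "has_weak_deriv u w"
proof -
  have "(LINT y|halfline. u y * vector_derivative \<phi> (at y)) = - (LINT y|halfline. w y * \<phi> y)"
    if \<phi>: "\<phi> \<in> test_functions" for \<phi>
  proof -
    note \<phi>' = test_function_deriv[OF \<phi>]
    have "(\<lambda>n. LINT y|halfline. f n y * vector_derivative \<phi> (at y)) \<longlonglongrightarrow> (LINT y|halfline. u y * vector_derivative \<phi> (at y))"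
      unfolding integral_test_function_enc[OF f \<phi>'] integral_test_function_enc[OF u \<phi>']
      by (intro tendsto_Complex tendsto_inner lim tendsto_const)
    moreover have "(\<lambda>n. LINT y|halfline. g n y * \<phi> y) \<longlonglongrightarrow> (LINT y|halfline. w y * \<phi> y)"
      unfolding integral_test_function_enc[OF g \<phi>] integral_test_function_enc[OF w \<phi>]
      by (intro tendsto_Complex tendsto_inner lim tendsto_const)
    then have "(\<lambda>n. - (LINT y|halfline. g n y * \<phi> y)) \<longlonglongrightarrow> - (LINT y|halfline. w y * \<phi> y)"
      by (rule tendsto_minus)
    moreover have "(LINT y|halfline. f n y * vector_derivative \<phi> (at y)) = - (LINT y|halfline. g n y * \<phi> y)" for n
      using d[of n] \<phi> by (simp add: has_weak_deriv_iff)
    ultimately show ?thesis using LIMSEQ_unique by simp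
  qed
  then show ?thesis
    using u w by (simp add: has_weak_deriv_iff L2_wmeas_locally_integrable)
qed

text \<open>The assumption \<open>weight\<close> says that y^(c - \<alpha>) is integrable at 0, so
  bounded functions of bounded support belong to the space; \<open>V_loc\<close> likewise reaches
  down to 0.\<close>

locale weighted_form =
  fixes \<alpha> c :: real and V :: "real \<Rightarrow> real"
  assumes weight: "0 < c + 1 - \<alpha>"
    and V_nonneg_wmeas: "AE y in wmeas (c - \<alpha>). 0 \<le> V y"
    and V_loc: "V \<in> Lq_loc 1 (c - \<alpha>)"
begin

abbreviation "\<mu> \<equiv> wmeas (c - \<alpha>)"
abbreviation "fdom \<equiv> form_dom \<alpha> c V"
abbreviation "rtV \<equiv> \<lambda>y. complex_of_real (sqrt (V y))"

lemma V_nonneg: "AE y in halfline. 0 \<le> V y"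
  using V_nonneg_wmeas by (simp add: AE_wmeas_iff)

lemma V_measurable [measurable]: "V \<in> borel_measurable halfline"
  using V_loc by (simp add: Lq_loc_def)

lemma V_integrable: "integrable halfline (\<lambda>y. y powr (c - \<alpha>) * (indicator {a..b} y * \<bar>V y\<bar>))" if "0 \<le> a"
proof -
  have "integrable \<mu> (\<lambda>y. indicator {0..max b 1} y * \<bar>V y\<bar>)"
    using V_loc unfolding Lq_loc_def set_integrable_def by (auto dest: spec[of _ "max b 1"])
  then have "integrable halfline (\<lambda>y. y powr (c - \<alpha>) * (indicator {0..max b 1} y * \<bar>V y\<bar>))"
    by (subst (asm) integrable_wmeas) auto
  then show ?thesis
    by (rule Bochner_Integration.integrable_bound) (measurable, use that in \<open>auto simp: indicator_def\<close>)
qed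

lemma rtV_mult_L2:
  assumes \<phi>: "\<phi> \<in> borel_measurable halfline"
    and C: "\<And>y. 0 < y \<Longrightarrow> cmod (\<phi> y) \<le> C" and b: "\<And>y. b < y \<Longrightarrow> \<phi> y = 0"
  shows "(\<lambda>y. rtV y * \<phi> y) \<in> L2 \<mu>"
proof (rule bounded_support_mult_L2[OF _ \<phi> V_integrable[OF order_refl] _ _ C])
  show "AE y in halfline. (cmod (rtV y))\<^sup>2 \<le> \<bar>V y\<bar>" using V_nonneg by eventually_elim simp
  show "\<phi> y = 0" if "0 < y" "y \<notin> {0..b}" for y using that by (intro b) simp
qed measurable

lemma rtV_test_function_L2:
  assumes \<phi>: "\<phi> \<in> test_functions"
  shows "(\<lambda>y. rtV y * \<phi> y) \<in> L2 \<mu>"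
proof -
  obtain a b where ab: "0 < a" "a < b" "\<And>y. 0 < y \<Longrightarrow> y \<notin> {a..b} \<Longrightarrow> \<phi> y = 0" "smooth_on {0<..} \<phi>"
    by (rule test_function_bounds[OF \<phi>]) blast
  obtain C where C: "\<And>y. 0 < y \<Longrightarrow> cmod (\<phi> y) \<le> C"
    by (rule test_function_bounded[OF \<phi>]) blast
  show ?thesis
    by (rule rtV_mult_L2[OF smooth_on_measurable[OF ab(4)] C, of b]) (use ab in auto)
qed

lemma rtV_mult_locally_integrable:
  assumes "u \<in> L2 \<mu>"
  shows "locally_integrable (\<lambda>y. u y * rtV y)"
proof (rule L2_mult_locally_integrable[OF assms])
  show "rtV \<in> borel_measurable halfline" by measurable
  fix a b :: real assume "0 < a"
  then have "integrable halfline (\<lambda>y. y powr (c - \<alpha>) * (indicator {a..b} y * \<bar>V y\<bar>))"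
    by (intro V_integrable) simp
  then show "integrable halfline (\<lambda>y. y powr (c - \<alpha>) * (indicator {a..b} y * (cmod (rtV y))\<^sup>2))"
    by (simp add: real_sqrt_abs power2_eq_square abs_mult_self_eq flip: real_sqrt_mult)
qed

text \<open>The factor V^(1/2) is moved onto the test function, where local integrability of V
  suffices. The integral is then continuous in u alone, without any control of V^(1/2) u.\<close>

lemma integral_rtV_test_function_enc:
  assumes u: "u \<in> L2 \<mu>" and \<phi>: "\<phi> \<in> test_functions"
  defines "g \<equiv> \<lambda>y. rtV y * (of_real (y powr (- (c - \<alpha>))) * cnj (\<phi> y))"
  shows "(LINT y|halfline. (rtV y * u y) * \<phi> y)
    = Complex (inner (enc (c - \<alpha>) u) (enc (c - \<alpha>) g)) (inner (enc (c - \<alpha>) u) (l2h_mult_i (enc (c - \<alpha>) g)))"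
proof -
  have gL: "g \<in> L2 \<mu>"
    unfolding g_def by (intro rtV_test_function_L2 test_function_mult test_function_cnj \<phi> smooth_on_powr)
  have m: "(\<lambda>y. u y * cnj (g y)) \<in> borel_measurable halfline"
    using L2_measurable[OF u] L2_measurable[OF L2_cnj[OF gL]] by (intro borel_measurable_times) auto
  have "(LINT y|\<mu>. u y * cnj (g y)) = (LINT y|halfline. y powr (c - \<alpha>) *\<^sub>R (u y * cnj (g y)))"
    by (rule integral_wmeas[OF m])
  also have "\<dots> = (LINT y|halfline. (rtV y * u y) * \<phi> y)"
  proof (rule Bochner_Integration.integral_cong)
    fix y assume "y \<in> space halfline"
    then have "0 < y" by simp
    then have "y powr (c - \<alpha>) * y powr (- (c - \<alpha>)) = 1" by (simp add: powr_add[symmetric])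
    then have "complex_of_real (y powr (c - \<alpha>)) * complex_of_real (y powr (- (c - \<alpha>))) = 1"
      by (simp only: of_real_mult[symmetric] of_real_1)
    then show "y powr (c - \<alpha>) *\<^sub>R (u y * cnj (g y)) = rtV y * u y * \<phi> y"
      unfolding g_def scaleR_conv_of_real complex_cnj_mult complex_cnj_complex_of_real complex_cnj_cnj
      by (metis (no_types, lifting) mult.assoc mult.commute mult.left_neutral)
  qed simp
  finally show ?thesis using integral_cnj_enc[OF u gL] by simp
qed

lemma domD:
  assumes "u \<in> fdom"
  shows "u \<in> L2 \<mu>" "has_weak_deriv u (wderiv u)" "wderiv u \<in> L2 (wmeas c)" "(\<lambda>y. rtV y * u y) \<in> L2 \<mu>"
proof -
  obtain w where w: "has_weak_deriv u w" "w \<in> L2 (wmeas c)"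
    using assms unfolding form_dom_def by blast
  show d: "has_weak_deriv u (wderiv u)" by (rule has_weak_deriv_wderiv[OF w(1)])
  have "wderiv u \<in> borel_measurable halfline"
    using d by (auto simp: has_weak_deriv_iff intro: locally_integrable_measurable)
  \<comment> \<open>\<open>wderiv\<close> is an arbitrary choice among weak derivatives; uniqueness
    up to null sets transfers square integrability to it.\<close>
  moreover have "AE y in halfline. w y = wderiv u y"
    using wderiv_AE_eq[OF w(1)] by eventually_elim simp
  ultimately show "wderiv u \<in> L2 (wmeas c)" by (rule L2_wmeas_cong_AE[OF w(2)])
qed (use assms in \<open>auto simp: form_dom_def\<close>)

lemma domI:
  assumes "u \<in> L2 \<mu>" "has_weak_deriv u w" "w \<in> L2 (wmeas c)" "(\<lambda>y. rtV y * u y) \<in> L2 \<mu>"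
  shows "u \<in> fdom"
  using assms unfolding form_dom_def by blast

lemma dom_lincomb:
  assumes u: "u \<in> fdom" and v: "v \<in> fdom"
  shows "(\<lambda>y. a * u y + b * v y) \<in> fdom"
proof (rule domI)
  have "(\<lambda>y. a * (rtV y * u y) + b * (rtV y * v y)) \<in> L2 \<mu>"
    by (intro L2_add L2_cmult domD u v)
  then show "(\<lambda>y. rtV y * (a * u y + b * v y)) \<in> L2 \<mu>" by (simp add: algebra_simps)
  show "has_weak_deriv (\<lambda>y. a * u y + b * v y) (\<lambda>y. a * wderiv u y + b * wderiv v y)"
    by (intro has_weak_deriv_lincomb domD u v)
qed (intro L2_add L2_cmult domD u v)+

lemma dom_cong_AE:
  assumes u: "u \<in> fdom" and v: "v \<in> borel_measurable halfline" "AE y in halfline. u y = v y"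
  shows "v \<in> fdom"
proof (rule domI)
  show "v \<in> L2 \<mu>" by (rule L2_wmeas_cong_AE[OF domD(1)[OF u] v])
  have "wderiv u \<in> borel_measurable halfline" using L2_measurable[OF domD(3)[OF u]] by simp
  then show "has_weak_deriv v (wderiv u)"
    by (intro has_weak_deriv_cong_AE[OF domD(2)[OF u] v(2,1)]) auto
  show "wderiv u \<in> L2 (wmeas c)" by (rule domD(3)[OF u])
  show "(\<lambda>y. rtV y * v y) \<in> L2 \<mu>"
  proof (rule L2_wmeas_cong_AE[OF domD(4)[OF u]])
    show "(\<lambda>y. rtV y * v y) \<in> borel_measurable halfline" using v(1) by measurable
    show "AE y in halfline. rtV y * u y = rtV y * v y" using v(2) by eventually_elim simp
  qed
qed

lemma test_function_dom:
  assumes \<phi>: "\<phi> \<in> test_functions"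
  shows "\<phi> \<in> fdom"
proof (rule domI)
  have "smooth_on {0<..} \<phi>" using \<phi> by (simp add: test_functions_def)
  then show "has_weak_deriv \<phi> (\<lambda>y. vector_derivative \<phi> (at y))" by (rule has_weak_deriv_smooth)
qed (intro test_function_L2 rtV_test_function_L2 test_function_deriv \<phi>)+

section \<open>The form domain as a closed subspace of triples\<close>

definition triple :: "(real \<Rightarrow> complex) \<Rightarrow> l2h \<times> l2h \<times> l2h" where
  "triple u = (enc (c - \<alpha>) u, enc c (wderiv u), enc (c - \<alpha>) (\<lambda>y. rtV y * u y))"

definition triple_mult_i :: "l2h \<times> l2h \<times> l2h \<Rightarrow> l2h \<times> l2h \<times> l2h" where
  "triple_mult_i x = (l2h_mult_i (fst x), l2h_mult_i (fst (snd x)), l2h_mult_i (snd (snd x)))"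

lemma triple_eqI:
  assumes "u \<in> fdom" "has_weak_deriv u w" "w \<in> L2 (wmeas c)"
  shows "triple u = (enc (c - \<alpha>) u, enc c w, enc (c - \<alpha>) (\<lambda>y. rtV y * u y))"
  unfolding triple_def using wderiv_AE_eq[OF assms(2)] domD(3)[OF assms(1)] assms(3) by (simp add: enc_eq_iff)

lemma triple_lincomb:
  assumes u: "u \<in> fdom" and v: "v \<in> fdom"
  shows "triple (\<lambda>y. a * u y + b * v y)
    = (Re a *\<^sub>R triple u + Im a *\<^sub>R triple_mult_i (triple u)) + (Re b *\<^sub>R triple v + Im b *\<^sub>R triple_mult_i (triple v))"
proof -
  have "(\<lambda>y. rtV y * (a * u y + b * v y)) = (\<lambda>y. a * (rtV y * u y) + b * (rtV y * v y))"
    by (simp add: algebra_simps)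
  moreover have "triple (\<lambda>y. a * u y + b * v y) = (enc (c - \<alpha>) (\<lambda>y. a * u y + b * v y),
      enc c (\<lambda>y. a * wderiv u y + b * wderiv v y), enc (c - \<alpha>) (\<lambda>y. rtV y * (a * u y + b * v y)))"
    by (rule triple_eqI) (intro dom_lincomb has_weak_deriv_lincomb L2_add L2_cmult domD u v)+
  ultimately show ?thesis
    by (simp add: enc_add enc_cmult L2_cmult domD[OF u] domD[OF v] triple_def triple_mult_i_def)
qed

text \<open>The first component determines the other two: a function that vanishes almost everywhere
  has weak derivative 0. By linearity, elements of K can be identified by their first
  components.\<close>

lemma triple_eq_0: "u \<in> fdom \<Longrightarrow> enc (c - \<alpha>) u = 0 \<Longrightarrow> triple u = 0"
proof -
  assume u: "u \<in> fdom" and 0: "enc (c - \<alpha>) u = 0"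
  have e0: "enc k (\<lambda>_. 0) = 0" for k using enc_diff[OF L2_0 L2_0, of k] by simp
  have ae: "AE y in halfline. u y = 0"
    using 0 enc_eq_iff[OF domD(1)[OF u] L2_0] by (simp add: e0)
  have um: "u \<in> borel_measurable halfline" using L2_measurable[OF domD(1)[OF u]] by simp
  have "has_weak_deriv (\<lambda>_. 0) (\<lambda>_. 0)"
    by (auto simp: has_weak_deriv_iff intro: continuous_on_locally_integrable)
  then have "has_weak_deriv u (\<lambda>_. 0)"
    by (rule has_weak_deriv_cong_AE) (use ae um in auto)
  from triple_eqI[OF u this L2_0] have "triple u = (0, 0, enc (c - \<alpha>) (\<lambda>y. rtV y * u y))"
    by (simp add: e0 0)
  also have "enc (c - \<alpha>) (\<lambda>y. rtV y * u y) = enc (c - \<alpha>) (\<lambda>_. 0)"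
    using ae by (subst enc_eq_iff) (auto simp: domD[OF u] L2_0 elim: eventually_mono)
  finally show ?thesis by (simp add: e0 zero_prod_def)
qed

lemma triple_cong_AE:
  assumes u: "u \<in> fdom" and v: "v \<in> L2 \<mu>" and eq: "enc (c - \<alpha>) u = enc (c - \<alpha>) v"
  shows "v \<in> fdom" "triple v = triple u"
proof -
  have ae: "AE y in halfline. u y = v y" using eq domD(1)[OF u] v by (simp add: enc_eq_iff)
  then show vd: "v \<in> fdom" using L2_measurable[OF v] by (intro dom_cong_AE[OF u]) auto
  have "triple (\<lambda>y. 1 * v y + (-1) * u y) = 0"
  proof (rule triple_eq_0[OF dom_lincomb[OF vd u]])
    show "enc (c - \<alpha>) (\<lambda>y. 1 * v y + (-1) * u y) = 0"
      using eq enc_diff[OF v domD(1)[OF u]] by simp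
  qed
  then show "triple v = triple u" unfolding triple_lincomb[OF vd u] by simp
qed

abbreviation "K \<equiv> triple ` fdom"

lemma dom_0: "(\<lambda>_. 0) \<in> fdom"
  by (rule test_function_dom) (auto simp: test_functions_def intro: smooth_on_const exI[of _ 1])

lemma subspace_K: "subspace K"
proof (rule subspaceI)
  show "0 \<in> K"
  proof (rule image_eqI)
    have "enc (c - \<alpha>) (\<lambda>_. 0) = 0" using enc_diff[OF L2_0 L2_0, of "c - \<alpha>"] by simp
    then show "0 = triple (\<lambda>_. 0)" using triple_eq_0[OF dom_0] by simp
  qed (rule dom_0)
  show "x + y \<in> K" if "x \<in> K" "y \<in> K" for x y
  proof -
    from that obtain u v where u: "u \<in> fdom" "x = triple u" and v: "v \<in> fdom" "y = triple v" by blast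
    have t: "x + y = triple (\<lambda>y. 1 * u y + 1 * v y)"
      unfolding triple_lincomb[OF u(1) v(1)] u(2) v(2) by simp
    show ?thesis unfolding t by (rule imageI) (rule dom_lincomb[OF u(1) v(1)])
  qed
  show "r *\<^sub>R x \<in> K" if "x \<in> K" for r x
  proof -
    from that obtain u where u: "u \<in> fdom" "x = triple u" by blast
    have t: "r *\<^sub>R x = triple (\<lambda>y. of_real r * u y + 0 * u y)"
      unfolding triple_lincomb[OF u(1) u(1)] u(2) by simp
    show ?thesis unfolding t by (rule imageI) (rule dom_lincomb[OF u(1) u(1)])
  qed
qed

lemma triple_mult_i_K: "x \<in> K \<Longrightarrow> triple_mult_i x \<in> K"
proof -
  assume "x \<in> K"
  then obtain u where u: "u \<in> fdom" "x = triple u" by blast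
  have t: "triple_mult_i x = triple (\<lambda>y. \<i> * u y + 0 * u y)"
    unfolding triple_lincomb[OF u(1) u(1)] u(2) by simp
  show ?thesis unfolding t by (rule imageI) (rule dom_lincomb[OF u(1) u(1)])
qed

text \<open>Closedness of the form. The limits of the second and third components are recognized as
  the derivative and the V^(1/2) multiple of the limit of the first by testing, where every term is
  a continuous functional of one component.\<close>

lemma closed_K: "closed K"
proof (rule closed_sequential_limits[THEN iffD2], intro allI impI, elim conjE)
  fix X l assume X: "\<forall>n. X n \<in> K" and lim: "X \<longlonglongrightarrow> l"
  from X have "\<exists>v. v \<in> fdom \<and> X n = triple v" for n by blast
  then obtain u where "\<forall>n. u n \<in> fdom \<and> X n = triple (u n)" using choice[of "\<lambda>n v. v \<in> fdom \<and> X n = triple v"] by blast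
  then have u: "\<And>n. u n \<in> fdom" "\<And>n. X n = triple (u n)" by simp_all
  obtain l1 l2 l3 where l: "l = (l1, l2, l3)" by (cases l)
  have lim1: "(\<lambda>n. enc (c - \<alpha>) (u n)) \<longlonglongrightarrow> l1"
    using tendsto_fst[OF lim] by (simp add: u(2) l triple_def)
  have lim2: "(\<lambda>n. enc c (wderiv (u n))) \<longlonglongrightarrow> l2"
    using tendsto_fst[OF tendsto_snd[OF lim]] by (simp add: u(2) l triple_def)
  have lim3: "(\<lambda>n. enc (c - \<alpha>) (\<lambda>y. rtV y * u n y)) \<longlonglongrightarrow> l3"
    using tendsto_snd[OF tendsto_snd[OF lim]] by (simp add: u(2) l triple_def)
  define U where "U = dec (c - \<alpha>) l1"
  define w where "w = dec c l2"
  define q where "q = dec (c - \<alpha>) l3"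
  have L: "U \<in> L2 \<mu>" "w \<in> L2 (wmeas c)" "q \<in> L2 \<mu>" by (simp_all add: U_def w_def q_def dec_L2)
  have E: "enc (c - \<alpha>) U = l1" "enc c w = l2" "enc (c - \<alpha>) q = l3" by (simp_all add: U_def w_def q_def enc_dec)
  have d: "has_weak_deriv U w"
    by (rule has_weak_deriv_enc[OF L(1,2), of u "\<lambda>n. wderiv (u n)"]) (use lim1 lim2 E domD[OF u(1)] in auto)
  have ae: "AE y in halfline. rtV y * U y - q y = 0"
  proof (rule fundamental_lemma_calculus_of_variations)
    have loc: "locally_integrable (\<lambda>y. rtV y * U y)"
      using rtV_mult_locally_integrable[OF L(1)] by (simp add: mult.commute)
    then show "locally_integrable (\<lambda>y. rtV y * U y - q y)"
      by (intro locally_integrable_diff L2_wmeas_locally_integrable[OF L(3)])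
    fix \<phi> assume \<phi>: "\<phi> \<in> test_functions"
    have "(\<lambda>n. LINT y|halfline. (rtV y * u n y) * \<phi> y) \<longlonglongrightarrow> (LINT y|halfline. (rtV y * U y) * \<phi> y)"
      unfolding integral_rtV_test_function_enc[OF domD(1)[OF u(1)] \<phi>] integral_rtV_test_function_enc[OF L(1) \<phi>] E
      by (intro tendsto_Complex tendsto_inner lim1 tendsto_const)
    moreover have "(\<lambda>n. LINT y|halfline. (rtV y * u n y) * \<phi> y) \<longlonglongrightarrow> (LINT y|halfline. q y * \<phi> y)"
      unfolding integral_test_function_enc[OF domD(4)[OF u(1)] \<phi>] integral_test_function_enc[OF L(3) \<phi>] E
      by (intro tendsto_Complex tendsto_inner lim3 tendsto_const)
    ultimately have "(LINT y|halfline. (rtV y * U y) * \<phi> y) = (LINT y|halfline. q y * \<phi> y)"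
      by (rule LIMSEQ_unique)
    moreover have "integrable halfline (\<lambda>y. (rtV y * U y) * \<phi> y)" "integrable halfline (\<lambda>y. q y * \<phi> y)"
      by (rule integrable_mult_test_function[OF loc \<phi>],
          rule integrable_mult_test_function[OF L2_wmeas_locally_integrable[OF L(3)] \<phi>])
    ultimately show "(LINT y|halfline. (rtV y * U y - q y) * \<phi> y) = 0"
      by (simp add: left_diff_distrib)
  qed
  have Um: "(\<lambda>y. rtV y * U y) \<in> borel_measurable halfline" using L2_measurable[OF L(1)] by simp
  have ae': "AE y in halfline. q y = rtV y * U y" using ae by eventually_elim simp
  have qL: "(\<lambda>y. rtV y * U y) \<in> L2 \<mu>" by (rule L2_wmeas_cong_AE[OF L(3) Um ae'])
  have Ud: "U \<in> fdom" by (rule domI[OF L(1) d L(2) qL])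
  have "enc (c - \<alpha>) (\<lambda>y. rtV y * U y) = l3"
    unfolding E(3)[symmetric] using ae by (subst enc_eq_iff[OF qL L(3)]) simp
  then have "triple U = l" unfolding triple_eqI[OF Ud d L(2)] l by (simp add: E)
  then show "l \<in> K" using Ud by blast
qed

text \<open>The variational solution of u - A u = f: the projection of (f, 0, 0) is the triple of
  that u for which the product of u and v plus the form equals the product of f and v, for all v in
  the form domain.\<close>

definition resolvent :: "l2h \<Rightarrow>\<^sub>L l2h" where
  "resolvent = Blinfun (\<lambda>f. fst (orth_proj K (f, 0)))"

lemma resolvent_apply: "resolvent f = fst (orth_proj K (f, 0))"
proof -
  have "bounded_linear (\<lambda>f. fst (orth_proj K (f, 0)))"
    by (intro bounded_linear_fst_comp bounded_linear_compose[OF bounded_linear_orth_proj[OF subspace_K closed_K]]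
        bounded_linear_Pair bounded_linear_ident bounded_linear_zero)
  then show ?thesis by (simp add: resolvent_def bounded_linear_Blinfun_apply)
qed

definition mult_i :: "l2h \<Rightarrow>\<^sub>L l2h" where
  "mult_i = Blinfun l2h_mult_i"

lemma mult_i_apply [simp]: "mult_i x = l2h_mult_i x"
  by (simp add: mult_i_def bounded_linear_Blinfun_apply bounded_linear_l2h_mult_i)

lemma triple_mult_i_inner: "inner (triple_mult_i x) (triple_mult_i y) = inner x y"
  by (simp add: triple_mult_i_def inner_prod_def inner_l2h_mult_i)

lemma triple_mult_i_diff: "triple_mult_i (x - y) = triple_mult_i x - triple_mult_i y"
  by (simp add: triple_mult_i_def linear_diff[OF bounded_linear.linear[OF bounded_linear_l2h_mult_i]])

lemma triple_mult_i_twice: "triple_mult_i (triple_mult_i x) = - x"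
  by (simp add: triple_mult_i_def l2h_mult_i_twice prod_eq_iff)

text \<open>With P the projection, the product of R x and y is that of P (x, 0) and (y, 0). Symmetry
  of R follows from symmetry of P, and 0 \<le> R \<le> 1 because the quadratic form of P is a
  squared norm not exceeding that of its argument.\<close>

sublocale complex_unit_interval_operator resolvent mult_i
proof
  note P = orth_proj_in[OF subspace_K closed_K] orth_proj_orthogonal[OF subspace_K closed_K]
    inner_orth_proj[OF subspace_K closed_K] inner_orth_proj_commute[OF subspace_K closed_K]
  have inn: "inner (resolvent x) y = inner (orth_proj K (x, 0)) (y, 0)" for x y
    by (simp add: resolvent_apply inner_prod_def)
  show "inner (resolvent x) y = inner x (resolvent y)" for x y
    using inn[of x y] inn[of y x] P(4)[of "(x, 0)" "(y, 0)"] by (simp add: inner_commute)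
  have sq: "inner (resolvent x) x = inner (orth_proj K (x, 0)) (orth_proj K (x, 0))" for x
    using inn[of x x] P(3)[of "(x, 0)" "(x, 0)"] by (simp add: inner_commute)
  show "0 \<le> inner (resolvent x) x" for x unfolding sq by simp
  show "inner (resolvent x) x \<le> inner x x" for x
  proof -
    have "(norm (orth_proj K (x, 0)))\<^sup>2 \<le> (norm (x, 0 :: l2h \<times> l2h))\<^sup>2"
      by (intro power_mono norm_orth_proj subspace_K closed_K) simp
    then show ?thesis unfolding sq by (simp add: power2_norm_eq_inner inner_prod_def)
  qed
  show "mult_i (mult_i x) = - x" for x by (simp add: l2h_mult_i_twice)
  show "inner (mult_i x) (mult_i y) = inner x y" for x y by (simp add: inner_l2h_mult_i)
  show "resolvent (mult_i x) = mult_i (resolvent x)" for x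
  proof -
    have "orth_proj K (triple_mult_i (x, 0)) = triple_mult_i (orth_proj K (x, 0))"
    proof (rule orth_proj_eqI[OF subspace_K closed_K])
      show "triple_mult_i (orth_proj K (x, 0)) \<in> K" by (intro triple_mult_i_K P(1))
      fix y assume y: "y \<in> K"
      \<comment> \<open>Every y in K is i times another element of K, so the isometry i carries
        orthogonality to K from x to i x.\<close>
      have "y = triple_mult_i (triple_mult_i (- y))" by (simp add: triple_mult_i_twice)
      moreover have "triple_mult_i (- y) \<in> K" using y subspace_neg[OF subspace_K] by (intro triple_mult_i_K) auto
      ultimately show "inner (triple_mult_i (x, 0) - triple_mult_i (orth_proj K (x, 0))) y = 0"
        using P(2) by (metis triple_mult_i_diff triple_mult_i_inner)
    qed
    moreover have "triple_mult_i (x, 0) = (l2h_mult_i x, 0)"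
      using linear_0[OF bounded_linear.linear[OF bounded_linear_l2h_mult_i]]
      by (simp add: triple_mult_i_def zero_prod_def)
    ultimately show ?thesis by (simp add: resolvent_apply triple_mult_i_def)
  qed
qed

text \<open>By symmetry a vector x orthogonal to the range satisfies R x = 0. The projection of (x,
  0) then vanishes, as its first component does, so x is orthogonal to the whole form domain and in
  particular to all test functions.\<close>

lemma dense_range_resolvent: "closure (range (blinfun_apply resolvent)) = UNIV"
proof (rule dense_if_orthogonal_zero)
  show "subspace (range (blinfun_apply resolvent))"
    by (intro linear_subspace_image subspace_UNIV bounded_linear.linear blinfun.bounded_linear_right)
  fix x assume x: "\<And>y. y \<in> range (blinfun_apply resolvent) \<Longrightarrow> inner x y = 0"
  have "inner (resolvent x) (resolvent x) = inner x (resolvent (resolvent x))" by (rule selfadj)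
  also have "\<dots> = 0" by (rule x) blast
  finally have R0: "resolvent x = 0" by simp
  obtain u where u: "u \<in> fdom" "orth_proj K (x, 0) = triple u"
    using orth_proj_in[OF subspace_K closed_K, of "(x, 0)"] by blast
  then have "triple u = 0" using R0 by (intro triple_eq_0) (auto simp: resolvent_apply triple_def)
  then have orth: "inner x (enc (c - \<alpha>) v) = 0" if "v \<in> fdom" for v
    using orth_proj_orthogonal[OF subspace_K closed_K, of "triple v" "(x, 0)"] that u(2)
    by (auto simp: triple_def inner_prod_def)
  have "AE y in halfline. dec (c - \<alpha>) x y = 0"
  proof (rule fundamental_lemma_calculus_of_variations)
    show "locally_integrable (dec (c - \<alpha>) x)" by (rule L2_wmeas_locally_integrable[OF dec_L2])
    fix \<phi> assume \<phi>: "\<phi> \<in> test_functions"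
    let ?g = "\<lambda>y. of_real (y powr (- (c - \<alpha>))) * cnj (\<phi> y)"
    have g: "?g \<in> test_functions" by (intro test_function_mult test_function_cnj \<phi> smooth_on_powr)
    have "inner x (enc (c - \<alpha>) ?g) = 0" by (intro orth test_function_dom g)
    moreover have "inner x (l2h_mult_i (enc (c - \<alpha>) ?g)) = 0"
      using orth[OF test_function_dom[OF test_function_cmult[OF g, of \<i>]]] enc_mult_i[OF test_function_L2[OF g], of "c - \<alpha>"] by simp
    ultimately show "(LINT y|halfline. dec (c - \<alpha>) x y * \<phi> y) = 0"
      unfolding integral_test_function_enc[OF dec_L2 \<phi>] enc_dec by (simp add: complex_eq_iff)
  qed
  then have "enc (c - \<alpha>) (dec (c - \<alpha>) x) = enc (c - \<alpha>) (\<lambda>_. 0)"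
    by (subst enc_eq_iff[OF dec_L2 L2_0])
  also have "\<dots> = 0" using enc_diff[OF L2_0 L2_0, of "c - \<alpha>"] by simp
  finally show "x = 0" by (simp add: enc_dec)
qed

text \<open>The factor y^\<alpha> turns the weight c - \<alpha> into c in the derivative term. Both
  terms are integrable for u and v in the domain, which justifies splitting the integral.\<close>

lemma form_eq:
  assumes u: "u \<in> fdom" and v: "v \<in> fdom"
  shows "form \<alpha> c V u v = (LINT y|wmeas c. wderiv u y * cnj (wderiv v y)) + (LINT y|\<mu>. (rtV y * u y) * cnj (rtV y * v y))"
    and "(LINT y|\<mu>. (rtV y * u y) * cnj (rtV y * v y)) = (LINT y|\<mu>. of_real (V y) * u y * cnj (v y))"
proof -
  note L = domD[OF u] domD[OF v]
  have m: "wderiv u \<in> borel_measurable halfline" "wderiv v \<in> borel_measurable halfline"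
    "u \<in> borel_measurable halfline" "v \<in> borel_measurable halfline"
    using L2_measurable[OF L(1)] L2_measurable[OF L(3)] L2_measurable[OF L(5)] L2_measurable[OF L(7)] by auto
  note [measurable] = m
  have cm: "(\<lambda>y. cnj (wderiv v y)) \<in> borel_measurable halfline"
    by (rule measurable_compose[OF m(2) borel_measurable_cnj])
  note [measurable] = cm
  have Fm: "(\<lambda>y. of_real (y powr \<alpha>) * wderiv u y * cnj (wderiv v y)) \<in> borel_measurable halfline"
    by measurable
  have Gm: "(\<lambda>y. wderiv u y * cnj (wderiv v y)) \<in> borel_measurable halfline" by measurable
  have eq: "y powr (c - \<alpha>) *\<^sub>R (of_real (y powr \<alpha>) * wderiv u y * cnj (wderiv v y)) = y powr c *\<^sub>R (wderiv u y * cnj (wderiv v y))"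
    if "0 < y" for y
  proof -
    have "complex_of_real (y powr c) = of_real (y powr (c - \<alpha>)) * of_real (y powr \<alpha>)"
      using that by (simp add: powr_add[symmetric] flip: of_real_mult)
    then show ?thesis by (simp add: scaleR_conv_of_real mult.assoc)
  qed
  have eqi: "integrable halfline (\<lambda>y. y powr (c - \<alpha>) *\<^sub>R (of_real (y powr \<alpha>) * wderiv u y * cnj (wderiv v y)))
      \<longleftrightarrow> integrable halfline (\<lambda>y. y powr c *\<^sub>R (wderiv u y * cnj (wderiv v y)))"
    by (rule Bochner_Integration.integrable_cong) (auto simp: eq)
  have i1: "integrable \<mu> (\<lambda>y. of_real (y powr \<alpha>) * wderiv u y * cnj (wderiv v y))"
    using L2_integrable_mult_cnj[OF L(3) L(7)] unfolding integrable_wmeas[OF Fm] integrable_wmeas[OF Gm] eqi .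
  have e1: "(LINT y|\<mu>. of_real (y powr \<alpha>) * wderiv u y * cnj (wderiv v y)) = (LINT y|wmeas c. wderiv u y * cnj (wderiv v y))"
    unfolding integral_wmeas[OF Fm] integral_wmeas[OF Gm]
    by (rule Bochner_Integration.integral_cong) (auto simp: eq)
  have ae: "AE y in \<mu>. (rtV y * u y) * cnj (rtV y * v y) = of_real (V y) * u y * cnj (v y)"
    unfolding AE_wmeas_iff using V_nonneg
  proof eventually_elim
    case (elim y)
    then have "rtV y * rtV y = of_real (V y)" by (simp flip: of_real_mult)
    then show ?case by (simp add: mult_ac)
  qed
  have cv: "(\<lambda>y. cnj (v y)) \<in> borel_measurable halfline"
    by (rule measurable_compose[OF m(4) borel_measurable_cnj])
  note [measurable] = cv
  have Hm: "(\<lambda>y. of_real (V y) * u y * cnj (v y)) \<in> borel_measurable \<mu>"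
    unfolding measurable_wmeas by measurable
  have i2': "integrable \<mu> (\<lambda>y. (rtV y * u y) * cnj (rtV y * v y))"
    by (rule L2_integrable_mult_cnj[OF L(4) L(8)])
  have i2: "integrable \<mu> (\<lambda>y. of_real (V y) * u y * cnj (v y))"
    by (rule integrable_cong_AE_imp[OF i2' Hm]) (use ae in eventually_elim, simp)
  have e2: "(LINT y|\<mu>. of_real (V y) * u y * cnj (v y)) = (LINT y|\<mu>. (rtV y * u y) * cnj (rtV y * v y))"
    by (rule integral_cong_AE[OF Hm borel_measurable_integrable[OF i2']]) (use ae in eventually_elim, metis)
  show "form \<alpha> c V u v = (LINT y|wmeas c. wderiv u y * cnj (wderiv v y)) + (LINT y|\<mu>. (rtV y * u y) * cnj (rtV y * v y))"
    unfolding form_def using Bochner_Integration.integral_add[OF i1 i2] by (simp only: e1 e2)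
  show "(LINT y|\<mu>. (rtV y * u y) * cnj (rtV y * v y)) = (LINT y|\<mu>. of_real (V y) * u y * cnj (v y))"
    by (rule e2[symmetric])
qed

lemma form_eq_inner_triple:
  assumes u: "u \<in> fdom" and v: "v \<in> fdom"
  shows "form \<alpha> c V u v = Complex (inner (snd (triple u)) (snd (triple v))) (inner (snd (triple u)) (snd (triple_mult_i (triple v))))"
  unfolding form_eq(1)[OF u v] integral_cnj_enc[OF domD(3)[OF u] domD(3)[OF v]] integral_cnj_enc[OF domD(4)[OF u] domD(4)[OF v]]
  by (simp add: triple_def triple_mult_i_def inner_prod_def complex_eq_iff)

end

section \<open>Generation of the contractive analytic semigroup\<close>

lemma in_sector_pi_half: "z \<in> sector (pi / 2) \<longleftrightarrow> 0 < Re z"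
  unfolding sector_def mem_Collect_eq Arg_Re_pos by auto

context weighted_form
begin

lemma enc_cmult_cscale: "f \<in> L2 \<mu> \<Longrightarrow> enc (c - \<alpha>) (\<lambda>y. a * f y) = cscale a (enc (c - \<alpha>) f)"
  by (simp add: enc_cmult cscale_def)

text \<open>Added to the product of u and v, the weak equation says that (u - g, 0, 0) minus the
  triple of u is orthogonal to K; the complex identity is the real one for v together with that for
  i v. In the converse direction the projection is the triple of some w equal to u almost
  everywhere, and \<open>triple_cong_AE\<close> passes from w to u.\<close>

lemma neumann_op_iff:
  assumes u: "u \<in> L2 \<mu>" and g: "g \<in> L2 \<mu>"
  shows "(u, g) \<in> neumann_op \<alpha> c V \<longleftrightarrow> enc (c - \<alpha>) u = resolvent (enc (c - \<alpha>) u - enc (c - \<alpha>) g)"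
proof -
  define f where "f = enc (c - \<alpha>) u - enc (c - \<alpha>) g"
  have inn: "inner ((f, 0) - triple u) y = - inner (enc (c - \<alpha>) g) (fst y) - inner (snd (triple u)) (snd y)" for y
    by (simp add: f_def inner_prod_def triple_def inner_diff_left)
  have rhs: "(LINT y|\<mu>. - g y * cnj (v y)) = Complex (- inner (enc (c - \<alpha>) g) (fst (triple v))) (- inner (enc (c - \<alpha>) g) (fst (triple_mult_i (triple v))))"
    if v: "v \<in> fdom" for v
  proof -
    have "(LINT y|\<mu>. - g y * cnj (v y)) = - (LINT y|\<mu>. g y * cnj (v y))" by simp
    then show ?thesis unfolding integral_cnj_enc[OF g domD(1)[OF v]]
      by (simp add: triple_def triple_mult_i_def complex_eq_iff)
  qed
  show ?thesis unfolding f_def[symmetric]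
  proof
    assume "(u, g) \<in> neumann_op \<alpha> c V"
    then have ud: "u \<in> fdom" and eq: "\<And>v. v \<in> fdom \<Longrightarrow> form \<alpha> c V u v = (LINT y|\<mu>. - g y * cnj (v y))"
      by (auto simp: neumann_op_def)
    have "orth_proj K (f, 0) = triple u"
    proof (rule orth_proj_eqI[OF subspace_K closed_K])
      show "triple u \<in> K" using ud by blast
      fix y assume "y \<in> K"
      then obtain v where v: "v \<in> fdom" "y = triple v" by blast
      show "inner ((f, 0) - triple u) y = 0"
        using eq[OF v(1)] unfolding inn v(2) rhs[OF v(1)] form_eq_inner_triple[OF ud v(1)] by simp
    qed
    then show "enc (c - \<alpha>) u = resolvent f" by (simp add: resolvent_apply triple_def)
  next
    assume *: "enc (c - \<alpha>) u = resolvent f"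
    obtain w where w: "w \<in> fdom" "orth_proj K (f, 0) = triple w"
      using orth_proj_in[OF subspace_K closed_K, of "(f, 0)"] by blast
    have "enc (c - \<alpha>) w = enc (c - \<alpha>) u" using * w(2) by (simp add: resolvent_apply triple_def)
    from triple_cong_AE[OF w(1) u this] have ud: "u \<in> fdom" and P: "orth_proj K (f, 0) = triple u"
      using w(2) by auto
    have orth: "inner ((f, 0) - triple u) y = 0" if "y \<in> K" for y
      using orth_proj_orthogonal[OF subspace_K closed_K that, of "(f, 0)"] P by simp
    have "form \<alpha> c V u v = (LINT y|\<mu>. - g y * cnj (v y))" if v: "v \<in> fdom" for v
    proof -
      have "triple v \<in> K" using v by blast
      then show ?thesis
        using orth[of "triple v"] orth[OF triple_mult_i_K, of "triple v"]
        unfolding inn rhs[OF v] form_eq_inner_triple[OF ud v] by (simp add: complex_eq_iff)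
    qed
    then show "(u, g) \<in> neumann_op \<alpha> c V" using ud g by (simp add: neumann_op_def)
  qed
qed

lemma bounded_operator_dec_enc:
  assumes B: "\<And>a x. blinfun_apply B (cscale a x) = cscale a (B x)"
  shows "bounded_operator \<mu> (\<lambda>f. dec (c - \<alpha>) (B (enc (c - \<alpha>) f)))"
  unfolding bounded_operator_def
proof (intro conjI ballI allI)
  show "dec (c - \<alpha>) (B (enc (c - \<alpha>) f)) \<in> L2 \<mu>" for f by (rule dec_L2)
  fix f g a b assume f: "f \<in> L2 \<mu>" and g: "g \<in> L2 \<mu>"
  let ?S = "\<lambda>f. dec (c - \<alpha>) (B (enc (c - \<alpha>) f))"
  have "enc (c - \<alpha>) (\<lambda>t. a * ?S f t + b * ?S g t) = cscale a (B (enc (c - \<alpha>) f)) + cscale b (B (enc (c - \<alpha>) g))"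
    by (simp add: enc_add enc_cmult_cscale dec_L2 L2_cmult enc_dec)
  also have "\<dots> = B (enc (c - \<alpha>) (\<lambda>t. a * f t + b * g t))"
    using f g by (simp add: enc_add enc_cmult_cscale L2_cmult blinfun.add_right B)
  also have "\<dots> = enc (c - \<alpha>) (?S (\<lambda>t. a * f t + b * g t))" by (simp add: enc_dec)
  finally have "enc (c - \<alpha>) (?S (\<lambda>t. a * f t + b * g t)) = enc (c - \<alpha>) (\<lambda>t. a * ?S f t + b * ?S g t)" by simp
  then show "AE x in \<mu>. ?S (\<lambda>t. a * f t + b * g t) x = a * ?S f x + b * ?S g x"
    unfolding AE_wmeas_iff by (subst (asm) enc_eq_iff) (auto intro!: dec_L2 L2_add L2_cmult)
next
  show "\<exists>K. \<forall>f\<in>L2 \<mu>. l2norm \<mu> (dec (c - \<alpha>) (B (enc (c - \<alpha>) f))) \<le> K * l2norm \<mu> f"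
    using norm_blinfun[of B]
    by (intro exI[of _ "norm B"] ballI) (simp add: dec_L2 enc_dec flip: norm_enc)
qed

definition sg :: "complex \<Rightarrow> (real \<Rightarrow> complex) \<Rightarrow> (real \<Rightarrow> complex)" where
  "sg z f = dec (c - \<alpha>) (heat z (enc (c - \<alpha>) f))"

lemma sg_L2: "sg z f \<in> L2 \<mu>" and enc_sg: "enc (c - \<alpha>) (sg z f) = heat z (enc (c - \<alpha>) f)"
  by (simp_all add: sg_def dec_L2 enc_dec)

lemma l2norm_sg_quotient:
  assumes u: "u \<in> L2 \<mu>" and g: "g \<in> L2 \<mu>" and v: "v \<in> L2 \<mu>"
  shows "l2norm \<mu> (\<lambda>x. (u x - v x) / a - g x)
    = norm (cscale (1 / a) (enc (c - \<alpha>) u - enc (c - \<alpha>) v) - enc (c - \<alpha>) g)"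
proof -
  have "(\<lambda>x. (u x - v x) / a - g x) = (\<lambda>x. (1 / a) * (u x - v x) - g x)" by simp
  moreover have "(\<lambda>x. (1 / a) * (u x - v x) - g x) \<in> L2 \<mu>" by (intro L2_diff L2_cmult u v g)
  ultimately show ?thesis
    using u v g by (simp only: norm_enc[symmetric] enc_diff L2_diff L2_cmult enc_cmult_cscale)
qed

lemma l2norm_diff: "u \<in> L2 \<mu> \<Longrightarrow> v \<in> L2 \<mu> \<Longrightarrow> l2norm \<mu> (\<lambda>x. u x - v x) = norm (enc (c - \<alpha>) u - enc (c - \<alpha>) v)"
  by (simp add: norm_enc[symmetric] enc_diff L2_diff)

lemma generator_sg: "generator \<mu> sg = neumann_op \<alpha> c V"
proof (rule set_eqI, rule iffI)
  fix p
  have main: "((\<lambda>t. l2norm \<mu> (\<lambda>x. (sg (of_real t) u x - u x) / of_real t - g x)) \<longlongrightarrow> 0) (at_right 0)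
      \<longleftrightarrow> (u, g) \<in> neumann_op \<alpha> c V" if u: "u \<in> L2 \<mu>" and g: "g \<in> L2 \<mu>" for u g
  proof -
    have "l2norm \<mu> (\<lambda>x. (sg (of_real t) u x - u x) / of_real t - g x)
        = norm ((1 / t) *\<^sub>R (heat (of_real t) (enc (c - \<alpha>) u) - enc (c - \<alpha>) u) - enc (c - \<alpha>) g)" for t :: real
      unfolding l2norm_sg_quotient[OF sg_L2 g u] enc_sg by (simp add: cscale_def flip: of_real_divide)
    then show ?thesis
      by (simp add: tendsto_norm_zero_iff LIM_zero_iff heat_generator[OF dense_range_resolvent] neumann_op_iff[OF u g])
  qed
  show "p \<in> neumann_op \<alpha> c V" if "p \<in> generator \<mu> sg"
    using that main by (auto simp: generator_def)
  show "p \<in> generator \<mu> sg" if p: "p \<in> neumann_op \<alpha> c V"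
  proof -
    obtain u g where ug: "p = (u, g)" by (cases p)
    have "u \<in> L2 \<mu>" "g \<in> L2 \<mu>" using p domD(1) by (auto simp: neumann_op_def ug)
    then show ?thesis using main p by (auto simp: generator_def ug)
  qed
qed

text \<open>Self-adjointness gives contractions on the whole open right half-plane, so the largest
  admissible angle \<pi> / 2 can be taken.\<close>

theorem generates: "generates_contractive_analytic_semigroup \<mu> (neumann_op \<alpha> c V)"
  unfolding generates_contractive_analytic_semigroup_def
proof (intro exI conjI)
  show "generator \<mu> sg = neumann_op \<alpha> c V" by (rule generator_sg)
  show "\<forall>z\<in>sector (pi / 2). \<forall>f\<in>L2 \<mu>. l2norm \<mu> (sg z f) \<le> l2norm \<mu> f"
    by (auto simp: in_sector_pi_half sg_L2 enc_sg norm_heat_le simp flip: norm_enc)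
  show "analytic_semigroup \<mu> (pi / 2) sg"
    unfolding analytic_semigroup_def
  proof (intro conjI ballI allI impI)
    show "bounded_operator \<mu> (sg z)" if "z \<in> insert 0 (sector (pi / 2))" for z
    proof -
      have "bounded_operator \<mu> (\<lambda>f. dec (c - \<alpha>) (heat z (enc (c - \<alpha>) f)))"
        using that by (intro bounded_operator_dec_enc) (auto simp: in_sector_pi_half heat_cscale heat_0)
      then show ?thesis by (simp add: sg_def[abs_def])
    qed
    show "AE x in \<mu>. sg 0 f x = f x" if "f \<in> L2 \<mu>" for f
      using dec_enc[OF that] by (simp add: AE_wmeas_iff sg_def heat_0)
    show "AE x in \<mu>. sg (z + w) f x = sg z (sg w f) x"
      if "z \<in> sector (pi / 2)" "w \<in> sector (pi / 2)" "f \<in> L2 \<mu>" for z w f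
      using that by (simp add: sg_def enc_dec heat_add in_sector_pi_half)
    show "operator_holomorphic_on \<mu> sg (sector (pi / 2))"
      unfolding operator_holomorphic_on_def
    proof
      fix z assume "z \<in> sector (pi / 2)"
      then have z: "0 < Re z" by (simp add: in_sector_pi_half)
      define D where "D f = dec (c - \<alpha>) (heat_deriv z (enc (c - \<alpha>) f))" for f
      have "bounded_operator \<mu> D"
        unfolding D_def[abs_def] using z by (intro bounded_operator_dec_enc heat_deriv_cscale)
      moreover have "\<forall>\<^sub>F w in at z within sector (pi / 2). \<forall>f\<in>L2 \<mu>.
           l2norm \<mu> (\<lambda>x. (sg w f x - sg z f x) / (w - z) - D f x) \<le> \<epsilon> * l2norm \<mu> f" if e: "\<epsilon> > 0" for \<epsilon>
      proof -
        \<comment> \<open>The first bound makes \<open>heat_difference_quotient\<close> applicable,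
          the second turns its constant 8 / (Re z)^2 into \<epsilon>.\<close>
        define d where "d = min (Re z / 2) (\<epsilon> * (Re z)\<^sup>2 / 8)"
        have d: "d > 0" using e z by (simp add: d_def)
        have "\<forall>f\<in>L2 \<mu>. l2norm \<mu> (\<lambda>x. (sg w f x - sg z f x) / (w - z) - D f x) \<le> \<epsilon> * l2norm \<mu> f"
          if w: "w \<noteq> z" "dist w z < d" for w
        proof
          fix f assume f: "f \<in> L2 \<mu>"
          have D: "D f \<in> L2 \<mu>" "enc (c - \<alpha>) (D f) = heat_deriv z (enc (c - \<alpha>) f)"
            by (simp_all add: D_def dec_L2 enc_dec)
          have wz: "cmod (w - z) \<le> Re z / 2" "cmod (w - z) \<le> \<epsilon> * (Re z)\<^sup>2 / 8"
            using w(2) by (simp_all add: dist_norm d_def)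
          have "l2norm \<mu> (\<lambda>x. (sg w f x - sg z f x) / (w - z) - D f x)
              \<le> 8 / (Re z)\<^sup>2 * cmod (w - z) * norm (enc (c - \<alpha>) f)"
            unfolding l2norm_sg_quotient[OF sg_L2 D(1) sg_L2] enc_sg D(2)
            by (rule heat_difference_quotient[OF z wz(1) w(1)])
          also have "\<dots> \<le> 8 / (Re z)\<^sup>2 * (\<epsilon> * (Re z)\<^sup>2 / 8) * norm (enc (c - \<alpha>) f)"
            using wz(2) by (intro mult_right_mono mult_left_mono) auto
          also have "\<dots> = \<epsilon> * l2norm \<mu> f" using z f by (simp add: norm_enc)
          finally show "l2norm \<mu> (\<lambda>x. (sg w f x - sg z f x) / (w - z) - D f x) \<le> \<epsilon> * l2norm \<mu> f" .
        qed
        then show ?thesis unfolding eventually_at using d by blast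
      qed
      ultimately show "\<exists>D. bounded_operator \<mu> D \<and> (\<forall>\<epsilon>>0. \<forall>\<^sub>F w in at z within sector (pi / 2). \<forall>f\<in>L2 \<mu>.
           l2norm \<mu> (\<lambda>x. (sg w f x - sg z f x) / (w - z) - D f x) \<le> \<epsilon> * l2norm \<mu> f)" by blast
    qed
    show "((\<lambda>z. l2norm \<mu> (\<lambda>x. sg z f x - f x)) \<longlongrightarrow> 0) (at 0 within sector \<theta>')"
      if "0 < \<theta>' \<and> \<theta>' < pi / 2" "f \<in> L2 \<mu>" for \<theta>' f
    proof -
      have "sector \<theta>' \<subseteq> {z. 0 < Re z}"
      proof
        fix z assume "z \<in> sector \<theta>'"
        then have "z \<in> sector (pi / 2)" using that by (auto simp: sector_def)
        then show "z \<in> {z. 0 < Re z}" by (simp add: in_sector_pi_half)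
      qed
      then have "((\<lambda>z. norm (heat z (enc (c - \<alpha>) f) - enc (c - \<alpha>) f)) \<longlongrightarrow> 0) (at 0 within sector \<theta>')"
        by (intro tendsto_norm_zero tendsto_within_subset[OF heat_tendsto_id[OF dense_range_resolvent]])
      then show ?thesis using that by (simp add: l2norm_diff sg_L2 enc_sg)
    qed
  qed simp_all
qed

end

section \<open>The core\<close>

text \<open>Integrated form of (y^c r')' = (1 + V) y^m r with the condition at 0 built in: the flux
  H = y^c r' is an integral from 0, without a free constant. The last clause excludes growth at
  infinity. Everything is real, because the argument is about signs.\<close>

definition ode_solution :: "real \<Rightarrow> real \<Rightarrow> (real \<Rightarrow> real) \<Rightarrow> (real \<Rightarrow> real) \<Rightarrow> (real \<Rightarrow> real) \<Rightarrow> bool" where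
  "ode_solution c m V r H \<longleftrightarrow>
    (\<forall>y>0. (r has_real_derivative y powr (- c) * H y) (at y)) \<and>
    (\<forall>y>0. integrable halfline (\<lambda>s. indicator {0..y} s * ((1 + V s) * s powr m * r s))) \<and>
    (\<forall>y>0. H y = (LINT s|halfline. indicator {0..y} s * ((1 + V s) * s powr m * r s))) \<and>
    integrable halfline (\<lambda>s. s powr m * (r s)\<^sup>2)"

lemma ode_solution_uminus:
  assumes "ode_solution c m V r H"
  shows "ode_solution c m V (\<lambda>y. - r y) (\<lambda>y. - H y)"
proof -
  have "((\<lambda>y. - r y) has_real_derivative y powr (- c) * - H y) (at y)" if "0 < y" for y
  proof -
    have "(r has_real_derivative y powr (- c) * H y) (at y)"
      using assms that unfolding ode_solution_def by blast
    from DERIV_minus[OF this] show ?thesis by simp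
  qed
  then show ?thesis using assms by (simp add: ode_solution_def)
qed

text \<open>For m > -1 the weight dominates 1 / s beyond 1, and the integral of 1 / s diverges
  logarithmically.\<close>

lemma not_integrable_increasing:
  assumes m: "-1 < m" and r: "integrable halfline (\<lambda>s. s powr m * (r s)\<^sup>2)"
    and k: "0 < k" "0 < Y" "\<And>s. Y \<le> s \<Longrightarrow> k \<le> r s"
  shows False
proof -
  define Z where "Z = max Y 1"
  have Z: "Y \<le> Z" "1 \<le> Z" by (simp_all add: Z_def)
  define I where "I = (LINT s|halfline. s powr m * (r s)\<^sup>2)"
  have bound: "k\<^sup>2 * (ln b - ln Z) \<le> I" if b: "Z \<le> b" for b
  proof -
    have c: "continuous_on {Z..b} (\<lambda>s. k\<^sup>2 * (1 / s))" using Z by (intro continuous_intros) auto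
    then have int: "integrable lborel (\<lambda>s. indicator {Z..b} s *\<^sub>R (k\<^sup>2 * (1 / s)))"
      by (rule borel_integrable_compact[OF compact_Icc])
    then have int': "set_integrable lebesgue {Z..b} (\<lambda>s. k\<^sup>2 * (1 / s))"
      unfolding set_integrable_def by (simp add: integrable_completion borel_measurable_integrable)
    have eq: "(\<lambda>s. indicator {0<..} s *\<^sub>R (indicator {Z..b} s *\<^sub>R (k\<^sup>2 * (1 / s)))) = (\<lambda>s. indicator {Z..b} s *\<^sub>R (k\<^sup>2 * (1 / s)))"
      using Z by (auto simp: indicator_def)
    have "k\<^sup>2 * (ln b - ln Z) = integral {Z..b} (\<lambda>s. k\<^sup>2 * (1 / s))"
    proof (rule integral_unique[symmetric])
      have "((\<lambda>s. k\<^sup>2 * (1 / s)) has_integral k\<^sup>2 * ln b - k\<^sup>2 * ln Z) {Z..b}"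
      proof (rule fundamental_theorem_of_calculus[OF b])
        fix s assume "s \<in> {Z..b}"
        then have "((\<lambda>s. k\<^sup>2 * ln s) has_real_derivative k\<^sup>2 * (1 / s)) (at s within {Z..b})"
          using Z by (auto intro!: derivative_eq_intros)
        then show "((\<lambda>s. k\<^sup>2 * ln s) has_vector_derivative k\<^sup>2 * (1 / s)) (at s within {Z..b})"
          by (simp add: has_real_derivative_iff_has_vector_derivative)
      qed
      then show "((\<lambda>s. k\<^sup>2 * (1 / s)) has_integral k\<^sup>2 * (ln b - ln Z)) {Z..b}" by (simp add: right_diff_distrib)
    qed
    also have "\<dots> = (LINT s:{Z..b}|lebesgue. k\<^sup>2 * (1 / s))"
      by (rule set_lebesgue_integral_eq_integral(2)[OF int', symmetric])
    also have "\<dots> = (LINT s|halfline. indicator {Z..b} s *\<^sub>R (k\<^sup>2 * (1 / s)))"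
      unfolding set_lebesgue_integral_def by (subst integral_restrict_space) (simp_all only: eq, simp)
    also have "\<dots> \<le> I"
      unfolding I_def
    proof (rule integral_mono)
      show "integrable halfline (\<lambda>s. indicator {Z..b} s *\<^sub>R (k\<^sup>2 * (1 / s)))"
        using int' unfolding set_integrable_def by (subst integrable_restrict_space) (simp_all only: eq, simp)
      fix s :: real assume "s \<in> space halfline"
      show "indicator {Z..b} s *\<^sub>R (k\<^sup>2 * (1 / s)) \<le> s powr m * (r s)\<^sup>2"
      proof (cases "s \<in> {Z..b}")
        case True
        then have s: "1 \<le> s" "Y \<le> s" using Z by auto
        have "1 / s = s powr (- 1)" using s by (simp add: powr_minus_divide)
        also have "\<dots> \<le> s powr m" using s m by (intro powr_mono) auto
        finally have "1 / s \<le> s powr m" .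
        moreover have "k\<^sup>2 \<le> (r s)\<^sup>2" using k(1) k(3)[OF s(2)] by (intro power_mono) auto
        ultimately have "(1 / s) * k\<^sup>2 \<le> s powr m * (r s)\<^sup>2" using s by (intro mult_mono) auto
        then show ?thesis using True by (simp add: mult.commute)
      qed auto
    qed (rule r)
    finally show ?thesis .
  qed
  have "0 \<le> I" unfolding I_def by (intro integral_nonneg_AE) auto
  \<comment> \<open>Chosen so that the logarithmic lower bound becomes I + k^2, which exceeds
    I.\<close>
  define b where "b = exp (ln Z + I / k\<^sup>2 + 1)"
  have lb: "ln b = ln Z + I / k\<^sup>2 + 1" by (simp add: b_def)
  have "Z = exp (ln Z)" using Z by simp
  also have "\<dots> \<le> b" unfolding b_def using \<open>0 \<le> I\<close> by simp
  finally have "k\<^sup>2 * (ln b - ln Z) \<le> I" by (rule bound)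
  then show False using k(1) by (simp add: lb distrib_left add.assoc)
qed

text \<open>While r \<ge> 0 to the right of y1, the flux H does not fall below H y1 > 0 and r does
  not decrease. At a first point with r \<le> 0 this would still give r at least r y1; so r never
  drops below r y1, which \<open>not_integrable_increasing\<close> excludes.\<close>

lemma ode_solution_same_sign_False:
  assumes sol: "ode_solution c m V r H" and V: "AE s in halfline. 0 \<le> V s" and m: "-1 < m"
    and y1: "0 < y1" "0 < r y1" "0 < H y1"
  shows False
proof -
  have d: "(r has_real_derivative y powr (- c) * H y) (at y)" if "0 < y" for y
    using sol that unfolding ode_solution_def by blast
  have I: "integrable halfline (\<lambda>s. indicator {0..y} s * ((1 + V s) * s powr m * r s))"
    and H: "H y = (LINT s|halfline. indicator {0..y} s * ((1 + V s) * s powr m * r s))" if "0 < y" for y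
    using sol that by (simp_all add: ode_solution_def)
  have cont: "continuous_on {a..b} r" if "0 < a" for a b
    using DERIV_isCont[OF d] that by (intro continuous_at_imp_continuous_on) auto
  have mono: "r y1 \<le> r t" if t: "y1 \<le> t" and pos: "\<And>s. y1 \<le> s \<Longrightarrow> s \<le> t \<Longrightarrow> 0 \<le> r s" for t
  proof (rule DERIV_nonneg_imp_nondecreasing[OF t])
    fix x assume x: "y1 \<le> x" "x \<le> t"
    then have x0: "0 < x" using y1(1) by simp
    have "H y1 \<le> H x"
      unfolding H[OF y1(1)] H[OF x0]
    proof (rule integral_mono_AE[OF I[OF y1(1)] I[OF x0]])
      show "AE s in halfline. indicator {0..y1} s * ((1 + V s) * s powr m * r s) \<le> indicator {0..x} s * ((1 + V s) * s powr m * r s)"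
        using V
      proof eventually_elim
        case (elim s)
        show ?case
        proof (cases "s \<in> {0..x} - {0..y1}")
          case True
          then have "0 \<le> r s" using x y1(1) by (intro pos) auto
          then show ?thesis using True elim by simp
        next
          case False
          then show ?thesis using x by (auto simp: indicator_def)
        qed
      qed
    qed
    then have "0 \<le> x powr (- c) * H x" using y1(3) by simp
    then show "\<exists>y. (r has_real_derivative y) (at x) \<and> 0 \<le> y" using d[OF x0] by blast
  qed
  have all_pos: "0 < r s" if s: "y1 \<le> s" for s
  proof (rule ccontr)
    assume neg: "\<not> 0 < r s"
    define S where "S = {t \<in> {y1..s}. r t \<le> 0}"
    have "closed S" unfolding S_def
      by (rule continuous_on_closed_Collect_le[OF cont[OF y1(1)] continuous_on_const closed_atLeastAtMost])
    moreover have "bounded S" by (rule bounded_subset[OF bounded_closed_interval[of y1 s]]) (auto simp: S_def)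
    ultimately have compact: "compact S" by (simp add: compact_eq_bounded_closed)
    have "s \<in> S" using s neg unfolding S_def by simp
    then have "S \<noteq> {}" by blast
    from compact_attains_inf[OF compact this]
    obtain t where t: "t \<in> S" "\<And>x. x \<in> S \<Longrightarrow> t \<le> x" by blast
    have below: "0 < r x" if "y1 \<le> x" "x < t" for x
    proof (rule ccontr)
      assume "\<not> 0 < r x"
      then have "x \<in> S" using t(1) that unfolding S_def by simp
      then show False using t(2)[of x] that(2) by simp
    qed
    \<comment> \<open>A negative value at t would force a zero before t. Hence r \<ge> 0 up to and
      including t, and \<open>mono\<close> reaches t itself.\<close>
    have "0 \<le> r t"
    proof (rule ccontr)
      assume "\<not> 0 \<le> r t"
      then have "\<exists>x\<ge>y1. x \<le> t \<and> r x = 0"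
        using t(1) y1 by (intro IVT2' cont) (auto simp: S_def)
      then obtain x where "y1 \<le> x" "x \<le> t" "r x = 0" by blast
      then show False using below[of x] \<open>\<not> 0 \<le> r t\<close> by (cases "x = t") auto
    qed
    then have "0 \<le> r x" if "y1 \<le> x" "x \<le> t" for x
      using below[OF that(1)] that(2) by (cases "x = t") auto
    then have "r y1 \<le> r t" using t(1) by (intro mono) (auto simp: S_def)
    then show False using t(1) y1(2) by (auto simp: S_def)
  qed
  have "r y1 \<le> r s" if "y1 \<le> s" for s
    by (rule mono[OF that]) (use all_pos in \<open>auto intro: less_imp_le\<close>)
  moreover have "integrable halfline (\<lambda>s. s powr m * (r s)\<^sup>2)" using sol by (simp add: ode_solution_def)
  ultimately show False using not_integrable_increasing[OF m _ y1(2,1)] by blast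
qed

lemma ode_solution_pos_False:
  assumes sol: "ode_solution c m V r H" and V: "AE s in halfline. 0 \<le> V s" and m: "-1 < m"
    and y0: "0 < y0" "0 < r y0"
  shows False
proof -
  have d: "(r has_real_derivative y powr (- c) * H y) (at y)" if "0 < y" for y
    using sol that unfolding ode_solution_def by blast
  have I: "integrable halfline (\<lambda>s. indicator {0..y} s * ((1 + V s) * s powr m * r s))"
    and H: "H y = (LINT s|halfline. indicator {0..y} s * ((1 + V s) * s powr m * r s))" if "0 < y" for y
    using sol that by (simp_all add: ode_solution_def)
  have opp: "r y * H y \<le> 0" if y: "0 < y" for y
  proof (rule ccontr)
    assume "\<not> r y * H y \<le> 0"
    then consider "0 < r y" "0 < H y" | "0 < - r y" "0 < - H y"
      by (auto simp: not_le zero_less_mult_iff)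
    then show False
      using ode_solution_same_sign_False[OF sol V m y] ode_solution_same_sign_False[OF ode_solution_uminus[OF sol] V m y]
      by cases auto
  qed
  have sq: "(r y0)\<^sup>2 \<le> (r s)\<^sup>2" if s: "0 < s" "s \<le> y0" for s
  proof (rule DERIV_nonpos_imp_nonincreasing[OF s(2)])
    fix x assume "s \<le> x" "x \<le> y0"
    then have x: "0 < x" using s by simp
    have "((\<lambda>y. (r y)\<^sup>2) has_real_derivative 2 * (r x * H x) * x powr (- c)) (at x)"
      using d[OF x] by (auto intro!: derivative_eq_intros)
    moreover have "2 * (r x * H x) \<le> 0" using opp[OF x] by linarith
    then have "2 * (r x * H x) * x powr (- c) \<le> 0" by (rule mult_nonpos_nonneg) simp
    ultimately show "\<exists>y. ((\<lambda>y. (r y)\<^sup>2) has_real_derivative y) (at x) \<and> y \<le> 0" by blast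
  qed
  \<comment> \<open>By \<open>sq\<close> the square of r stays at least its value at y0 towards 0,
    so r has no zero there and the intermediate value theorem preserves its sign.\<close>
  have pos: "0 < r s" if s: "0 < s" "s \<le> y0" for s
  proof (rule ccontr)
    assume "\<not> 0 < r s"
    moreover have "continuous_on {s..y0} r"
      using DERIV_isCont[OF d] s by (intro continuous_at_imp_continuous_on) auto
    ultimately obtain x where "s \<le> x" "x \<le> y0" "r x = 0"
      using IVT'[of r s 0 y0] s y0 by auto
    then show False using sq[of x] s y0 by auto
  qed
  let ?F = "\<lambda>s. indicator {0..y0} s * ((1 + V s) * s powr m * r s)"
  have nn: "AE s in halfline. 0 \<le> ?F s"
    using V AE_halfline_positive
    by eventually_elim (use pos in \<open>auto simp: indicator_def intro!: mult_nonneg_nonneg less_imp_le\<close>)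
  have "0 \<le> H y0" unfolding H[OF y0(1)] by (rule integral_nonneg_AE[OF nn])
  \<comment> \<open>A vanishing integral would force the nonnegative integrand to vanish almost
    everywhere, but it is positive on the whole interval because 1 + V \<ge> 1.\<close>
  moreover have "H y0 \<noteq> 0"
  proof
    assume "H y0 = 0"
    then have "AE s in halfline. ?F s = 0"
      using integral_nonneg_eq_0_iff_AE[OF I[OF y0(1)] nn] H[OF y0(1)] by simp
    then have "AE s in lebesgue. s \<notin> {0<..<y0}"
      using V unfolding AE_halfline_iff
    proof eventually_elim
      case (elim s)
      show ?case
      proof
        assume s: "s \<in> {0<..<y0}"
        then have "0 < (1 + V s) * s powr m * r s"
          using elim(2) pos[of s] by (intro mult_pos_pos) auto
        then show False using elim(1) s by auto
      qed
    qed
    then have "{0<..<y0} \<in> null_sets lebesgue"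
      by (rule AE_iff_null_sets[THEN iffD2, rotated]) simp
    then have "negligible (box 0 y0)" by (simp only: negligible_iff_null_sets box_real)
    then have "box 0 y0 = {}" by (simp only: negligible_interval)
    moreover have "y0 / 2 \<in> box 0 y0" using y0(1) by simp
    ultimately show False by blast
  qed
  ultimately have "0 < r y0 * H y0" using y0 by simp
  then show False using opp[OF y0(1)] by simp
qed

lemma ode_solution_eq_0:
  assumes sol: "ode_solution c m V r H" and V: "AE s in halfline. 0 \<le> V s" and m: "-1 < m" and y: "0 < y"
  shows "r y = 0"
  using ode_solution_pos_False[OF sol V m y] ode_solution_pos_False[OF ode_solution_uminus[OF sol] V m y]
  by (cases "r y" "0 :: real" rule: linorder_cases) auto

section \<open>Cumulative integrals and integration by parts\<close>

lemma sigma_finite_halfline: "sigma_finite_measure halfline"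
proof (rule sigma_finite_measure_restrict_space)
  obtain A :: "real set set" where "countable A" "A \<subseteq> sets lborel" "\<Union>A = space lborel" "\<forall>a\<in>A. emeasure lborel a \<noteq> \<infinity>"
    using lborel.sigma_finite_countable by blast
  then show "sigma_finite_measure (lebesgue :: real measure)"
    by (intro sigma_finite_measure.intro exI[of _ A]) auto
qed simp

lemma tail_integral_of_derivative:
  fixes \<psi> U :: "real \<Rightarrow> complex"
  assumes \<psi>: "\<psi> \<in> test_functions" and d: "\<And>y. 0 < y \<Longrightarrow> (U has_vector_derivative \<psi> y) (at y)"
    and b: "\<And>y. b \<le> y \<Longrightarrow> \<psi> y = 0" "\<And>y. b \<le> y \<Longrightarrow> U y = 0" and y: "0 < y"
  shows "(LINT s|halfline. indicator {y..} s *\<^sub>R \<psi> s) = - U y"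
proof (cases "b \<le> y")
  case True
  then have "(LINT s|halfline. indicator {y..} s *\<^sub>R \<psi> s) = (LINT s|halfline. 0)"
    by (intro Bochner_Integration.integral_cong) (auto simp: indicator_def b(1))
  then show ?thesis using True b(2) by simp
next
  case False
  have cont: "continuous_on {0<..} \<psi>"
    using \<psi> by (intro smooth_on_imp_continuous_on) (simp add: test_functions_def)
  have "(LINT s|halfline. indicator {y..} s *\<^sub>R \<psi> s) = (LINT s|lebesgue. indicator {0<..} s *\<^sub>R (indicator {y..} s *\<^sub>R \<psi> s))"
    by (rule integral_restrict_space) simp
  also have "\<dots> = (LINT s:{y..b}|lebesgue. \<psi> s)"
    unfolding set_lebesgue_integral_def
    by (rule Bochner_Integration.integral_cong) (use y b in \<open>auto simp: indicator_def\<close>)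
  also have "\<dots> = integral {y..b} \<psi>"
    by (rule set_lebesgue_integral_eq_integral(2)[OF locally_integrableD[OF continuous_on_locally_integrable[OF cont] y]])
  also have "\<dots> = U b - U y"
    by (intro integral_unique fundamental_theorem_of_calculus)
      (use False y d in \<open>auto intro: has_vector_derivative_at_within\<close>)
  finally show ?thesis using b(2)[of b] by simp
qed

text \<open>U vanishes beyond b, so U y is minus the integral of \<psi> over the tail from y;
  exchanging integrals over the triangle y \<le> s gives the claim. Fubini replaces the product rule
  because k is merely integrable, so its cumulative integral may fail to be differentiable at some
  points.\<close>

lemma integral_cumulative_by_parts:
  fixes k \<psi> U :: "real \<Rightarrow> complex"
  assumes k [measurable]: "k \<in> borel_measurable halfline"
    and kint: "\<And>b. integrable halfline (\<lambda>s. indicator {0..b} s *\<^sub>R k s)"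
    and \<psi>: "\<psi> \<in> test_functions" and d: "\<And>y. 0 < y \<Longrightarrow> (U has_vector_derivative \<psi> y) (at y)"
    and b: "\<And>y. b \<le> y \<Longrightarrow> \<psi> y = 0" "\<And>y. b \<le> y \<Longrightarrow> U y = 0"
  shows "(LINT y|halfline. k y * U y) = - (LINT s|halfline. (LINT y|halfline. indicator {0..s} y *\<^sub>R k y) * \<psi> s)"
proof -
  interpret sigma_finite_measure halfline by (rule sigma_finite_halfline)
  interpret pair_sigma_finite halfline halfline ..
  have one: "locally_integrable (\<lambda>_. 1)" by (intro continuous_on_locally_integrable continuous_intros)
  have \<psi>int: "integrable halfline \<psi>" using integrable_mult_test_function[OF one \<psi>] by simp
  then have [measurable]: "\<psi> \<in> borel_measurable halfline" by (rule borel_measurable_integrable)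
  define f where "f p = (if fst p \<le> snd p then k (fst p) * \<psi> (snd p) else 0)" for p :: "real \<times> real"
  have fm [measurable]: "f \<in> borel_measurable (halfline \<Otimes>\<^sub>M halfline)"
  proof -
    have 1: "fst \<in> borel_measurable (halfline \<Otimes>\<^sub>M halfline)" "snd \<in> borel_measurable (halfline \<Otimes>\<^sub>M halfline)"
      using measurable_compose[OF measurable_fst borel_measurable_id_halfline, of halfline]
        measurable_compose[OF measurable_snd borel_measurable_id_halfline, of halfline] by simp_all
    have 2: "(\<lambda>p. k (fst p) * \<psi> (snd p)) \<in> borel_measurable (halfline \<Otimes>\<^sub>M halfline)" by measurable
    show ?thesis
      unfolding f_def[abs_def] by (intro measurable_If 2 borel_measurable_const) (use 1 in measurable)
  qed
  define C where "C = (LINT s|halfline. norm (\<psi> s))"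
  have inner_int: "integrable halfline (\<lambda>s. f (y, s))" for y
  proof (rule Bochner_Integration.integrable_bound)
    show "integrable halfline (\<lambda>s. norm (k y) * norm (\<psi> s))" using \<psi>int by simp
    show "(\<lambda>s. f (y, s)) \<in> borel_measurable halfline"
    proof -
      have "(\<lambda>s. f (y, s)) = (\<lambda>s. indicator {y..} s *\<^sub>R (k y * \<psi> s))"
        by (auto simp: f_def indicator_def)
      moreover have "(\<lambda>s. indicator {y..} s *\<^sub>R (k y * \<psi> s)) \<in> borel_measurable halfline" by measurable
      ultimately show ?thesis by simp
    qed
    show "AE s in halfline. norm (f (y, s)) \<le> norm (norm (k y) * norm (\<psi> s))"
      by (auto simp: f_def norm_mult)
  qed
  have "integrable (halfline \<Otimes>\<^sub>M halfline) f"
  proof (rule Fubini_integrable[OF fm])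
    show "AE y in halfline. integrable halfline (\<lambda>s. f (y, s))" using inner_int by simp
    \<comment> \<open>The inner integral is at most C times the modulus of k, and it vanishes for y
      > b because \<psi> does; so integrability of k down to 0 on bounded intervals is
      enough.\<close>
    show "integrable halfline (\<lambda>y. LINT s|halfline. norm (f (y, s)))"
    proof (rule Bochner_Integration.integrable_bound)
      show "integrable halfline (\<lambda>y. C * norm (indicator {0..b} y *\<^sub>R k y))"
        by (intro integrable_mult_right integrable_norm kint)
      show "(\<lambda>y. LINT s|halfline. norm (f (y, s))) \<in> borel_measurable halfline" by measurable
      show "AE y in halfline. norm (LINT s|halfline. norm (f (y, s))) \<le> norm (C * norm (indicator {0..b} y *\<^sub>R k y))"
        using AE_halfline_positive
      proof eventually_elim
        case (elim y)
        have nn: "0 \<le> (LINT s|halfline. norm (f (y, s)))" "0 \<le> C"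
          unfolding C_def by (intro integral_nonneg_AE; simp)+
        have "(LINT s|halfline. norm (f (y, s))) \<le> C * norm (indicator {0..b} y *\<^sub>R k y)"
        proof (cases "y \<le> b")
          case True
          have "(LINT s|halfline. norm (f (y, s))) \<le> (LINT s|halfline. norm (k y) * norm (\<psi> s))"
            by (rule integral_mono) (use inner_int \<psi>int in \<open>auto simp: f_def norm_mult\<close>)
          then show ?thesis using True elim by (simp add: C_def mult.commute)
        next
          case False
          have "f (y, s) = 0" for s using False b(1)[of s] by (auto simp: f_def)
          then show ?thesis using nn by simp
        qed
        then show ?case using nn by simp
      qed
    qed
  qed
  then have "(LINT s|halfline. LINT y|halfline. f (y, s)) = (LINT y|halfline. LINT s|halfline. f (y, s))"
    using Fubini_integral[of "\<lambda>y s. f (y, s)"] by simp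
  also have "\<dots> = (LINT y|halfline. - (k y * U y))"
  proof (rule Bochner_Integration.integral_cong[OF refl])
    fix y assume "y \<in> space halfline"
    then have y: "0 < y" by simp
    have "(LINT s|halfline. f (y, s)) = (LINT s|halfline. k y * (indicator {y..} s *\<^sub>R \<psi> s))"
      by (intro Bochner_Integration.integral_cong) (auto simp: f_def indicator_def)
    also have "\<dots> = k y * (LINT s|halfline. indicator {y..} s *\<^sub>R \<psi> s)" by (rule integral_mult_right_zero)
    also have "(LINT s|halfline. indicator {y..} s *\<^sub>R \<psi> s) = - U y"
      by (rule tail_integral_of_derivative[where b = b]) (use \<psi> d b y in auto)
    finally show "(LINT s|halfline. f (y, s)) = - (k y * U y)" by simp
  qed
  also have "(LINT s|halfline. LINT y|halfline. f (y, s)) = (LINT s|halfline. (LINT y|halfline. indicator {0..s} y *\<^sub>R k y) * \<psi> s)"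
  proof (rule Bochner_Integration.integral_cong[OF refl])
    fix s
    have "(LINT y|halfline. f (y, s)) = (LINT y|halfline. (indicator {0..s} y *\<^sub>R k y) * \<psi> s)"
      by (intro Bochner_Integration.integral_cong) (auto simp: f_def indicator_def)
    also have "\<dots> = (LINT y|halfline. indicator {0..s} y *\<^sub>R k y) * \<psi> s" by (rule integral_mult_left_zero)
    finally show "(LINT y|halfline. f (y, s)) = (LINT y|halfline. indicator {0..s} y *\<^sub>R k y) * \<psi> s" .
  qed
  finally show ?thesis by simp
qed

lemma continuous_on_cumulative:
  fixes k :: "real \<Rightarrow> complex"
  assumes kint: "\<And>b. integrable halfline (\<lambda>s. indicator {0..b} s *\<^sub>R k s)"
  shows "continuous_on {0<..} (\<lambda>y. LINT s|halfline. indicator {0..y} s *\<^sub>R k s)"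
proof -
  define k0 where "k0 s = indicator {0<..} s *\<^sub>R k s" for s
  have int: "set_integrable lebesgue {0..y} k0" for y
  proof -
    have "integrable lebesgue (\<lambda>s. indicator {0<..} s *\<^sub>R (indicator {0..y} s *\<^sub>R k s))"
      using kint[of y] by (subst (asm) integrable_restrict_space) auto
    also have "(\<lambda>s. indicator {0<..} s *\<^sub>R (indicator {0..y} s *\<^sub>R k s)) = (\<lambda>s. indicator {0..y} s *\<^sub>R k0 s)"
      by (auto simp: k0_def indicator_def)
    finally show ?thesis by (simp add: set_integrable_def)
  qed
  have eq: "(LINT s|halfline. indicator {0..y} s *\<^sub>R k s) = integral {0..y} k0" for y
  proof -
    have "(LINT s|halfline. indicator {0..y} s *\<^sub>R k s) = (LINT s|lebesgue. indicator {0<..} s *\<^sub>R (indicator {0..y} s *\<^sub>R k s))"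
      by (rule integral_restrict_space) simp
    also have "\<dots> = (LINT s:{0..y}|lebesgue. k0 s)"
      unfolding set_lebesgue_integral_def by (rule Bochner_Integration.integral_cong) (auto simp: k0_def indicator_def)
    finally show ?thesis using set_lebesgue_integral_eq_integral(2)[OF int] by simp
  qed
  have "continuous (at y) (\<lambda>y. integral {0..y} k0)" if "0 < y" for y
  proof -
    have "continuous_on {0..y + 1} (\<lambda>y. integral {0..y} k0)"
      by (rule indefinite_integral_continuous_1[OF set_lebesgue_integral_eq_integral(1)[OF int]])
    then have "continuous_on {0<..<y + 1} (\<lambda>y. integral {0..y} k0)"
      by (rule continuous_on_subset) auto
    then show ?thesis using that by (subst (asm) continuous_on_eq_continuous_at) auto
  qed
  then show ?thesis unfolding eq by (intro continuous_at_imp_continuous_on) auto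
qed

lemma antiderivative_on_halfline:
  fixes w :: "real \<Rightarrow> complex"
  assumes "continuous_on {0<..} w"
  obtains G where "\<And>y. 0 < y \<Longrightarrow> (G has_vector_derivative w y) (at y)"
proof -
  have "\<exists>F. \<forall>x::real. ereal 0 < ereal x \<longrightarrow> ereal x < \<infinity> \<longrightarrow> (F has_vector_derivative w x) (at x)"
  proof (rule einterval_antiderivative)
    fix x assume "ereal 0 < ereal x"
    then show "isCont w x" using assms by (simp add: continuous_on_eq_continuous_at)
  qed simp
  then show ?thesis using that by auto
qed

lemma integrable_powr_from_0:
  assumes "-1 < m"
  shows "integrable halfline (\<lambda>y. y powr m * indicator {0..b} y)"
proof (cases "0 \<le> b")
  case True
  have "(\<lambda>y. y powr m) integrable_on {0..b}" by (rule integrable_on_powr_from_0[OF assms True])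
  then have "(\<lambda>y. y powr m) absolutely_integrable_on {0..b}"
    by (intro nonnegative_absolutely_integrable_1) auto
  then have "integrable lebesgue (\<lambda>y. indicator {0..b} y *\<^sub>R (y powr m))" by (simp add: set_integrable_def)
  also have "(\<lambda>y. indicator {0..b} y *\<^sub>R (y powr m)) = (\<lambda>y. indicator {0<..} y *\<^sub>R (y powr m * indicator {0..b} y))"
    by (rule ext) (auto simp: indicator_def)
  finally show ?thesis by (subst integrable_restrict_space) auto
next
  case False
  then show ?thesis by simp
qed

section \<open>Functions that are constant near zero\<close>

lemma core_functions_lincomb:
  assumes "u \<in> core_functions" "v \<in> core_functions"
  shows "(\<lambda>y. a * u y + b * v y) \<in> core_functions"
proof -
  obtain b1 e1 k1 where 1: "smooth_on {0..} u" "\<And>y. b1 \<le> y \<Longrightarrow> u y = 0" "0 < e1" "\<And>y. y \<in> {0..<e1} \<Longrightarrow> u y = k1"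
    using assms(1) unfolding core_functions_def by blast
  obtain b2 e2 k2 where 2: "smooth_on {0..} v" "\<And>y. b2 \<le> y \<Longrightarrow> v y = 0" "0 < e2" "\<And>y. y \<in> {0..<e2} \<Longrightarrow> v y = k2"
    using assms(2) unfolding core_functions_def by blast
  have "smooth_on {0..} (\<lambda>y. a * u y + b * v y)"
    by (intro smooth_on_add smooth_on_mult smooth_on_const 1 2)
  moreover have "\<forall>y\<ge>max b1 b2. a * u y + b * v y = 0" using 1(2) 2(2) by simp
  moreover have "\<forall>y\<in>{0..<min e1 e2}. a * u y + b * v y = a * k1 + b * k2"
    using 1(4) 2(4) by simp
  moreover have "0 < min e1 e2" using 1(3) 2(3) by simp
  ultimately show ?thesis unfolding core_functions_def by blast
qed

lemma core_function_deriv: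
  assumes u: "u \<in> core_functions"
  obtains \<psi> where "\<psi> \<in> test_functions" "\<And>y. 0 < y \<Longrightarrow> (u has_vector_derivative \<psi> y) (at y)"
proof -
  obtain b e k where 1: "smooth_on {0..} u" "\<And>y. b \<le> y \<Longrightarrow> u y = 0" "0 < e" "\<And>y. y \<in> {0..<e} \<Longrightarrow> u y = k"
    using u unfolding core_functions_def by blast
  have sm: "smooth_on {0<..} u" by (rule smooth_on_subset[OF 1(1)]) auto
  have zero: "vector_derivative u (at y) = 0" if y: "0 < y" "y \<notin> {e..b}" for y
  proof (cases "y < e")
    case True
    have "(u has_vector_derivative 0) (at y)"
      by (rule has_vector_derivative_locally_const[of "{0<..<e}" _ _ k]) (use y True 1(4) in auto)
    then show ?thesis by (rule vector_derivative_at)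
  next
    case False
    have "(u has_vector_derivative 0) (at y)"
      by (rule has_vector_derivative_locally_const[of "{b<..}" _ _ 0]) (use y False 1(2) in auto)
    then show ?thesis by (rule vector_derivative_at)
  qed
  have "(\<lambda>y. vector_derivative u (at y)) \<in> test_functions"
    by (rule test_functionI[OF smooth_on_deriv(2)[OF sm] 1(3) zero])
  then show ?thesis using that smooth_on_deriv(1)[OF sm] by blast
qed

text \<open>The primitive is normalized to vanish at infinity, which leaves the constant - \<Phi> b
  near 0. Every test function therefore occurs as a derivative, with no condition on its integral;
  this is the freedom that a test function u would not have.\<close>

lemma core_function_of_deriv:
  assumes \<psi>: "\<psi> \<in> test_functions"
  obtains u b where "u \<in> core_functions" "\<And>y. 0 < y \<Longrightarrow> (u has_vector_derivative \<psi> y) (at y)" "0 < b"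
    "\<And>y. b \<le> y \<Longrightarrow> \<psi> y = 0" "\<And>y. b \<le> y \<Longrightarrow> u y = 0"
proof -
  obtain \<Phi> a b where \<Phi>: "0 < a" "a < b" "smooth_on UNIV \<Phi>" "\<And>y. y < a \<Longrightarrow> \<Phi> y = 0"
    "\<And>y. 0 < y \<Longrightarrow> (\<Phi> has_vector_derivative \<psi> y) (at y)" "\<And>y. b \<le> y \<Longrightarrow> \<Phi> y = \<Phi> b"
    "\<And>y. 0 < y \<Longrightarrow> y \<notin> {a..b} \<Longrightarrow> \<psi> y = 0"
    by (rule test_function_antiderivative[OF \<psi>]) blast
  define u where "u y = \<Phi> y + (- \<Phi> b)" for y
  show ?thesis
  \<comment> \<open>Not b, since \<psi> is only known to vanish strictly beyond b.\<close>
  proof (rule that[of u "b + 1"])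
    have "smooth_on {0..} u"
      unfolding u_def[abs_def] by (intro smooth_on_add smooth_on_const smooth_on_subset[OF \<Phi>(3)]) auto
    moreover have "\<forall>y\<ge>b. u y = 0"
    proof (intro allI impI)
      fix y assume "b \<le> y"
      from \<Phi>(6)[OF this] show "u y = 0" unfolding u_def by simp
    qed
    moreover have "\<forall>y\<in>{0..<a}. u y = - \<Phi> b" unfolding u_def using \<Phi>(4) by simp
    ultimately show "u \<in> core_functions" unfolding core_functions_def using \<Phi>(1) by blast
    show "u y = 0" if "b + 1 \<le> y" for y using \<open>\<forall>y\<ge>b. u y = 0\<close> that by simp
    show "\<psi> y = 0" if "b + 1 \<le> y" for y using \<Phi>(1,2) that by (intro \<Phi>(7)) auto
    show "(u has_vector_derivative \<psi> y) (at y)" if "0 < y" for y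
      using has_vector_derivative_add[OF \<Phi>(5)[OF that] has_vector_derivative_const[of "- \<Phi> b"]]
      by (simp add: u_def[abs_def])
  qed (use \<Phi> in auto)
qed

lemma core_function_bounds:
  assumes u: "u \<in> core_functions"
  obtains C b where "\<And>y. 0 < y \<Longrightarrow> cmod (u y) \<le> C" "\<And>y. b < y \<Longrightarrow> u y = 0" "u \<in> borel_measurable halfline"
proof -
  obtain b where 1: "smooth_on {0..} u" "\<And>y. b \<le> y \<Longrightarrow> u y = 0"
    using u unfolding core_functions_def by blast
  have "continuous_on {0..b} u"
    by (rule continuous_on_subset[OF smooth_on_imp_continuous_on[OF 1(1)]]) auto
  then have "bounded (u ` {0..b})" by (intro compact_imp_bounded compact_continuous_image) auto
  then obtain C where C: "\<And>y. y \<in> {0..b} \<Longrightarrow> cmod (u y) \<le> C" unfolding bounded_iff by blast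
  have "cmod (u y) \<le> max C 0" if "0 < y" for y
    using C[of y] 1(2)[of y] that by (cases "y \<le> b") auto
  moreover have "u \<in> borel_measurable halfline"
    by (rule smooth_on_measurable[OF smooth_on_subset[OF 1(1)]]) auto
  ultimately show ?thesis using that[of "max C 0" b] 1(2) by force
qed

section \<open>The core property for a locally square integrable potential\<close>

locale weighted_form_L2 = weighted_form +
  assumes V_loc_L2: "V \<in> Lq_loc 2 (c - \<alpha>)"
begin

lemma V_square_integrable: "integrable halfline (\<lambda>y. y powr (c - \<alpha>) * (indicator {0..b} y * (V y)\<^sup>2))"
proof -
  have pw: "\<bar>x\<bar> powr 2 = x\<^sup>2" for x :: real
    using powr_numeral[of "\<bar>x\<bar>" "Num.Bit0 Num.One"] by simp
  have "integrable \<mu> (\<lambda>y. indicator {0..max b 1} y * (V y)\<^sup>2)"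
    using V_loc_L2 unfolding Lq_loc_def set_integrable_def by (auto dest: spec[of _ "max b 1"] simp: pw)
  then have "integrable halfline (\<lambda>y. y powr (c - \<alpha>) * (indicator {0..max b 1} y * (V y)\<^sup>2))"
    by (subst (asm) integrable_wmeas) auto
  then show ?thesis
    by (rule Bochner_Integration.integrable_bound) (measurable, auto simp: indicator_def)
qed

text \<open>The place where square integrability of V down to 0 puts the core functions into the
  domain: near 0 such a function is a constant, and V u is there a multiple of V.\<close>

lemma V_mult_L2:
  assumes \<phi>: "\<phi> \<in> borel_measurable halfline"
    and C: "\<And>y. 0 < y \<Longrightarrow> cmod (\<phi> y) \<le> C" and b: "\<And>y. b < y \<Longrightarrow> \<phi> y = 0"
  shows "(\<lambda>y. of_real (V y) * \<phi> y) \<in> L2 \<mu>"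
proof (rule bounded_support_mult_L2[OF _ \<phi> V_square_integrable _ _ C])
  show "\<phi> y = 0" if "0 < y" "y \<notin> {0..b}" for y using that by (intro b) simp
  show "(\<lambda>y. complex_of_real (V y)) \<in> borel_measurable halfline" "(\<lambda>y. (V y)\<^sup>2) \<in> borel_measurable halfline"
    by measurable
qed simp_all

lemma bounded_support_L2:
  assumes \<phi>: "\<phi> \<in> borel_measurable halfline"
    and C: "\<And>y. 0 < y \<Longrightarrow> cmod (\<phi> y) \<le> C" and b: "\<And>y. b < y \<Longrightarrow> \<phi> y = 0"
  shows "\<phi> \<in> L2 \<mu>"
proof -
  have int: "integrable halfline (\<lambda>y. y powr (c - \<alpha>) * (indicator {0..b} y * 1))"
    using integrable_powr_from_0[of "c - \<alpha>" b] weight by simp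
  have "(\<lambda>y. 1 * \<phi> y) \<in> L2 \<mu>"
    by (rule bounded_support_mult_L2[OF _ \<phi> int _ _ C]) (use b in auto)
  then show ?thesis by simp
qed

text \<open>The expression y^\<alpha> (u'' + (c / y) u') - V u in divergence form, y^(\<alpha> - c)
  (y^c u')' - V u, with \<eta> playing the role of y^c u'.\<close>

definition core_image :: "(real \<Rightarrow> complex) \<Rightarrow> (real \<Rightarrow> complex) \<Rightarrow> real \<Rightarrow> complex" where
  "core_image u \<eta> y = of_real (y powr (\<alpha> - c)) * vector_derivative \<eta> (at y) - of_real (V y) * u y"

text \<open>Since \<eta> = y^c u' is a test function, integrating the form by parts is nothing but
  the definition of the weak derivative of v. No boundary term at 0 can arise, although nothing is
  known about v there.\<close>

lemma core_neumann:
  assumes u: "u \<in> core_functions" and \<eta>: "\<eta> \<in> test_functions"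
    and d: "\<And>y. 0 < y \<Longrightarrow> (u has_vector_derivative of_real (y powr (- c)) * \<eta> y) (at y)"
  shows "(u, core_image u \<eta>) \<in> neumann_op \<alpha> c V" and "u \<in> L2 \<mu>" and "core_image u \<eta> \<in> L2 \<mu>"
proof -
  obtain C b where bd: "\<And>y. 0 < y \<Longrightarrow> cmod (u y) \<le> C" "\<And>y. b < y \<Longrightarrow> u y = 0" and um: "u \<in> borel_measurable halfline"
    by (rule core_function_bounds[OF u]) blast
  define w where "w y = of_real (y powr (- c)) * \<eta> y" for y
  have w: "w \<in> test_functions" unfolding w_def[abs_def] by (intro test_function_mult \<eta> smooth_on_powr)
  have "continuous_on {0<..} w"
    using w by (intro smooth_on_imp_continuous_on) (simp add: test_functions_def)
  then have wd: "has_weak_deriv u w"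
    by (rule has_weak_deriv_C1[rotated]) (use d in \<open>simp add: w_def\<close>)
  show uL: "u \<in> L2 \<mu>" by (rule bounded_support_L2[OF um bd])
  have wL: "w \<in> L2 (wmeas c)" by (rule test_function_L2[OF w])
  have ud: "u \<in> fdom" by (rule domI[OF uL wd wL rtV_mult_L2[OF um bd]])
  define \<eta>' where "\<eta>' y = vector_derivative \<eta> (at y)" for y
  have \<eta>': "\<eta>' \<in> test_functions" unfolding \<eta>'_def[abs_def] by (rule test_function_deriv[OF \<eta>])
  have t: "(\<lambda>y. of_real (y powr (\<alpha> - c)) * \<eta>' y) \<in> test_functions" by (intro test_function_mult \<eta>' smooth_on_powr)
  note tL = test_function_L2[OF t, of "c - \<alpha>"]
  have VL: "(\<lambda>y. of_real (V y) * u y) \<in> L2 \<mu>" by (rule V_mult_L2[OF um bd])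
  have A: "core_image u \<eta> = (\<lambda>y. of_real (y powr (\<alpha> - c)) * \<eta>' y - of_real (V y) * u y)"
    by (simp add: core_image_def[abs_def] \<eta>'_def)
  show AL: "core_image u \<eta> \<in> L2 \<mu>" unfolding A by (rule L2_diff[OF tL VL])
  have "form \<alpha> c V u v = (LINT y|\<mu>. - core_image u \<eta> y * cnj (v y))" if v: "v \<in> fdom" for v
  proof -
    note L = domD[OF v]
    have m: "wderiv v \<in> borel_measurable halfline" "v \<in> borel_measurable halfline" "w \<in> borel_measurable halfline"
      "wderiv u \<in> borel_measurable halfline" "\<eta>' \<in> borel_measurable halfline"
      using L2_measurable[OF L(3)] L2_measurable[OF L(1)] L2_measurable[OF wL] L2_measurable[OF domD(3)[OF ud]]
        L2_measurable[OF test_function_L2[OF \<eta>', of c]] by auto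
    note [measurable] = m
    note [measurable] = measurable_compose[OF m(1) borel_measurable_cnj] measurable_compose[OF m(2) borel_measurable_cnj]
    have ae: "AE y in halfline. wderiv u y = w y" by (rule wderiv_AE_eq[OF wd])
    have pow: "complex_of_real (y powr c) * of_real (y powr (- c)) = 1"
      "complex_of_real (y powr (c - \<alpha>)) * of_real (y powr (\<alpha> - c)) = 1" if "0 < y" for y
      using that by (simp_all add: powr_add[symmetric] flip: of_real_mult)
    have "(LINT y|wmeas c. wderiv u y * cnj (wderiv v y)) = (LINT y|wmeas c. w y * cnj (wderiv v y))"
      by (rule integral_cong_AE) (simp_all, measurable, use ae in \<open>unfold AE_wmeas_iff, eventually_elim, simp\<close>)
    also have "\<dots> = (LINT y|halfline. y powr c *\<^sub>R (w y * cnj (wderiv v y)))" by (rule integral_wmeas) measurable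
    also have "\<dots> = (LINT y|halfline. cnj (wderiv v y * cnj (\<eta> y)))"
    proof (rule Bochner_Integration.integral_cong[OF refl])
      fix y assume "y \<in> space halfline"
      then show "y powr c *\<^sub>R (w y * cnj (wderiv v y)) = cnj (wderiv v y * cnj (\<eta> y))"
        using pow(1)[of y] by (simp add: w_def scaleR_conv_of_real mult.assoc[symmetric])
    qed
    also have "\<dots> = cnj (LINT y|halfline. wderiv v y * cnj (\<eta> y))" by (rule Bochner_Integration.integral_cnj)
    also have "(LINT y|halfline. wderiv v y * cnj (\<eta> y)) = - (LINT y|halfline. v y * vector_derivative (\<lambda>y. cnj (\<eta> y)) (at y))"
      using L(2) test_function_cnj[OF \<eta>] by (simp add: has_weak_deriv_iff)
    also have "(LINT y|halfline. v y * vector_derivative (\<lambda>y. cnj (\<eta> y)) (at y)) = (LINT y|halfline. v y * cnj (\<eta>' y))"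
    proof (rule Bochner_Integration.integral_cong[OF refl])
      fix y assume "y \<in> space halfline"
      then have "(\<eta> has_vector_derivative \<eta>' y) (at y)"
        unfolding \<eta>'_def using \<eta> by (intro smooth_on_deriv) (auto simp: test_functions_def)
      then have "((\<lambda>y. cnj (\<eta> y)) has_vector_derivative cnj (\<eta>' y)) (at y)" by (rule has_vector_derivative_cnj)
      then show "v y * vector_derivative (\<lambda>y. cnj (\<eta> y)) (at y) = v y * cnj (\<eta>' y)"
        by (simp add: vector_derivative_at)
    qed
    also have "cnj (- (LINT y|halfline. v y * cnj (\<eta>' y))) = - (LINT y|halfline. cnj (v y * cnj (\<eta>' y)))"
      by (simp only: Bochner_Integration.integral_cnj complex_cnj_minus)
    also have "(LINT y|halfline. cnj (v y * cnj (\<eta>' y))) = (LINT y|halfline. y powr (c - \<alpha>) *\<^sub>R ((of_real (y powr (\<alpha> - c)) * \<eta>' y) * cnj (v y)))"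
    proof (rule Bochner_Integration.integral_cong[OF refl])
      fix y assume "y \<in> space halfline"
      then have p: "complex_of_real (y powr (c - \<alpha>)) * of_real (y powr (\<alpha> - c)) = 1" by (intro pow) simp
      have "X * ((Y * p) * q) = (X * Y) * (q * p)" for X Y p q :: complex by (simp add: mult_ac)
      then show "cnj (v y * cnj (\<eta>' y)) = y powr (c - \<alpha>) *\<^sub>R ((of_real (y powr (\<alpha> - c)) * \<eta>' y) * cnj (v y))"
        by (simp only: complex_cnj_mult complex_cnj_cnj scaleR_conv_of_real p mult_1_left)
    qed
    also have "\<dots> = (LINT y|\<mu>. (of_real (y powr (\<alpha> - c)) * \<eta>' y) * cnj (v y))"
      by (rule integral_wmeas[symmetric]) measurable
    finally have 1: "(LINT y|wmeas c. wderiv u y * cnj (wderiv v y)) = - (LINT y|\<mu>. (of_real (y powr (\<alpha> - c)) * \<eta>' y) * cnj (v y))" .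
    have "(LINT y|\<mu>. - core_image u \<eta> y * cnj (v y))
        = (LINT y|\<mu>. (of_real (V y) * u y) * cnj (v y) - (of_real (y powr (\<alpha> - c)) * \<eta>' y) * cnj (v y))"
      by (simp add: A algebra_simps)
    also have "\<dots> = (LINT y|\<mu>. (of_real (V y) * u y) * cnj (v y)) - (LINT y|\<mu>. (of_real (y powr (\<alpha> - c)) * \<eta>' y) * cnj (v y))"
      by (intro Bochner_Integration.integral_diff L2_integrable_mult_cnj VL tL L(1))
    finally show ?thesis unfolding form_eq[OF ud v] 1 by simp
  qed
  then show "(u, core_image u \<eta>) \<in> neumann_op \<alpha> c V" using ud AL by (simp add: neumann_op_def)
qed

lemma core_in_Domain:
  assumes u: "u \<in> core_functions"
  shows "u \<in> Domain (neumann_op \<alpha> c V)"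
proof -
  obtain \<psi> where \<psi>: "\<psi> \<in> test_functions" "\<And>y. 0 < y \<Longrightarrow> (u has_vector_derivative \<psi> y) (at y)"
    by (rule core_function_deriv[OF u]) blast
  define \<eta> where "\<eta> y = of_real (y powr c) * \<psi> y" for y
  have \<eta>: "\<eta> \<in> test_functions" unfolding \<eta>_def[abs_def] by (intro test_function_mult \<psi> smooth_on_powr)
  have "(u has_vector_derivative of_real (y powr (- c)) * \<eta> y) (at y)" if "0 < y" for y
  proof -
    have "complex_of_real (y powr (- c)) * of_real (y powr c) = 1"
      using that by (simp add: powr_add[symmetric] flip: of_real_mult)
    then have "of_real (y powr (- c)) * \<eta> y = \<psi> y" by (simp add: \<eta>_def mult.assoc[symmetric])
    then show ?thesis using \<psi>(2)[OF that] by simp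
  qed
  from core_neumann(1)[OF u \<eta> this] show ?thesis by blast
qed

text \<open>The image of the core functions under 1 - A. As 1 - A has a bounded inverse, density of
  this set yields approximation in the graph norm.\<close>

definition core_residuals :: "l2h set" where
  "core_residuals = {enc (c - \<alpha>) v - enc (c - \<alpha>) h | v h. (v, h) \<in> neumann_op \<alpha> c V \<and> v \<in> core_functions}"

lemma neumann_op_L2: "(u, g) \<in> neumann_op \<alpha> c V \<Longrightarrow> u \<in> L2 \<mu>" "(u, g) \<in> neumann_op \<alpha> c V \<Longrightarrow> g \<in> L2 \<mu>"
  using domD(1) by (auto simp: neumann_op_def)

text \<open>Read off from u = R (u - g) and the complex linearity of R, which avoids computing with
  chosen weak derivatives in the form.\<close>

lemma neumann_op_lincomb:
  assumes 1: "(u, g) \<in> neumann_op \<alpha> c V" and 2: "(v, h) \<in> neumann_op \<alpha> c V"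
  shows "(\<lambda>y. a * u y + b * v y, \<lambda>y. a * g y + b * h y) \<in> neumann_op \<alpha> c V"
proof -
  note L = neumann_op_L2[OF 1] neumann_op_L2[OF 2]
  have R: "enc (c - \<alpha>) u = resolvent (enc (c - \<alpha>) u - enc (c - \<alpha>) g)" "enc (c - \<alpha>) v = resolvent (enc (c - \<alpha>) v - enc (c - \<alpha>) h)"
    using 1 2 neumann_op_iff[OF L(1,2)] neumann_op_iff[OF L(3,4)] by blast+
  have Rc: "resolvent (cscale k x) = cscale k (resolvent x)" for k x
    using R_J[of x] by (simp add: cscale_def blinfun.bilinear_simps)
  have lin: "cscale k (x - y) = cscale k x - cscale k y" for k x y
    by (simp add: cscale_def blinfun.bilinear_simps algebra_simps flip: mult_i_apply)
  have E: "enc (c - \<alpha>) (\<lambda>y. a * f y + b * f' y) = cscale a (enc (c - \<alpha>) f) + cscale b (enc (c - \<alpha>) f')"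
    if "f \<in> L2 \<mu>" "f' \<in> L2 \<mu>" for f f'
    using that by (simp add: enc_add enc_cmult_cscale L2_cmult)
  have "resolvent ((cscale a (enc (c - \<alpha>) u) + cscale b (enc (c - \<alpha>) v)) - (cscale a (enc (c - \<alpha>) g) + cscale b (enc (c - \<alpha>) h)))
      = resolvent (cscale a (enc (c - \<alpha>) u - enc (c - \<alpha>) g) + cscale b (enc (c - \<alpha>) v - enc (c - \<alpha>) h))"
    by (simp add: lin algebra_simps)
  also have "\<dots> = cscale a (resolvent (enc (c - \<alpha>) u - enc (c - \<alpha>) g)) + cscale b (resolvent (enc (c - \<alpha>) v - enc (c - \<alpha>) h))"
    by (simp only: blinfun.add_right Rc)
  also have "\<dots> = cscale a (enc (c - \<alpha>) u) + cscale b (enc (c - \<alpha>) v)" by (simp only: R[symmetric])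
  finally show ?thesis
    using L by (subst neumann_op_iff) (auto simp: E intro!: L2_add L2_cmult)
qed

lemma subspace_core_residuals: "subspace core_residuals"
proof (rule subspaceI)
  have add: "a *\<^sub>R x + b *\<^sub>R y \<in> core_residuals" if xy: "x \<in> core_residuals" "y \<in> core_residuals" for x y a b
  proof -
    obtain v h where 1: "x = enc (c - \<alpha>) v - enc (c - \<alpha>) h" "(v, h) \<in> neumann_op \<alpha> c V" "v \<in> core_functions"
      using xy(1) unfolding core_residuals_def by blast
    obtain v' h' where 2: "y = enc (c - \<alpha>) v' - enc (c - \<alpha>) h'" "(v', h') \<in> neumann_op \<alpha> c V" "v' \<in> core_functions"
      using xy(2) unfolding core_residuals_def by blast
    let ?v = "\<lambda>y. of_real a * v y + of_real b * v' y" and ?h = "\<lambda>y. of_real a * h y + of_real b * h' y"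
    have "a *\<^sub>R x + b *\<^sub>R y = enc (c - \<alpha>) ?v - enc (c - \<alpha>) ?h"
      using neumann_op_L2[OF 1(2)] neumann_op_L2[OF 2(2)]
      by (simp add: enc_add enc_scaleR L2_cmult 1(1) 2(1) algebra_simps)
    moreover have "(?v, ?h) \<in> neumann_op \<alpha> c V" by (rule neumann_op_lincomb[OF 1(2) 2(2)])
    moreover have "?v \<in> core_functions" by (rule core_functions_lincomb[OF 1(3) 2(3)])
    ultimately show ?thesis unfolding core_residuals_def by blast
  qed
  show "x + y \<in> core_residuals" if "x \<in> core_residuals" "y \<in> core_residuals" for x y
    using add[OF that, of 1 1] by simp
  show "r *\<^sub>R x \<in> core_residuals" if "x \<in> core_residuals" for r x
    using add[OF that that, of r 0] by simp
  have "(\<lambda>_. 0) \<in> core_functions"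
    unfolding core_functions_def using smooth_on_const by (auto intro: exI[of _ 1])
  then obtain h where "(\<lambda>_. 0, h) \<in> neumann_op \<alpha> c V" using core_in_Domain by blast
  with \<open>(\<lambda>_. 0) \<in> core_functions\<close> have "enc (c - \<alpha>) (\<lambda>_. 0) - enc (c - \<alpha>) h \<in> core_residuals"
    unfolding core_residuals_def by blast
  \<comment> \<open>Zero is obtained as 0 x + 0 x, so that the image h of the zero function does not
    have to be identified.\<close>
  from add[OF this this, of 0 0] show "0 \<in> core_residuals" by simp
qed

text \<open>The product of 1 + V and h is bounded by the sum of their squares, and V is square
  integrable down to 0; so the flux H may be integrated from 0.\<close>

lemma potential_integrable:
  assumes h: "h \<in> L2 \<mu>"
  shows "integrable halfline (\<lambda>s. indicator {0..b} s *\<^sub>R (of_real ((1 + V s) * s powr (c - \<alpha>)) * h s))"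
proof (rule Bochner_Integration.integrable_bound)
  have [measurable]: "h \<in> borel_measurable halfline" using L2_measurable[OF h] by simp
  have "integrable halfline (\<lambda>s. s powr (c - \<alpha>) *\<^sub>R (cmod (h s))\<^sup>2)"
    using L2_square_integrable[OF h] by (subst (asm) integrable_wmeas) auto
  then show "integrable halfline (\<lambda>s. s powr (c - \<alpha>) *\<^sub>R (cmod (h s))\<^sup>2
      + (2 * (s powr (c - \<alpha>) * indicator {0..b} s) + 2 * (s powr (c - \<alpha>) * (indicator {0..b} s * (V s)\<^sup>2))))"
    using weight by (intro Bochner_Integration.integrable_add integrable_mult_right integrable_powr_from_0 V_square_integrable) auto
  show "(\<lambda>s. indicator {0..b} s *\<^sub>R (of_real ((1 + V s) * s powr (c - \<alpha>)) * h s)) \<in> borel_measurable halfline"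
    by measurable
  show "AE s in halfline. norm (indicator {0..b} s *\<^sub>R (of_real ((1 + V s) * s powr (c - \<alpha>)) * h s))
      \<le> norm (s powr (c - \<alpha>) *\<^sub>R (cmod (h s))\<^sup>2
      + (2 * (s powr (c - \<alpha>) * indicator {0..b} s) + 2 * (s powr (c - \<alpha>) * (indicator {0..b} s * (V s)\<^sup>2))))"
  proof (rule AE_I2)
    fix s
    let ?p = "s powr (c - \<alpha>)"
    have "2 * (\<bar>1 + V s\<bar> * cmod (h s)) \<le> (1 + V s)\<^sup>2 + (cmod (h s))\<^sup>2"
      using sum_squares_bound[of "\<bar>1 + V s\<bar>" "cmod (h s)"] by simp
    moreover have "(1 + V s)\<^sup>2 \<le> 2 + 2 * (V s)\<^sup>2"
      using sum_squares_bound[of 1 "V s"] by (simp add: power2_sum)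
    moreover have "0 \<le> \<bar>1 + V s\<bar> * cmod (h s)" by simp
    ultimately have "\<bar>1 + V s\<bar> * cmod (h s) \<le> (cmod (h s))\<^sup>2 + (2 + 2 * (V s)\<^sup>2)" by linarith
    then have "?p * (\<bar>1 + V s\<bar> * cmod (h s)) \<le> ?p * ((cmod (h s))\<^sup>2 + (2 + 2 * (V s)\<^sup>2))"
      by (rule mult_left_mono) simp
    then show "norm (indicator {0..b} s *\<^sub>R (of_real ((1 + V s) * ?p) * h s))
      \<le> norm (?p *\<^sub>R (cmod (h s))\<^sup>2 + (2 * (?p * indicator {0..b} s) + 2 * (?p * (indicator {0..b} s * (V s)\<^sup>2))))"
      by (cases "s \<in> {0..b}") (auto simp: norm_mult abs_mult distrib_left mult_ac simp del: of_real_mult of_real_add)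
  qed
qed

text \<open>For a given \<phi> a core function u is built with y^c u' = cnj \<phi>. Orthogonality to
  u - A u then equates the integrals of k cnj u and of h \<phi>', where k = (1 + V) y^(c - \<alpha>)
  h; moving the derivative off u by \<open>integral_cumulative_by_parts\<close> turns the former
  into minus the integral of y^(-c) H \<phi>.\<close>

lemma orthogonal_weak_deriv:
  assumes h: "h \<in> L2 \<mu>"
    and orth: "\<And>u g. (u, g) \<in> neumann_op \<alpha> c V \<Longrightarrow> u \<in> core_functions \<Longrightarrow> (LINT y|\<mu>. h y * cnj (u y - g y)) = 0"
  defines "H \<equiv> \<lambda>y. LINT s|halfline. indicator {0..y} s *\<^sub>R (of_real ((1 + V s) * s powr (c - \<alpha>)) * h s)"
  shows "has_weak_deriv h (\<lambda>y. of_real (y powr (- c)) * H y)" and "continuous_on {0<..} H"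
proof -
  define k where "k s = of_real ((1 + V s) * s powr (c - \<alpha>)) * h s" for s
  have hm [measurable]: "h \<in> borel_measurable halfline" using L2_measurable[OF h] by simp
  have km [measurable]: "k \<in> borel_measurable halfline" unfolding k_def[abs_def] by measurable
  have kint: "integrable halfline (\<lambda>s. indicator {0..b} s *\<^sub>R k s)" for b
    unfolding k_def by (rule potential_integrable[OF h])
  show Hc: "continuous_on {0<..} H"
    unfolding H_def using continuous_on_cumulative[OF kint] by (simp add: k_def)
  have "continuous_on {0<..} (\<lambda>y. of_real (y powr (- c)) * H y)"
    by (intro continuous_on_mult Hc smooth_on_imp_continuous_on smooth_on_powr)
  then have loc: "locally_integrable (\<lambda>y. of_real (y powr (- c)) * H y)"
    by (rule continuous_on_locally_integrable)
  have hloc: "locally_integrable h" by (rule L2_wmeas_locally_integrable[OF h])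
  have "(LINT y|halfline. h y * vector_derivative \<phi> (at y)) = - (LINT y|halfline. of_real (y powr (- c)) * H y * \<phi> y)"
    if \<phi>: "\<phi> \<in> test_functions" for \<phi>
  proof -
    define \<eta> where "\<eta> y = cnj (\<phi> y)" for y
    have \<eta>: "\<eta> \<in> test_functions" unfolding \<eta>_def[abs_def] by (rule test_function_cnj[OF \<phi>])
    define \<psi> where "\<psi> y = of_real (y powr (- c)) * \<eta> y" for y
    have \<psi>: "\<psi> \<in> test_functions" unfolding \<psi>_def[abs_def] by (intro test_function_mult \<eta> smooth_on_powr)
    obtain u b where u: "u \<in> core_functions" "\<And>y. 0 < y \<Longrightarrow> (u has_vector_derivative \<psi> y) (at y)" "0 < b"
      "\<And>y. b \<le> y \<Longrightarrow> \<psi> y = 0" "\<And>y. b \<le> y \<Longrightarrow> u y = 0"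
      by (rule core_function_of_deriv[OF \<psi>]) blast
    note N = core_neumann[OF u(1) \<eta> u(2)[unfolded \<psi>_def]]
    have deriv: "vector_derivative \<eta> (at y) = cnj (vector_derivative \<phi> (at y))" if "0 < y" for y
    proof -
      have "(\<phi> has_vector_derivative vector_derivative \<phi> (at y)) (at y)"
        using \<phi> that by (intro smooth_on_deriv) (auto simp: test_functions_def)
      from has_vector_derivative_cnj[OF this] show ?thesis
        unfolding \<eta>_def[abs_def] by (rule vector_derivative_at)
    qed
    have um: "u \<in> borel_measurable halfline" and gm: "core_image u \<eta> \<in> borel_measurable halfline"
      using L2_measurable[OF N(2)] L2_measurable[OF N(3)] by simp_all
    have "(\<lambda>y. u y - core_image u \<eta> y) \<in> borel_measurable halfline" using um gm by (rule borel_measurable_diff)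
    from measurable_compose[OF this borel_measurable_cnj]
    have "(\<lambda>y. h y * cnj (u y - core_image u \<eta> y)) \<in> borel_measurable halfline" using hm by (intro borel_measurable_times)
    from integral_wmeas[OF this, of "c - \<alpha>"] orth[OF N(1) u(1)]
    have "0 = (LINT y|halfline. y powr (c - \<alpha>) *\<^sub>R (h y * cnj (u y - core_image u \<eta> y)))" by simp
    also have "\<dots> = (LINT y|halfline. k y * cnj (u y) - h y * vector_derivative \<phi> (at y))"
    proof (rule Bochner_Integration.integral_cong[OF refl])
      fix y assume "y \<in> space halfline"
      then have y: "0 < y" by simp
      then have "complex_of_real (y powr (c - \<alpha>)) * of_real (y powr (\<alpha> - c)) = 1"
        by (simp add: powr_add[symmetric] flip: of_real_mult)
      moreover have "X * (h y * (cu - (Y * p' - v * cu))) = ((1 + v) * X * h y) * cu - (X * Y) * (h y * p')" for X Y v cu p' :: complex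
        by (simp add: algebra_simps)
      ultimately show "y powr (c - \<alpha>) *\<^sub>R (h y * cnj (u y - core_image u \<eta> y)) = k y * cnj (u y) - h y * vector_derivative \<phi> (at y)"
        by (simp add: core_image_def deriv[OF y] k_def scaleR_conv_of_real)
    qed
    also have "\<dots> = (LINT y|halfline. k y * cnj (u y)) - (LINT y|halfline. h y * vector_derivative \<phi> (at y))"
    proof (rule Bochner_Integration.integral_diff)
      show "integrable halfline (\<lambda>y. h y * vector_derivative \<phi> (at y))"
        by (rule integrable_mult_test_function[OF hloc test_function_deriv[OF \<phi>]])
      obtain C where C: "\<And>y. 0 < y \<Longrightarrow> cmod (u y) \<le> C" by (rule core_function_bounds[OF u(1)]) blast
      show "integrable halfline (\<lambda>y. k y * cnj (u y))"
      proof (rule Bochner_Integration.integrable_bound)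
        show "integrable halfline (\<lambda>y. C * norm (indicator {0..b} y *\<^sub>R k y))"
          by (intro integrable_mult_right integrable_norm kint)
        show "(\<lambda>y. k y * cnj (u y)) \<in> borel_measurable halfline"
          by (rule borel_measurable_times[OF km measurable_compose[OF um borel_measurable_cnj]])
        show "AE y in halfline. norm (k y * cnj (u y)) \<le> norm (C * norm (indicator {0..b} y *\<^sub>R k y))"
          using AE_halfline_positive
        proof eventually_elim
          case (elim y)
          have "0 \<le> C" using C[OF elim] norm_ge_zero order_trans by blast
          moreover have "norm (k y) * cmod (u y) \<le> norm (k y) * C" by (rule mult_left_mono[OF C[OF elim]]) simp
          ultimately show ?case using elim u(5)[of y]
            by (cases "y \<le> b") (auto simp: norm_mult abs_mult mult.commute)
        qed
      qed
    qed
    also have "(LINT y|halfline. k y * cnj (u y)) = - (LINT s|halfline. (LINT y|halfline. indicator {0..s} y *\<^sub>R k y) * cnj (\<psi> s))"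
    proof (rule integral_cumulative_by_parts[OF km kint test_function_cnj[OF \<psi>]])
      show "((\<lambda>y. cnj (u y)) has_vector_derivative cnj (\<psi> y)) (at y)" if "0 < y" for y
        using u(2)[OF that] by (rule has_vector_derivative_cnj)
      show "cnj (\<psi> y) = 0" "cnj (u y) = 0" if "b \<le> y" for y using u(4,5)[OF that] by simp_all
    qed
    also have "(LINT s|halfline. (LINT y|halfline. indicator {0..s} y *\<^sub>R k y) * cnj (\<psi> s)) = (LINT y|halfline. of_real (y powr (- c)) * H y * \<phi> y)"
      by (simp add: H_def k_def \<psi>_def \<eta>_def mult_ac)
    finally show ?thesis by (simp add: eq_diff_eq)
  qed
  then show "has_weak_deriv h (\<lambda>y. of_real (y powr (- c)) * H y)"
    using loc hloc by (simp add: has_weak_deriv_iff)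
qed

text \<open>A primitive of the continuous function y^(-c) H differs from h by a constant (du
  Bois-Reymond), so h has a differentiable representative h1. As V is real, real and imaginary part
  of h1 solve the real equation separately.\<close>

lemma orthogonal_to_residuals_eq_0:
  assumes h: "h \<in> L2 \<mu>"
    and orth: "\<And>u g. (u, g) \<in> neumann_op \<alpha> c V \<Longrightarrow> u \<in> core_functions \<Longrightarrow> (LINT y|\<mu>. h y * cnj (u y - g y)) = 0"
  shows "AE y in halfline. h y = 0"
proof -
  define H where "H y = (LINT s|halfline. indicator {0..y} s *\<^sub>R (of_real ((1 + V s) * s powr (c - \<alpha>)) * h s))" for y
  have wd: "has_weak_deriv h (\<lambda>y. of_real (y powr (- c)) * H y)" and Hc: "continuous_on {0<..} H"
    using orthogonal_weak_deriv[OF h orth] by (simp_all add: H_def[abs_def])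
  have wc: "continuous_on {0<..} (\<lambda>y. of_real (y powr (- c)) * H y)"
    by (intro continuous_on_mult Hc smooth_on_imp_continuous_on smooth_on_powr)
  obtain G where G: "\<And>y. 0 < y \<Longrightarrow> (G has_vector_derivative of_real (y powr (- c)) * H y) (at y)"
    by (rule antiderivative_on_halfline[OF wc]) blast
  have wd0: "has_weak_deriv (\<lambda>y. 1 * h y + (-1) * G y) (\<lambda>y. 1 * (of_real (y powr (- c)) * H y) + (-1) * (of_real (y powr (- c)) * H y))"
    by (rule has_weak_deriv_lincomb[OF wd has_weak_deriv_C1[OF G wc]])
  have "\<exists>C. AE y in halfline. 1 * h y + (-1) * G y = C"
    by (rule du_Bois_Reymond) (use wd0 in \<open>simp_all add: has_weak_deriv_iff\<close>)
  then obtain C where C: "AE y in halfline. 1 * h y + (-1) * G y = C" by blast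
  define h1 where "h1 y = G y + C" for y
  have ae: "AE y in halfline. h y = h1 y" using C by eventually_elim (auto simp: h1_def algebra_simps)
  have hm: "h \<in> borel_measurable halfline" using L2_measurable[OF h] by simp
  have h1d: "(h1 has_vector_derivative of_real (y powr (- c)) * H y) (at y)" if "0 < y" for y
    using has_vector_derivative_add[OF G[OF that] has_vector_derivative_const[of C]] by (simp add: h1_def[abs_def])
  have "continuous_on {0<..} h1"
    using h1d by (intro continuous_at_imp_continuous_on) (auto intro: has_vector_derivative_continuous)
  then have h1m: "h1 \<in> borel_measurable halfline" by (intro continuous_imp_measurable_on_sets_lebesgue) auto
  have h1L: "h1 \<in> L2 \<mu>" by (rule L2_wmeas_cong_AE[OF h h1m ae])
  \<comment> \<open>Changing h on a null set does not change H, so h1 and H satisfy the integrated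
    equation at every point.\<close>
  have H1: "H y = (LINT s|halfline. indicator {0..y} s *\<^sub>R (of_real ((1 + V s) * s powr (c - \<alpha>)) * h1 s))" for y
    unfolding H_def
    by (rule integral_cong_AE) (use ae potential_integrable[OF h] potential_integrable[OF h1L] in \<open>auto elim: eventually_mono\<close>)
  have sq: "integrable halfline (\<lambda>s. s powr (c - \<alpha>) * (cmod (h1 s))\<^sup>2)"
    using L2_square_integrable[OF h1L] h1m by (subst (asm) integrable_wmeas) auto
  \<comment> \<open>Re and Im are treated together: each is bounded by the modulus, real linear and
    compatible with real factors, hence passes through derivative and integral.\<close>
  have part: "f (h1 y) = 0" if f: "f = Re \<or> f = Im" and y: "0 < y" for f y
  proof -
    have fl: "bounded_linear f" using f bounded_linear_Re bounded_linear_Im by blast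
    have fle: "\<bar>f z\<bar> \<le> cmod z" for z using f abs_Re_le_cmod abs_Im_le_cmod by auto
    have fmult: "f (of_real a * z) = a * f z" for a z using f by auto
    have fm: "(\<lambda>s. f (h1 s)) \<in> borel_measurable halfline"
      using f h1m by auto
    have fI: "(\<lambda>s. f (indicator {0..y} s *\<^sub>R (of_real ((1 + V s) * s powr (c - \<alpha>)) * h1 s)))
        = (\<lambda>s. indicator {0..y} s * ((1 + V s) * s powr (c - \<alpha>) * f (h1 s)))" for y
      by (rule ext) (simp only: scaleR_conv_of_real fmult)
    have "ode_solution c (c - \<alpha>) V (\<lambda>y. f (h1 y)) (\<lambda>y. f (H y))"
      unfolding ode_solution_def
    proof (intro conjI allI impI)
      fix y :: real assume y: "0 < y"
      have "((\<lambda>y. f (h1 y)) has_vector_derivative f (of_real (y powr (- c)) * H y)) (at y)"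
        by (rule bounded_linear.has_vector_derivative[OF fl h1d[OF y]])
      then show "((\<lambda>y. f (h1 y)) has_real_derivative y powr (- c) * f (H y)) (at y)"
        by (simp only: fmult has_real_derivative_iff_has_vector_derivative)
      show "integrable halfline (\<lambda>s. indicator {0..y} s * ((1 + V s) * s powr (c - \<alpha>) * f (h1 s)))"
        using integrable_bounded_linear[OF fl potential_integrable[OF h1L, of y]] unfolding fI .
      show "f (H y) = (LINT s|halfline. indicator {0..y} s * ((1 + V s) * s powr (c - \<alpha>) * f (h1 s)))"
        unfolding H1 using integral_bounded_linear[OF fl potential_integrable[OF h1L, of y]] unfolding fI by simp
    next
      show "integrable halfline (\<lambda>s. s powr (c - \<alpha>) * (f (h1 s))\<^sup>2)"
      proof (rule Bochner_Integration.integrable_bound[OF sq])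
        show "(\<lambda>s. s powr (c - \<alpha>) * (f (h1 s))\<^sup>2) \<in> borel_measurable halfline" using fm by measurable
        show "AE s in halfline. norm (s powr (c - \<alpha>) * (f (h1 s))\<^sup>2) \<le> norm (s powr (c - \<alpha>) * (cmod (h1 s))\<^sup>2)"
        proof (rule AE_I2)
          fix s
          have "(f (h1 s))\<^sup>2 \<le> (cmod (h1 s))\<^sup>2" using power_mono[OF fle[of "h1 s"], of 2] by simp
          then show "norm (s powr (c - \<alpha>) * (f (h1 s))\<^sup>2) \<le> norm (s powr (c - \<alpha>) * (cmod (h1 s))\<^sup>2)"
            by (simp add: mult_left_mono)
        qed
      qed
    qed
    then show ?thesis
      by (rule ode_solution_eq_0[OF _ V_nonneg _ y]) (use weight in simp)
  qed
  have h1_0: "h1 y = 0" if "0 < y" for y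
    using part[of Re y] part[of Im y] that by (simp add: complex_eq_iff)
  show ?thesis using ae AE_halfline_positive by eventually_elim (simp add: h1_0)
qed

text \<open>Density is tested in the real Hilbert space, but the residuals are invariant under i, so
  real orthogonality to all of them is complex orthogonality.\<close>

lemma closure_core_residuals: "closure core_residuals = UNIV"
proof (rule dense_if_orthogonal_zero[OF subspace_core_residuals])
  fix x assume x: "\<And>y. y \<in> core_residuals \<Longrightarrow> inner x y = 0"
  have "AE y in halfline. dec (c - \<alpha>) x y = 0"
  proof (rule orthogonal_to_residuals_eq_0[OF dec_L2])
    fix u g assume ug: "(u, g) \<in> neumann_op \<alpha> c V" and u: "u \<in> core_functions"
    note L = neumann_op_L2[OF ug]
    have 1: "inner x (enc (c - \<alpha>) u - enc (c - \<alpha>) g) = 0"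
      by (rule x) (use ug u in \<open>auto simp: core_residuals_def\<close>)
    have "(\<lambda>y. \<i> * u y + 0 * u y, \<lambda>y. \<i> * g y + 0 * g y) \<in> neumann_op \<alpha> c V" "(\<lambda>y. \<i> * u y + 0 * u y) \<in> core_functions"
      by (rule neumann_op_lincomb[OF ug ug], rule core_functions_lincomb[OF u u])
    then have "inner x (enc (c - \<alpha>) (\<lambda>y. \<i> * u y) - enc (c - \<alpha>) (\<lambda>y. \<i> * g y)) = 0"
      by (intro x) (auto simp: core_residuals_def)
    then have 2: "inner x (l2h_mult_i (enc (c - \<alpha>) u - enc (c - \<alpha>) g)) = 0"
      using L by (simp add: enc_mult_i linear_diff[OF bounded_linear.linear[OF bounded_linear_l2h_mult_i]])
    show "(LINT y|\<mu>. dec (c - \<alpha>) x y * cnj (u y - g y)) = 0"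
      using integral_cnj_enc[OF dec_L2 L2_diff[OF L], of x] 1 2 L
      by (simp add: enc_dec enc_diff complex_eq_iff)
  qed
  then have "enc (c - \<alpha>) (dec (c - \<alpha>) x) = enc (c - \<alpha>) (\<lambda>_. 0)"
    by (subst enc_eq_iff[OF dec_L2 L2_0])
  also have "\<dots> = 0" using enc_diff[OF L2_0 L2_0, of "c - \<alpha>"] by simp
  finally show "x = 0" by (simp add: enc_dec)
qed

lemma norm_resolvent_le: "norm (resolvent x) \<le> norm x"
proof -
  have "norm (fst (orth_proj K (x, 0))) \<le> norm (orth_proj K (x, 0))"
    by (metis norm_fst_le prod.collapse)
  also have "\<dots> \<le> norm (x, 0 :: l2h \<times> l2h)" by (rule norm_orth_proj[OF subspace_K closed_K])
  finally show ?thesis by (simp add: resolvent_apply norm_Pair)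
qed

text \<open>If a residual v - h is close to u - g, then u - v is close to 0 because R is a
  contraction, and g - h is the difference of these two small quantities; hence the tolerance e /
  2.\<close>

theorem core_functions_is_core: "is_core \<mu> (neumann_op \<alpha> c V) core_functions"
  unfolding is_core_def
proof (intro conjI ballI allI impI subsetI; clarify?)
  show "u \<in> Domain (neumann_op \<alpha> c V)" if "u \<in> core_functions" for u by (rule core_in_Domain[OF that])
  fix u g and e :: real assume ug: "(u, g) \<in> neumann_op \<alpha> c V" and e: "0 < e"
  note L = neumann_op_L2[OF ug]
  let ?f = "enc (c - \<alpha>) u - enc (c - \<alpha>) g"
  have "?f \<in> closure core_residuals" by (simp add: closure_core_residuals)
  then obtain z where z: "z \<in> core_residuals" "dist z ?f < e / 2"
    using e by (metis closure_approachable half_gt_zero)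
  then obtain v h where vh: "z = enc (c - \<alpha>) v - enc (c - \<alpha>) h" "(v, h) \<in> neumann_op \<alpha> c V" "v \<in> core_functions"
    unfolding core_residuals_def by blast
  note L' = neumann_op_L2[OF vh(2)]
  have "enc (c - \<alpha>) u - enc (c - \<alpha>) v = resolvent (?f - z)"
    using neumann_op_iff[OF L] neumann_op_iff[OF L'] ug vh by (simp add: blinfun.diff_right)
  then have 1: "norm (enc (c - \<alpha>) u - enc (c - \<alpha>) v) < e / 2"
    using norm_resolvent_le[of "?f - z"] z(2) by (simp add: dist_norm norm_minus_commute)
  have "enc (c - \<alpha>) g - enc (c - \<alpha>) h = (enc (c - \<alpha>) u - enc (c - \<alpha>) v) - (?f - z)" by (simp add: vh(1))
  then have "norm (enc (c - \<alpha>) g - enc (c - \<alpha>) h) \<le> norm (enc (c - \<alpha>) u - enc (c - \<alpha>) v) + norm (?f - z)"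
    by (simp only: norm_triangle_ineq4)
  also have "\<dots> < e" using 1 z(2) by (simp add: dist_norm norm_minus_commute)
  finally show "\<exists>(v, h)\<in>neumann_op \<alpha> c V. v \<in> core_functions \<and> l2norm \<mu> (\<lambda>x. u x - v x) < e \<and> l2norm \<mu> (\<lambda>x. g x - h x) < e"
    using 1 e vh by (intro bexI[of _ "(v, h)"]) (auto simp: l2norm_diff L L')
qed

end

text \<open>For s \<le> 0 one has y^(-s) \<le> b^(-s) on (0, b]: the weight y^s is bounded below
  there, and dividing by it costs only a constant.\<close>

lemma Lq_loc_2_singular:
  assumes s: "s \<le> 0" and V: "V \<in> borel_measurable (wmeas k)" and W: "(\<lambda>y. V y * y powr s) \<in> Lq_loc 2 k"
  shows "V \<in> Lq_loc 2 k"
  unfolding Lq_loc_def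
proof (intro CollectI conjI allI impI)
  fix b :: real assume b: "0 < b"
  have [measurable]: "V \<in> borel_measurable halfline" using V by simp
  have W': "integrable (wmeas k) (\<lambda>y. indicator {0..b} y *\<^sub>R (\<bar>V y * y powr s\<bar> powr 2))"
    using W b unfolding Lq_loc_def set_integrable_def by blast
  have "integrable (wmeas k) (\<lambda>y. indicator {0..b} y *\<^sub>R (\<bar>V y\<bar> powr 2))"
  proof (rule Bochner_Integration.integrable_bound)
    show "integrable (wmeas k) (\<lambda>y. (b powr (- s)) powr 2 * (indicator {0..b} y *\<^sub>R (\<bar>V y * y powr s\<bar> powr 2)))"
      by (rule integrable_mult_right[OF W'])
    show "(\<lambda>y. indicator {0..b} y *\<^sub>R (\<bar>V y\<bar> powr 2)) \<in> borel_measurable (wmeas k)"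
      unfolding measurable_wmeas by measurable
    show "AE y in wmeas k. norm (indicator {0..b} y *\<^sub>R (\<bar>V y\<bar> powr 2))
        \<le> norm ((b powr (- s)) powr 2 * (indicator {0..b} y *\<^sub>R (\<bar>V y * y powr s\<bar> powr 2)))"
      unfolding AE_wmeas_iff using AE_halfline_positive
    proof eventually_elim
      case (elim y)
      show ?case
      proof (cases "y \<le> b")
        case True
        have "y powr (- s) \<le> b powr (- s)" using True elim s by (intro powr_mono2) auto
        moreover have "y powr (- s) * y powr s = 1" using elim by (simp add: powr_add[symmetric])
        ultimately have "1 \<le> b powr (- s) * y powr s" by (metis mult_right_mono powr_ge_zero)
        then have "1 * \<bar>V y\<bar> \<le> (b powr (- s) * y powr s) * \<bar>V y\<bar>" by (rule mult_right_mono) simp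
        then have "\<bar>V y\<bar> powr 2 \<le> (b powr (- s) * \<bar>V y * y powr s\<bar>) powr 2"
          by (intro powr_mono2) (auto simp: abs_mult mult_ac)
        also have "\<dots> = (b powr (- s)) powr 2 * \<bar>V y * y powr s\<bar> powr 2" by (rule powr_mult)
        finally show ?thesis using True elim by simp
      qed auto
    qed
  qed
  then show "set_integrable (wmeas k) {0..b} (\<lambda>y. \<bar>V y\<bar> powr 2)" by (simp add: set_integrable_def)
qed (rule V)

theorem proposition6p1:
  fixes \<alpha> c :: real and V :: "real \<Rightarrow> real"
  assumes "\<alpha> < 2" and "c + 1 - \<alpha> > 0"
    and "AE y in wmeas (c - \<alpha>). 0 \<le> V y"
    and "V \<in> Lq_loc 1 (c - \<alpha>)"
  shows "generates_contractive_analytic_semigroup (wmeas (c - \<alpha>)) (neumann_op \<alpha> c V) \<and>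
    ((c < 3 - \<alpha> \<and> V \<in> Lq_loc 2 (c - \<alpha>)) \<or>
     (c = 3 - \<alpha> \<and> V \<in> Lq_loc 2 (c - \<alpha>) \<and>
        (\<lambda>y. V y * \<bar>ln y\<bar> powr (1/2)) \<in> Lq_loc 2 (c - \<alpha>)) \<or>
     (c > 3 - \<alpha> \<and> (\<lambda>y. V y * y powr ((3 - c - \<alpha>) / 2)) \<in> Lq_loc 2 (c - \<alpha>))
     \<longrightarrow> is_core (wmeas (c - \<alpha>)) (neumann_op \<alpha> c V) core_functions)"
proof (intro conjI impI)
  interpret weighted_form \<alpha> c V
    by unfold_locales (use assms in auto)
  show "generates_contractive_analytic_semigroup (wmeas (c - \<alpha>)) (neumann_op \<alpha> c V)" by (rule generates)
  assume *: "(c < 3 - \<alpha> \<and> V \<in> Lq_loc 2 (c - \<alpha>)) \<or>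
     (c = 3 - \<alpha> \<and> V \<in> Lq_loc 2 (c - \<alpha>) \<and>
        (\<lambda>y. V y * \<bar>ln y\<bar> powr (1/2)) \<in> Lq_loc 2 (c - \<alpha>)) \<or>
     (c > 3 - \<alpha> \<and> (\<lambda>y. V y * y powr ((3 - c - \<alpha>) / 2)) \<in> Lq_loc 2 (c - \<alpha>))"
  \<comment> \<open>In case (iii) the exponent (3 - c - \<alpha>) / 2 is negative, so the weight is
    singular at 0 and can be divided out. In case (ii) the membership is part of the assumption: the
    logarithmic weight vanishes at y = 1 and by itself gives no control of V there.\<close>
  have V2: "V \<in> Lq_loc 2 (c - \<alpha>)"
  proof (cases "3 - \<alpha> < c")
    case True
    then have W: "(\<lambda>y. V y * y powr ((3 - c - \<alpha>) / 2)) \<in> Lq_loc 2 (c - \<alpha>)"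
      using * by (elim disjE conjE) simp_all
    show ?thesis
      by (rule Lq_loc_2_singular[OF _ _ W]) (use True V_measurable in simp_all)
  next
    case False
    then show ?thesis using * by (elim disjE conjE) simp_all
  qed
  interpret weighted_form_L2 \<alpha> c V by unfold_locales (rule V2)
  show "is_core (wmeas (c - \<alpha>)) (neumann_op \<alpha> c V) core_functions" by (rule core_functions_is_core)
qed

end
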